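(* Let $d\ge 1$, $0\le m\le d$, $p\in(d,\infty]$, $p'=p/(p-1)$, $K=(-1,1)^d$ and $C=\mathbb{R}^d_{m,+}=\mathbb{R}_+^m\times\mathbb{R}^{d-m}$. For every $h>0$ and every function $f\in L_\infty(C)$ such that $\partial_{\bf I}f\in W^{1,p}(C)$, the following inequality holds: $$\|\partial_{\bf I}f\|_{L_\infty(C)}\le A(d,p)\,h^{1-\frac dp}\,2^{\frac{m-d}{p}}\,\big\||\nabla\partial_{\bf I}f|_{K^\circ}\big\|_{L_p(C)}+2^m h^{-d}\|f\|_{L_\infty(C)}, \tag{1}$$ where $$A(d,p)=d^{-1}B^{\frac1{p'}}\left(1-\frac{(d-1)p'}{d},\,p'+1\right).$$ It can be rewritten in the following multiplicative form: $$\|\partial_{\bf I}f\|_{L_\infty(C)}\le a(d,p)\,2^{\alpha\left(\frac md-\frac dp\right)}\,\|f\|_{L_\infty(C)}^{1-\alpha}\,\big\||\nabla\partial_{\bf I}f|_{K^\circ}\big\|_{L_p(C)}^{\alpha}, \tag{2}$$ where $$\alpha=\frac{pd}{p+(p-1)d},\qquad a(d,p)=\left(\frac{(p-d)A(d,p)}{pd}\right)^{\alpha}\left(\frac{pd}{p-d}+1\right).$$ For $m=0$ and $m=1$ inequalities (1) (for each $h>0$) and (2) are sharp.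
   Context: $\mathbb{R}_+=(0,\infty)$. For a locally integrable function $f\colon C\to\mathbb{R}$, with ${\bf I}=(1,\ldots,1)\in\mathbb{R}^d$, $\partial_{\bf I}f=\dfrac{\partial^d f}{\partial x_1\cdots\partial x_d}$ is the mixed derivative, understood in the distributional sense; $\nabla$ denotes the distributional gradient. $W^{1,p}(C)$ is the Sobolev space of (locally integrable) functions on $C$ all of whose first-order distributional derivatives belong to $L_p(C)$. For $K=(-1,1)^d$, $|x|_K=\inf\{\lambda>0: x\in\lambda K\}=\max\{|x_1|,\ldots,|x_d|\}$, and the dual norm is $|z|_{K^\circ}=\sup\{(x,z): |x|_K\le1\}$, where $(x,z)$ is the dot product. $B(\cdot,\cdot)$ is the Euler beta function, and $B^{1/p'}(\cdot,\cdot)$ is its value raised to the power $1/p'$. For $p=\infty$ one has $p'=1$, $1/p=0$, and the expressions for $\alpha$ and $a(d,p)$ are understood as limits as $p\to\infty$. An inequality is called sharp if there is an admissible function $f$ for which it becomes an equality with both sides nonzero. *)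

theory Defs
  imports "HOL-Analysis.Analysis" "HOL-Probability.Essential_Supremum"
begin

section \<open>The domain and the norms on \<open>\<real>\<^sup>d\<close>\<close>

text \<open>
  Points of \<open>\<real>\<^sup>d\<close> have type \<open>real ^ 'n\<close> with \<open>d = CARD('n)\<close>. The linear order on \<open>'n\<close> provides
  the numbering of the coordinates: an index is among the first \<open>m\<close> ones iff fewer than \<open>m\<close>
  indices precede it.
\<close>

definition orthant :: "nat \<Rightarrow> (real ^ 'n::{finite,linorder}) set" where
  "orthant m = {x. \<forall>i. card {..<i} < m \<longrightarrow> 0 < x $ i}"

definition cube :: "(real ^ 'n) set" where
  "cube = {x. \<forall>i. - 1 < x $ i \<and> x $ i < 1}"

definition cube_norm :: "real ^ 'n \<Rightarrow> real" where
  "cube_norm x = Inf {l. 0 < l \<and> x \<in> (\<lambda>y. l *\<^sub>R y) ` cube}"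

definition cube_dual_norm :: "real ^ 'n \<Rightarrow> real" where
  "cube_dual_norm z = (SUP x\<in>{x. cube_norm x \<le> 1}. x \<bullet> z)"


section \<open>Lebesgue spaces\<close>

text \<open>
  Exponents are extended reals, as \<open>p = \<infinity>\<close> is allowed. The norm is real-valued, hence only
  meaningful for members of the space; finiteness is always stated by \<open>in_Lp\<close>.
\<close>

definition in_Lp :: "ereal \<Rightarrow> (real ^ 'n) set \<Rightarrow> (real ^ 'n \<Rightarrow> real) \<Rightarrow> bool" where
  "in_Lp p C f \<longleftrightarrow> f \<in> borel_measurable (lebesgue_on C) \<and>
     (if p = \<infinity> then esssup (lebesgue_on C) (\<lambda>x. ereal \<bar>f x\<bar>) < \<infinity>
      else integrable (lebesgue_on C) (\<lambda>x. \<bar>f x\<bar> powr real_of_ereal p))"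

definition Lp_norm :: "ereal \<Rightarrow> (real ^ 'n) set \<Rightarrow> (real ^ 'n \<Rightarrow> real) \<Rightarrow> real" where
  "Lp_norm p C f =
     (if p = \<infinity> then real_of_ereal (esssup (lebesgue_on C) (\<lambda>x. ereal \<bar>f x\<bar>))
      else (LINT x|lebesgue_on C. \<bar>f x\<bar> powr real_of_ereal p) powr (1 / real_of_ereal p))"

definition locally_integrable :: "(real ^ 'n) set \<Rightarrow> (real ^ 'n \<Rightarrow> real) \<Rightarrow> bool" where
  "locally_integrable C f \<longleftrightarrow> (\<forall>K. compact K \<and> K \<subseteq> C \<longrightarrow> f absolutely_integrable_on K)"


section \<open>Distributional derivatives\<close>

definition partial :: "'n \<Rightarrow> (real ^ 'n \<Rightarrow> real) \<Rightarrow> real ^ 'n \<Rightarrow> real" where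
  "partial i \<phi> x = deriv (\<lambda>t. \<phi> (x + t *\<^sub>R axis i 1)) 0"

definition partials :: "'n list \<Rightarrow> (real ^ 'n \<Rightarrow> real) \<Rightarrow> real ^ 'n \<Rightarrow> real" where
  "partials is \<phi> = foldr partial is \<phi>"

text \<open>\<open>C\<^sup>\<infinity>\<close>: all iterated partial derivatives exist and are continuous.\<close>

definition smooth :: "(real ^ 'n \<Rightarrow> real) \<Rightarrow> bool" where
  "smooth \<phi> \<longleftrightarrow> (\<forall>is. continuous_on UNIV (partials is \<phi>) \<and>
     (\<forall>i x. (\<lambda>t. partials is \<phi> (x + t *\<^sub>R axis i 1)) differentiable at 0))"

definition test_function :: "(real ^ 'n) set \<Rightarrow> (real ^ 'n \<Rightarrow> real) \<Rightarrow> bool" where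
  "test_function C \<phi> \<longleftrightarrow> smooth \<phi> \<and>
     compact (closure {x. \<phi> x \<noteq> 0}) \<and> closure {x. \<phi> x \<noteq> 0} \<subseteq> C"

definition has_weak_partials ::
  "(real ^ 'n) set \<Rightarrow> 'n list \<Rightarrow> (real ^ 'n \<Rightarrow> real) \<Rightarrow> (real ^ 'n \<Rightarrow> real) \<Rightarrow> bool" where
  "has_weak_partials C is f g \<longleftrightarrow> locally_integrable C f \<and> locally_integrable C g \<and>
     (\<forall>\<phi>. test_function C \<phi> \<longrightarrow>
        (LINT x:C|lebesgue. f x * partials is \<phi> x) =
        (- 1) ^ length is * (LINT x:C|lebesgue. g x * \<phi> x))"

definition has_mixed_deriv ::
  "(real ^ 'n::{finite,linorder}) set \<Rightarrow>
    (real ^ 'n::{finite,linorder} \<Rightarrow> real) \<Rightarrow>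
    (real ^ 'n::{finite,linorder} \<Rightarrow> real) \<Rightarrow> bool" where
  "has_mixed_deriv C f g \<longleftrightarrow> has_weak_partials C (sorted_list_of_set UNIV) f g"

definition has_weak_gradient ::
  "(real ^ 'n) set \<Rightarrow> (real ^ 'n \<Rightarrow> real) \<Rightarrow> (real ^ 'n \<Rightarrow> real ^ 'n) \<Rightarrow> bool" where
  "has_weak_gradient C g G \<longleftrightarrow> (\<forall>i. has_weak_partials C [i] g (\<lambda>x. G x $ i))"

text \<open>Membership in \<open>W\<^sup>1\<^sup>,\<^sup>p(C)\<close>; the function itself is not required to lie in \<open>L\<^sub>p(C)\<close>.\<close>

definition in_W1 :: "ereal \<Rightarrow> (real ^ 'n) set \<Rightarrow> (real ^ 'n \<Rightarrow> real) \<Rightarrow> bool" where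
  "in_W1 p C g \<longleftrightarrow> locally_integrable C g \<and>
     (\<exists>G. has_weak_gradient C g G \<and> (\<forall>i. in_Lp p C (\<lambda>x. G x $ i)))"


section \<open>Constants\<close>

definition recip :: "ereal \<Rightarrow> real" where
  "recip p = (if p = \<infinity> then 0 else 1 / real_of_ereal p)"

definition conj_exp :: "ereal \<Rightarrow> real" where
  "conj_exp p = (if p = \<infinity> then 1 else real_of_ereal p / (real_of_ereal p - 1))"

definition const_A :: "nat \<Rightarrow> ereal \<Rightarrow> real" where
  "const_A d p = (1 / real d) *
     Beta (1 - (real d - 1) * conj_exp p / real d) (conj_exp p + 1) powr (1 / conj_exp p)"

definition extend_to_infinity :: "(real \<Rightarrow> real) \<Rightarrow> ereal \<Rightarrow> real" where
  "extend_to_infinity F p = (if p = \<infinity> then Lim at_top F else F (real_of_ereal p))"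

definition alpha :: "nat \<Rightarrow> ereal \<Rightarrow> real" where
  "alpha d = extend_to_infinity (\<lambda>q. q * real d / (q + (q - 1) * real d))"

definition const_a :: "nat \<Rightarrow> ereal \<Rightarrow> real" where
  "const_a d = extend_to_infinity (\<lambda>q.
     ((q - real d) * const_A d (ereal q) / (q * real d)) powr alpha d (ereal q) *
     (q * real d / (q - real d) + 1))"


section \<open>Admissible functions and the two bounds\<close>

text \<open>
  \<open>g\<close> and \<open>G\<close> are representatives of \<open>\<partial>\<^sub>I f\<close> and \<open>\<nabla>\<partial>\<^sub>I f\<close>, which are determined by \<open>f\<close>
  almost everywhere on \<open>C\<close>.
\<close>

definition admissible :: "(real ^ 'n::{finite,linorder}) set \<Rightarrow> ereal \<Rightarrow>
    (real ^ 'n::{finite,linorder} \<Rightarrow> real) \<Rightarrow>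
    (real ^ 'n::{finite,linorder} \<Rightarrow> real) \<Rightarrow>
    (real ^ 'n::{finite,linorder} \<Rightarrow> real ^ 'n::{finite,linorder}) \<Rightarrow> bool" where
  "admissible C p f g G \<longleftrightarrow>
     in_Lp \<infinity> C f \<and> has_mixed_deriv C f g \<and> in_W1 p C g \<and> has_weak_gradient C g G"

definition additive_bound :: "nat \<Rightarrow> ereal \<Rightarrow> real \<Rightarrow>
    (real ^ 'n::{finite,linorder} \<Rightarrow> real) \<Rightarrow>
    (real ^ 'n::{finite,linorder} \<Rightarrow> real ^ 'n::{finite,linorder}) \<Rightarrow> real" where
  "additive_bound m p h f G =
     const_A CARD('n) p * h powr (1 - real CARD('n) * recip p) *
       2 powr ((real m - real CARD('n)) * recip p) *
       Lp_norm p (orthant m) (\<lambda>x. cube_dual_norm (G x))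
     + 2 ^ m * h powr (- real CARD('n)) * Lp_norm \<infinity> (orthant m) f"

definition multiplicative_bound :: "nat \<Rightarrow> ereal \<Rightarrow>
    (real ^ 'n::{finite,linorder} \<Rightarrow> real) \<Rightarrow>
    (real ^ 'n::{finite,linorder} \<Rightarrow> real ^ 'n::{finite,linorder}) \<Rightarrow> real" where
  "multiplicative_bound m p f G =
     const_a CARD('n) p *
       2 powr (alpha CARD('n) p * (real m / real CARD('n) - real CARD('n) * recip p)) *
       Lp_norm \<infinity> (orthant m) f powr (1 - alpha CARD('n) p) *
       Lp_norm p (orthant m) (\<lambda>x. cube_dual_norm (G x)) powr alpha CARD('n) p"

end

(* A value g(x) of g = d_I f is compared with the average of g over the box x + Q, where Q is the part of
   the cube hK in the closed orthant. The integral of d_I f over a box is an alternating sum of the 2^d corner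
   values of f, so the average is at most 2^d |f| / |Q|; the difference of g(x) and the average is an integral
   of grad g against a radial kernel, which Hoelder's inequality and a Beta integral estimate. All of this is
   done weakly, testing against products of one-dimensional smooth bumps. The multiplicative form is the
   minimum of the additive one over h.

   Extremal functions exist for every m: let g be radial, supported in hK, with grad g the equality case of
   Hoelder's inequality, and f(x) = 2^-d * integral over C of g(y) prod_i sgn(x_i - y_i) dy. Then
   |f| <= 2^-d * integral of g over C, so the estimate of the average is an equality as well. Equality in the
   multiplicative form follows, its right side being the minimum over h. *)
theory Submission
  imports Defs "HOL-Computational_Algebra.Polynomial" "HOL-Probability.Distribution_Functions" "HOL-Real_Asymp.Real_Asymp"
begin

section \<open>Smooth box bumps\<close>

text \<open>In the inequality g is only locally integrable, so point values are avoided: the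
  averaging estimate is proved for the integral of g against each bump, and only the result is
  turned into a bound almost everywhere. The box Q is the set of all increments of size at most h
  that keep C inside itself; its volume 2^(d-m) h^d makes 2^d / |Q| the coefficient 2^m h^(-d). Near
  the centre the kernel grows like r^(1-d), so its power p' is integrable because p > d, and s =
  (r/h)^d turns that integral into the Beta value in A(d,p). For the extremal function no norm is
  computed. With X the additive bound, g(0) <= |g| <= X <= g(0), where the middle step is inequality
  (1) itself and the last one rests on s^d + (h^d - s^d) = h^d under an integral over the level s.
  The slope of the radial profile may be infinite at 0, so its gradient is justified by truncation
  at small radii.\<close>

definition deriv_seq :: "(nat \<Rightarrow> real \<Rightarrow> real) \<Rightarrow> bool" where
  "deriv_seq D \<longleftrightarrow> (\<forall>k t. (D k has_real_derivative D (Suc k) t) (at t))"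

lemma deriv_seqD: "deriv_seq D \<Longrightarrow> (D k has_real_derivative D (Suc k) t) (at t)"
  by (simp add: deriv_seq_def)

lemma deriv_seq_continuous: "deriv_seq D \<Longrightarrow> continuous_on S (D k)"
  by (meson DERIV_isCont continuous_at_imp_continuous_on deriv_seqD)

lemma deriv_seq_borel [measurable_dest]: "deriv_seq D \<Longrightarrow> D k \<in> borel_measurable borel"
  by (intro borel_measurable_continuous_onI deriv_seq_continuous)

text \<open>Leibniz' rule. A whole sequence of derivatives is carried along, so that smoothness of a
  product comes with formulas for all its derivatives.\<close>

lemma deriv_seq_mult:
  assumes U: "deriv_seq U" and V: "deriv_seq V"
  shows "deriv_seq (\<lambda>k t. \<Sum>j\<le>k. real (k choose j) * U j t * V (k - j) t)"
  unfolding deriv_seq_def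
proof (intro allI)
  fix k t
  have *: "real (k choose j) * (U (Suc j) t * V (k - j) t) + real (k choose j) * (U j t * V (Suc k - j) t)
      = real (k choose j) * U (Suc j) t * V (k - j) t + real (k choose j) * U j t * V (Suc k - j) t" for j
    by simp
  have d: "((\<lambda>t. \<Sum>j\<le>k. real (k choose j) * U j t * V (k - j) t) has_real_derivative
      (\<Sum>j\<le>k. real (k choose j) * U (Suc j) t * V (k - j) t + real (k choose j) * U j t * V (Suc k - j) t)) (at t)"
    using deriv_seqD[OF U] deriv_seqD[OF V]
    by (auto intro!: derivative_eq_intros simp: algebra_simps Suc_diff_le)
  have "(\<Sum>j\<le>Suc k. real (Suc k choose j) * U j t * V (Suc k - j) t)
     = V (Suc k) t * U 0 t + (\<Sum>j\<le>k. real (Suc k choose Suc j) * U (Suc j) t * V (k - j) t)"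
    by (subst sum.atMost_Suc_shift) simp
  \<comment> \<open>Pascal's rule. The first half already has its final form; the second half
    absorbs the split-off term j = 0 after reindexing.\<close>
  also have "(\<Sum>j\<le>k. real (Suc k choose Suc j) * U (Suc j) t * V (k - j) t)
     = (\<Sum>j\<le>k. real (k choose j) * U (Suc j) t * V (k - j) t)
      + (\<Sum>j\<le>k. real (k choose Suc j) * U (Suc j) t * V (k - j) t)"
    by (simp add: algebra_simps sum.distrib)
  also have "V (Suc k) t * U 0 t + (\<Sum>j\<le>k. real (k choose Suc j) * U (Suc j) t * V (k - j) t)
     = (\<Sum>j\<le>Suc k. real (k choose j) * U j t * V (Suc k - j) t)"
    by (subst sum.atMost_Suc_shift) simp
  then have "V (Suc k) t * U 0 t + (\<Sum>j\<le>k. real (k choose Suc j) * U (Suc j) t * V (k - j) t)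
     = (\<Sum>j\<le>k. real (k choose j) * U j t * V (Suc k - j) t)"
    by simp
  ultimately have "(\<Sum>j\<le>Suc k. real (Suc k choose j) * U j t * V (Suc k - j) t)
     = (\<Sum>j\<le>k. real (k choose j) * U (Suc j) t * V (k - j) t + real (k choose j) * U j t * V (Suc k - j) t)"
    by (simp add: sum.distrib)
  with d show "((\<lambda>t. \<Sum>j\<le>k. real (k choose j) * U j t * V (k - j) t) has_real_derivative
      (\<Sum>j\<le>Suc k. real (Suc k choose j) * U j t * V (Suc k - j) t)) (at t)"
    by simp
qed

lemma deriv_seq_affine:
  assumes "deriv_seq D"
  shows "deriv_seq (\<lambda>k t. c ^ k * D k (c * t + b))"
  unfolding deriv_seq_def
  by (auto intro!: derivative_eq_intros DERIV_chain'[where g="D _"] deriv_seqD[OF assms])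

lemma deriv_seq_diff:
  assumes "deriv_seq D" "deriv_seq E"
  shows "deriv_seq (\<lambda>k t. D k t - E k t)"
  using assms unfolding deriv_seq_def by (auto intro!: derivative_eq_intros)

section \<open>Functions flat at the origin and the smooth step\<close>

definition flat :: "real poly \<Rightarrow> real \<Rightarrow> real" where
  "flat p t = (if t > 0 then poly p (1 / t) * exp (- (1 / t)) else 0)"

lemma poly_times_exp_tendsto_0: "((\<lambda>u. poly p u * exp (- u)) \<longlongrightarrow> 0) at_top" for p :: "real poly"
proof -
  have "((\<lambda>u. \<Sum>i\<le>degree p. coeff p i * (u ^ i / exp u)) \<longlongrightarrow> (\<Sum>i\<le>degree p. coeff p i * 0)) at_top"
    by (intro tendsto_intros tendsto_power_div_exp_0)
  then show ?thesis
    by (simp add: poly_altdef sum_distrib_right exp_minus divide_inverse mult.assoc)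
qed

text \<open>The functions p(1/t) exp(-1/t) with a polynomial p are closed under differentiation:
  with X = 1/t, the polynomial p becomes X^2 (p - p'). Iterating from p = 1 gives all derivatives of
  exp(-1/t), extended by 0 to t <= 0.\<close>

lemma has_derivative_flat:
  "(flat p has_real_derivative flat (monom 1 2 * (p - pderiv p)) t) (at t)"
proof -
  consider "t > 0" | "t < 0" | "t = 0" by linarith
  then show ?thesis
  proof cases
    case 1
    have "((\<lambda>t. poly p (1 / t) * exp (- (1 / t))) has_real_derivative
        flat (monom 1 2 * (p - pderiv p)) t) (at t)"
    proof -
      have "((\<lambda>t. 1 / t) has_real_derivative - (1 / t)\<^sup>2) (at t)"
        using 1 by (auto intro!: derivative_eq_intros simp: power2_eq_square)
      note d = this
      have "((\<lambda>t. poly p (1 / t) * exp (- (1 / t))) has_real_derivative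
         poly (pderiv p) (1 / t) * (- (1 / t)\<^sup>2) * exp (- (1 / t))
         + exp (- (1 / t)) * (- (- (1 / t)\<^sup>2)) * poly p (1 / t)) (at t)"
        by (intro DERIV_mult DERIV_chain2[OF poly_DERIV d] DERIV_chain2[OF DERIV_exp DERIV_minus[OF d]])
      moreover have "poly (pderiv p) (1 / t) * (- (1 / t)\<^sup>2) * exp (- (1 / t))
         + exp (- (1 / t)) * (- (- (1 / t)\<^sup>2)) * poly p (1 / t) = flat (monom 1 2 * (p - pderiv p)) t"
        using 1 by (simp add: flat_def poly_monom algebra_simps)
      ultimately show ?thesis by simp
    qed
    then show ?thesis
      by (rule has_field_derivative_transform_within_open[of _ _ _ "{0<..}"])
        (use 1 in \<open>auto simp: flat_def\<close>)
  next
    case 2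
    have "((\<lambda>t. 0) has_real_derivative flat (monom 1 2 * (p - pderiv p)) t) (at t)"
      using 2 by (simp add: flat_def)
    then show ?thesis
      by (rule has_field_derivative_transform_within_open[of _ _ _ "{..<0}"])
        (use 2 in \<open>auto simp: flat_def\<close>)
  next
    case 3
    \<comment> \<open>With u = 1/h the right difference quotient at 0 is u p(u) exp(-u); the
      monomial of degree 1 accounts for the division by h.\<close>
    have "((\<lambda>h. poly (monom 1 1 * p) (inverse h) * exp (- (inverse h))) \<longlongrightarrow> 0) (at_right 0)"
      by (rule filterlim_compose[OF poly_times_exp_tendsto_0 filterlim_inverse_at_top_right])
    then have "((\<lambda>h. flat p h / h) \<longlongrightarrow> 0) (at_right 0)"
      by (rule Lim_transform_eventually)
        (auto simp: eventually_at_filter flat_def poly_monom field_simps)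
    moreover have "((\<lambda>h. flat p h / h) \<longlongrightarrow> 0) (at_left 0)"
      by (rule Lim_transform_eventually[OF tendsto_const])
        (auto simp: eventually_at_filter flat_def)
    ultimately have "((\<lambda>h. flat p h / h) \<longlongrightarrow> 0) (at 0)"
      by (simp add: filterlim_split_at)
    then show ?thesis using 3 by (simp add: DERIV_def flat_def)
  qed
qed

lemma deriv_seq_flat: "deriv_seq (\<lambda>k. flat (((\<lambda>p. monom 1 2 * (p - pderiv p)) ^^ k) 1))"
  using has_derivative_flat by (auto simp: deriv_seq_def)

text \<open>Normalised antiderivative of the bump exp(-1/t) exp(-1/(1-t)) on (0,1). A nonnegative
  derivative supported in [0,1] is what later makes the total variation 1 under every
  rescaling.\<close>

lemma exists_smooth_step:
  obtains S where "deriv_seq S" "\<And>t. t \<le> 0 \<Longrightarrow> S 0 t = 0" "\<And>t. t \<ge> 1 \<Longrightarrow> S 0 t = 1"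
    "\<And>t. S (Suc 0) t \<ge> 0" "\<And>k t. t \<notin> {0..1} \<Longrightarrow> S (Suc k) t = 0"
    "\<And>s t. s \<le> t \<Longrightarrow> S 0 s \<le> S 0 t"
proof -
  define E where "E = (\<lambda>k. flat (((\<lambda>p. monom 1 2 * (p - pderiv p)) ^^ k) 1))"
  \<comment> \<open>Mirror image under t -> 1 - t; the sign comes from the chain rule.\<close>
  define V where "V = (\<lambda>k t. (- 1) ^ k * E k ((- 1) * t + 1))"
  define B where "B = (\<lambda>k t. \<Sum>j\<le>k. real (k choose j) * E j t * V (k - j) t)"
  have B: "deriv_seq B"
    unfolding B_def V_def E_def by (intro deriv_seq_mult deriv_seq_affine deriv_seq_flat)
  have B0: "B k t = 0" if "t \<notin> {0<..<1}" for k t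
    using that by (auto simp: B_def E_def V_def flat_def)
  have B0_eq: "B 0 t = (if 0 < t \<and> t < 1 then exp (- (1 / t)) * exp (- (1 / (1 - t))) else 0)" for t
    by (auto simp: B_def E_def V_def flat_def)
  have "\<exists>F. \<forall>x::real. -\<infinity> < ereal x \<longrightarrow> ereal x < \<infinity> \<longrightarrow> (F has_vector_derivative B 0 x) (at x)"
    by (rule einterval_antiderivative) (use DERIV_isCont[OF deriv_seqD[OF B]] in auto)
  then obtain F where F: "\<And>x. (F has_real_derivative B 0 x) (at x)"
    by (auto simp: has_real_derivative_iff_has_vector_derivative)
  have mono: "F s \<le> F t" if "s \<le> t" for s t
  proof (rule DERIV_nonneg_imp_nondecreasing[OF that])
    show "\<exists>y. DERIV F x :> y \<and> 0 \<le> y" for x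
      by (rule exI[of _ "B 0 x"]) (use F[of x] in \<open>simp add: B0_eq\<close>)
  qed
  have less: "F 0 < F 1"
  proof (rule DERIV_pos_imp_increasing_open[of 0 1 F])
    show "\<exists>y. DERIV F x :> y \<and> 0 < y" if "0 < x" "x < 1" for x
      by (rule exI[of _ "B 0 x"]) (use F[of x] that in \<open>simp add: B0_eq\<close>)
    show "continuous_on {0..1} F"
      using F by (meson DERIV_isCont continuous_at_imp_continuous_on)
  qed simp
  have left: "F t = F 0" if "t \<le> 0" for t
  proof (cases "t = 0")
    case False
    then have "t < 0" using that by simp
    then obtain z where "t < z" "z < 0" "F 0 - F t = (0 - t) * B 0 z"
      using MVT2[of t 0 F "B 0"] F by blast
    then show ?thesis by (simp add: B0)
  qed simp
  have right: "F t = F 1" if "t \<ge> 1" for t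
  proof (cases "t = 1")
    case False
    then have "1 < t" using that by simp
    then obtain z where "1 < z" "z < t" "F t - F 1 = (t - 1) * B 0 z"
      using MVT2[of 1 t F "B 0"] F by blast
    then show ?thesis by (simp add: B0)
  qed simp
  \<comment> \<open>Derivative k + 1 of the step is derivative k of the bump, divided by the total
    rise.\<close>
  define S where "S = (\<lambda>k t. case k of 0 \<Rightarrow> (F t - F 0) / (F 1 - F 0) | Suc k \<Rightarrow> B k t / (F 1 - F 0))"
  show thesis
  proof
    show "deriv_seq S"
      unfolding deriv_seq_def
    proof (intro allI)
      show "(S k has_real_derivative S (Suc k) t) (at t)" for k t
        unfolding S_def using F less deriv_seqD[OF B]
        by (cases k) (auto intro!: derivative_eq_intros DERIV_cdivide)
    qed
    show "S 0 t = 0" if "t \<le> 0" for t using left[OF that] by (simp add: S_def)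
    show "S 0 t = 1" if "t \<ge> 1" for t using right[OF that] less by (simp add: S_def)
    show "S (Suc 0) t \<ge> 0" for t using less by (simp add: S_def B0_eq)
    show "S (Suc k) t = 0" if "t \<notin> {0..1}" for k t using that by (auto simp: S_def B0)
    show "S 0 s \<le> S 0 t" if "s \<le> t" for s t
      using mono[OF that] less by (simp add: S_def divide_right_mono)
  qed
qed

text \<open>A nondecreasing function rising from 0 to 1 has a derivative of L1 norm 1, however steep
  it is. Independence of \<open>c\<close> is essential, since \<open>c\<close> tends to infinity
  when bumps approach boxes.\<close>

lemma nn_integral_abs_deriv_step:
  assumes S: "deriv_seq S" and S0: "\<And>t. t \<le> 0 \<Longrightarrow> S 0 t = 0" and S1: "\<And>t. t \<ge> 1 \<Longrightarrow> S 0 t = 1"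
    and pos: "\<And>t. S (Suc 0) t \<ge> 0" and out: "\<And>k t. t \<notin> {0..1} \<Longrightarrow> S (Suc k) t = 0"
    and "c > 0"
  shows "(\<integral>\<^sup>+t. ennreal \<bar>c * S (Suc 0) (c * t + b)\<bar> \<partial>lborel) = 1"
proof -
  have D: "deriv_seq (\<lambda>k t. c ^ k * S k (c * t + b))"
    by (rule deriv_seq_affine[OF S])
  note [measurable] = deriv_seq_borel[OF S]
  have "(\<integral>\<^sup>+t. ennreal \<bar>c * S (Suc 0) (c * t + b)\<bar> \<partial>lborel)
      = (\<integral>\<^sup>+t. ennreal (c * S (Suc 0) (c * t + b)) * indicator {- b / c..(1 - b) / c} t \<partial>lborel)"
  proof (intro nn_integral_cong)
    fix t
    show "ennreal \<bar>c * S (Suc 0) (c * t + b)\<bar> =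
        ennreal (c * S (Suc 0) (c * t + b)) * indicator {- b / c..(1 - b) / c} t"
      using pos[of "c * t + b"] \<open>c > 0\<close> out[of "c * t + b" 0]
      by (cases "t \<in> {- b / c..(1 - b) / c}") (auto simp: field_simps indicator_def)
  qed
  also have "\<dots> = S 0 (c * ((1 - b) / c) + b) - S 0 (c * (- b / c) + b)"
    by (rule nn_integral_FTC_Icc)
      (use deriv_seqD[OF D, of 0] pos \<open>c > 0\<close> in \<open>auto intro!: has_field_derivative_at_within simp: field_simps\<close>)
  also have "\<dots> = 1" using \<open>c > 0\<close> S0 S1 by simp
  finally show ?thesis by simp
qed

section \<open>Products of functions of one variable\<close>

definition prod_fun :: "('n \<Rightarrow> nat \<Rightarrow> real \<Rightarrow> real) \<Rightarrow> ('n \<Rightarrow> nat) \<Rightarrow> real ^ 'n \<Rightarrow> real" where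
  "prod_fun D k x = (\<Prod>i\<in>UNIV. D i (k i) (x $ i))"

lemma has_derivative_prod_fun:
  assumes "\<forall>i. deriv_seq (D i)"
  shows "((\<lambda>t. prod_fun D k (x + t *\<^sub>R axis i 1)) has_real_derivative
    prod_fun D (k(i := Suc (k i))) (x + s *\<^sub>R axis i 1)) (at s)"
proof -
  have eq: "prod_fun D l (x + t *\<^sub>R axis i 1) =
      D i (l i) (x $ i + t) * (\<Prod>j\<in>UNIV - {i}. D j (l j) (x $ j))" for l t
    unfolding prod_fun_def
    by (subst prod.remove[of _ i]) (auto intro!: arg_cong2[where f="(*)"] prod.cong simp: axis_def)
  have "((\<lambda>t. D i (k i) (1 * t + x $ i)) has_real_derivative 1 * D i (Suc (k i)) (1 * s + x $ i)) (at s)"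
    using deriv_seqD[OF deriv_seq_affine[OF assms[rule_format, of i], of 1 "x $ i"], of "k i"] by simp
  then have "((\<lambda>t. D i (k i) (x $ i + t) * (\<Prod>j\<in>UNIV - {i}. D j (k j) (x $ j))) has_real_derivative
     D i (Suc (k i)) (x $ i + s) * (\<Prod>j\<in>UNIV - {i}. D j (k j) (x $ j))) (at s)"
    by (intro DERIV_cmult_right) (simp add: add.commute)
  also have "(\<Prod>j\<in>UNIV - {i}. D j (k j) (x $ j)) = (\<Prod>j\<in>UNIV - {i}. D j ((k(i := Suc (k i))) j) (x $ j))"
    by (intro prod.cong) auto
  finally show ?thesis
    using eq[of k] eq[of "k(i := Suc (k i))"] by simp
qed

lemma partial_prod_fun:
  assumes "\<forall>i. deriv_seq (D i)"
  shows "partial i (prod_fun D k) = prod_fun D (k(i := Suc (k i)))"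
  using DERIV_imp_deriv[OF has_derivative_prod_fun[OF assms, where s=0]]
  by (auto simp: partial_def)

text \<open>The vector \<open>k\<close> records the order of the derivative in each coordinate, so a
  partial derivative merely raises one entry and iterated ones only count occurrences in the
  list.\<close>

lemma partials_prod_fun:
  assumes "\<forall>i. deriv_seq (D i)"
  shows "partials is (prod_fun D k) = prod_fun D (\<lambda>i. k i + count_list is i)"
proof (induction "is")
  case (Cons i "is")
  then show ?case
    by (auto simp: partials_def partial_prod_fun[OF assms] intro!: arg_cong[where f="prod_fun D"])
qed (simp add: partials_def)

lemma continuous_on_prod_fun:
  assumes "\<forall>i. deriv_seq (D i)"
  shows "continuous_on S (prod_fun D k)"
proof -
  have "continuous_on S (\<lambda>x. D i (k i) (x $ i))" for i
    by (rule continuous_on_compose2[OF deriv_seq_continuous[OF assms[rule_format], of UNIV]])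
      (auto intro!: continuous_intros)
  then show ?thesis
    unfolding prod_fun_def by (intro continuous_intros)
qed

lemma prod_fun_borel [measurable]:
  assumes "\<forall>i. deriv_seq (D i)"
  shows "prod_fun D k \<in> borel_measurable borel"
  by (intro borel_measurable_continuous_onI continuous_on_prod_fun assms)

lemma smooth_prod_fun:
  assumes "\<forall>i. deriv_seq (D i)"
  shows "smooth (prod_fun D k)"
  unfolding smooth_def partials_prod_fun[OF assms] real_differentiable_def
  using has_derivative_prod_fun[OF assms] by (blast intro: continuous_on_prod_fun[OF assms])

lemma prod_fun_eq_0:
  assumes "\<And>i t. t \<notin> {a $ i..b $ i} \<Longrightarrow> D i (k i) t = 0" and "x \<notin> cbox a b"
  shows "prod_fun D k x = 0"
  using assms unfolding prod_fun_def mem_box_cart by (force intro!: prod_zero)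

lemma test_function_prod_fun:
  assumes D: "\<forall>i. deriv_seq (D i)"
    and out: "\<And>i t. t \<notin> {a $ i..b $ i} \<Longrightarrow> D i (k i) t = 0" and sub: "cbox a b \<subseteq> C"
  shows "test_function C (prod_fun D k)"
proof -
  have "{x. prod_fun D k x \<noteq> 0} \<subseteq> cbox a b"
    using prod_fun_eq_0[of a b D k, OF out] by blast
  then have "closure {x. prod_fun D k x \<noteq> 0} \<subseteq> cbox a b"
    by (simp add: closure_minimal closed_cbox)
  then show ?thesis
    using sub unfolding test_function_def
    by (meson closed_closure D smooth_prod_fun bounded_subset bounded_cbox compact_eq_bounded_closed
        subset_trans)
qed

section \<open>Signs almost everywhere from integrals over boxes\<close>

lemma nn_integral_indicator_Diff_tendsto_0:
  fixes u :: "'a::euclidean_space \<Rightarrow> real"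
  assumes u: "integrable lebesgue u" "\<And>x. 0 \<le> u x"
    and T: "\<And>n. T n \<in> lmeasurable" "\<And>n. measure lebesgue (T n) \<le> (1/2) ^ n"
  shows "(\<lambda>n. \<integral>\<^sup>+x. ennreal (u x) * indicator (T n) x \<partial>lebesgue) \<longlonglongrightarrow> 0"
proof -
  \<comment> \<open>The measures are summable, so by Borel-Cantelli almost every point lies in only
    finitely many \<open>T n\<close>; dominated convergence with majorant \<open>u\<close> then
    applies.\<close>
  have "AE x in lebesgue. eventually (\<lambda>n. x \<in> space lebesgue - T n) sequentially"
  proof (rule borel_cantelli_AE1)
    show "summable (\<lambda>n. measure lebesgue (T n))"
      by (rule summable_comparison_test'[of "\<lambda>n. (1/2) ^ n"]) (use T in auto)
    show "emeasure lebesgue (T n) < \<infinity>" for n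
      using fmeasurableD2[OF T(1)[of n]] by (simp add: less_top del: emeasure_completion)
  qed (use T in auto)
  then have "AE x in lebesgue. (\<lambda>n. ennreal (u x) * indicator (T n) x) \<longlonglongrightarrow> 0"
    by eventually_elim
      (auto intro!: tendsto_eventually simp: indicator_def elim!: eventually_mono)
  note lim = this
  have "(\<lambda>n. \<integral>\<^sup>+x. ennreal (u x) * indicator (T n) x \<partial>lebesgue) \<longlonglongrightarrow> (\<integral>\<^sup>+x. 0 \<partial>(lebesgue :: 'a measure))"
  proof (rule nn_integral_dominated_convergence[where w="\<lambda>x. ennreal (u x)"])
    have [measurable]: "u \<in> borel_measurable lebesgue" "T n \<in> sets lebesgue" for n
      using u T by auto
    show "(\<lambda>x. ennreal (u x) * indicator (T n) x) \<in> borel_measurable lebesgue" for n by measurable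
    show "(\<lambda>x. ennreal (u x)) \<in> borel_measurable lebesgue" by measurable
    show "AE x in lebesgue. ennreal (u x) * indicator (T n) x \<le> ennreal (u x)" for n
      by (auto simp: indicator_def)
  qed (use u lim in \<open>auto simp: integrable_iff_bounded\<close>)
  then show ?thesis by simp
qed

text \<open>Compares the measures \<open>\<mu>\<close> and \<open>\<nu>\<close> with densities h^+
  and h^-. The hypothesis makes \<open>\<nu>\<close> at most \<open>\<mu>\<close> on boxes, hence on
  coverings of \<open>N\<close>, the set where h < 0, by nonoverlapping boxes. As
  \<open>\<mu>\<close> vanishes on \<open>N\<close>, it tends to 0 on tighter and tighter coverings,
  which forces the \<open>\<nu>\<close>-mass of \<open>N\<close> to be 0.\<close>

lemma AE_nonneg_on_cbox:
  fixes h :: "'a::euclidean_space \<Rightarrow> real"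
  assumes h: "h absolutely_integrable_on cbox a b"
    and pos: "\<And>c d. cbox c d \<subseteq> cbox a b \<Longrightarrow> 0 \<le> integral (cbox c d) h"
  shows "AE x in lebesgue. x \<in> cbox a b \<longrightarrow> 0 \<le> h x"
proof -
  define B where "B = cbox a b"
  define u where "u = (\<lambda>x. max 0 (h x) * indicator B x)"
  define v where "v = (\<lambda>x. max 0 (- h x) * indicator B x)"
  have hB: "integrable lebesgue (\<lambda>x. indicator B x *\<^sub>R h x)"
    using h by (simp add: B_def set_integrable_def)
  have uv: "u x = max 0 (indicator B x *\<^sub>R h x)" "v x = max 0 (- (indicator B x *\<^sub>R h x))" for x
    by (auto simp: u_def v_def indicator_def)
  have u: "integrable lebesgue u" and v: "integrable lebesgue v"
    unfolding uv using hB by (auto intro!: integrable_max)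
  have [measurable]: "u \<in> borel_measurable lebesgue" "v \<in> borel_measurable lebesgue"
    using u v by auto
  have u0: "0 \<le> u x" and v0: "0 \<le> v x" for x by (auto simp: u_def v_def)
  define N where "N = {x \<in> space lebesgue. v x > 0}"
  have N[measurable]: "N \<in> sets lebesgue" unfolding N_def by measurable
  have NB: "N \<subseteq> B" by (auto simp: N_def v_def indicator_def split: if_splits)
  have Nl: "N \<in> lmeasurable"
    by (rule fmeasurableI2[OF lmeasurable_cbox NB[unfolded B_def] N])
  \<comment> \<open>h^+ is 0 where h is negative, so a covering set has \<open>\<mu>\<close>-mass
    only in its excess over \<open>N\<close>.\<close>
  have uN: "u x * indicator N x = 0" for x
    by (auto simp: N_def u_def v_def indicator_def)
  define \<mu> where "\<mu> = density lebesgue (\<lambda>x. ennreal (u x))"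
  define \<nu> where "\<nu> = density lebesgue (\<lambda>x. ennreal (v x))"
  have box_le: "emeasure \<nu> (box c d) \<le> emeasure \<mu> (box c d)" if "cbox c d \<subseteq> B" for c d
  proof -
    have i: "h absolutely_integrable_on cbox c d"
      using absolutely_integrable_on_subcbox[OF h] that by (simp add: B_def)
    have uc: "integrable lebesgue (\<lambda>x. indicator (box c d) x * u x)"
      "integrable lebesgue (\<lambda>x. indicator (box c d) x * v x)"
      using integrable_mult_indicator[OF _ u, of "box c d"] integrable_mult_indicator[OF _ v, of "box c d"]
      by simp_all
    have eq: "indicator (box c d) x * u x - indicator (box c d) x * v x = indicator (box c d) x *\<^sub>R h x" for x
      using that box_subset_cbox[of c d] by (auto simp: u_def v_def indicator_def)
    have "0 \<le> integral (cbox c d) h"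
      using pos that by (simp add: B_def)
    also have "\<dots> = integral (box c d) h"
      by (metis integral_open_interval)
    also have "\<dots> = (LINT x:box c d|lebesgue. h x)"
      by (intro set_lebesgue_integral_eq_integral(2)[symmetric] set_integrable_subset[OF i])
        (auto simp: box_subset_cbox)
    also have "\<dots> = (LINT x|lebesgue. indicator (box c d) x * u x) - (LINT x|lebesgue. indicator (box c d) x * v x)"
      unfolding set_lebesgue_integral_def eq[symmetric] by (rule Bochner_Integration.integral_diff[OF uc])
    finally have "(LINT x|lebesgue. indicator (box c d) x * v x) \<le> (LINT x|lebesgue. indicator (box c d) x * u x)"
      by simp
    then have "(\<integral>\<^sup>+x. ennreal (indicator (box c d) x * v x) \<partial>lebesgue) \<le> (\<integral>\<^sup>+x. ennreal (indicator (box c d) x * u x) \<partial>lebesgue)"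
      using uc u0 v0 by (subst (1 2) nn_integral_eq_integral) (auto intro!: ennreal_leI)
    moreover have "ennreal (indicator S x * w) = ennreal w * indicator S x" for S and x :: 'a and w
      by (simp add: indicator_def)
    ultimately show ?thesis
      by (simp add: \<mu>_def \<nu>_def emeasure_density)
  qed
  have null_zero: "emeasure \<nu> E = 0" if "E \<in> null_sets lebesgue" for E
  proof -
    have "emeasure \<nu> E = (\<integral>\<^sup>+x. ennreal (v x) * indicator E x \<partial>lebesgue)"
      using null_setsD2[OF that] by (simp add: \<nu>_def emeasure_density)
    also have "\<dots> = (\<integral>\<^sup>+x. 0 \<partial>(lebesgue :: 'a measure))"
    proof (rule nn_integral_cong_AE)
      show "AE x in lebesgue. ennreal (v x) * indicator E x = 0"
        using AE_not_in[OF that] by eventually_elim simp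
    qed
    finally show ?thesis by simp
  qed
  have "\<exists>E. N \<subseteq> E \<and> E \<in> lmeasurable \<and> measure lebesgue (E - N) \<le> (1/2)^n \<and> emeasure \<nu> E \<le> emeasure \<mu> E" for n
  proof -
    \<comment> \<open>Countably many nonoverlapping boxes that exceed \<open>N\<close> by at most
      (1/2)^n in measure. Their boundaries are null, so passing to interiors makes the family
      disjoint and both measures additive on it.\<close>
    obtain \<D> where D: "countable \<D>" "\<And>K. K \<in> \<D> \<Longrightarrow> K \<subseteq> cbox a b \<and> K \<noteq> {} \<and> (\<exists>c d. K = cbox c d)"
      "pairwise (\<lambda>A B. interior A \<inter> interior B = {}) \<D>" "N \<subseteq> \<Union>\<D>" "\<Union>\<D> \<in> lmeasurable"
      "measure lebesgue (\<Union>\<D>) \<le> measure lebesgue N + (1/2)^n"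
      using measurable_outer_intervals_bounded[OF Nl NB[unfolded B_def], of "(1/2)^n"] by (metis zero_less_divide_1_iff zero_less_numeral zero_less_power)
    have m1: "measure lebesgue (\<Union>\<D> - N) \<le> (1/2)^n"
      using D Nl by (subst measurable_measure_Diff) (auto simp: fmeasurable_def)
    have [measurable]: "interior K \<in> sets lebesgue" for K :: "'a set" by simp
    have Ds: "\<Union>\<D> \<in> sets lebesgue" using D(5) by auto
    have U: "(\<Union>K\<in>\<D>. interior K) \<in> sets lebesgue" using D(1) by (intro sets.countable_UN') auto
    have disj: "disjoint_family_on interior \<D>"
      using D(3) by (auto simp: disjoint_family_on_def pairwise_def)
    have null: "(\<Union>K\<in>\<D>. K - interior K) \<in> null_sets lebesgue"
    proof (rule null_sets_UN'[OF D(1)])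
      fix K assume "K \<in> \<D>"
      then obtain c d where "K = cbox c d" using D(2) by blast
      then show "K - interior K \<in> null_sets lebesgue"
        using null_sets_cbox_Diff_box[of c d] null_sets_completionI by (auto simp: interior_cbox)
    qed
    have "emeasure \<nu> (\<Union>\<D>) \<le> emeasure \<nu> ((\<Union>K\<in>\<D>. interior K) \<union> (\<Union>K\<in>\<D>. K - interior K))"
      using Ds U null by (intro emeasure_mono) (auto simp: \<nu>_def null_setsD2)
    also have "\<dots> \<le> emeasure \<nu> (\<Union>K\<in>\<D>. interior K) + emeasure \<nu> (\<Union>K\<in>\<D>. K - interior K)"
      using U null by (intro emeasure_subadditive) (auto simp: \<nu>_def null_setsD2)
    also have "\<dots> = emeasure \<nu> (\<Union>K\<in>\<D>. interior K)" using null_zero[OF null] by simp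
    also have "\<dots> = (\<integral>\<^sup>+K. emeasure \<nu> (interior K) \<partial>count_space \<D>)"
      using disj D(1) by (intro emeasure_UN_countable) (auto simp: \<nu>_def)
    also have "\<dots> \<le> (\<integral>\<^sup>+K. emeasure \<mu> (interior K) \<partial>count_space \<D>)"
    proof (rule nn_integral_mono)
      fix K assume "K \<in> space (count_space \<D>)"
      then have "K \<in> \<D>" by simp
      then obtain c d where "K = cbox c d" "K \<subseteq> B" using D(2) B_def by blast
      then show "emeasure \<nu> (interior K) \<le> emeasure \<mu> (interior K)"
        using box_le[of c d] by (simp add: interior_cbox)
    qed
    also have "\<dots> = emeasure \<mu> (\<Union>K\<in>\<D>. interior K)"
      using disj D(1) by (intro emeasure_UN_countable[symmetric]) (auto simp: \<mu>_def)
    also have "\<dots> \<le> emeasure \<mu> (\<Union>\<D>)"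
      using Ds interior_subset by (intro emeasure_mono) (auto simp: \<mu>_def)
    finally show ?thesis using D m1 by blast
  qed
  then obtain E where E: "\<And>n. N \<subseteq> E n" "\<And>n. E n \<in> lmeasurable"
      "\<And>n. measure lebesgue (E n - N) \<le> (1/2)^n" "\<And>n. emeasure \<nu> (E n) \<le> emeasure \<mu> (E n)"
    by metis
  have lim: "(\<lambda>n. \<integral>\<^sup>+x. ennreal (u x) * indicator (E n - N) x \<partial>lebesgue) \<longlonglongrightarrow> 0"
    using E Nl by (intro nn_integral_indicator_Diff_tendsto_0 u u0) (auto intro: fmeasurable.Diff)
  have "emeasure \<nu> N \<le> (\<integral>\<^sup>+x. ennreal (u x) * indicator (E n - N) x \<partial>lebesgue)" for n
  proof -
    have [measurable]: "E n \<in> sets lebesgue" using E(2) by auto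
    have "emeasure \<nu> N \<le> emeasure \<nu> (E n)"
      using E(1) by (intro emeasure_mono) (auto simp: \<nu>_def)
    also have "\<dots> \<le> emeasure \<mu> (E n)" by (rule E)
    also have "\<dots> = (\<integral>\<^sup>+x. ennreal (u x) * indicator (E n) x \<partial>lebesgue)"
      by (simp add: \<mu>_def emeasure_density)
    also have "\<dots> = (\<integral>\<^sup>+x. ennreal (u x) * indicator (E n - N) x \<partial>lebesgue)"
    proof (rule nn_integral_cong)
      show "ennreal (u x) * indicator (E n) x = ennreal (u x) * indicator (E n - N) x" for x
        using uN[of x] by (cases "x \<in> N") (auto simp: indicator_def)
    qed
    finally show ?thesis .
  qed
  then have "emeasure \<nu> N \<le> 0"
    by (intro LIMSEQ_le_const[OF lim]) auto
  then have "(\<integral>\<^sup>+x. ennreal (v x) * indicator N x \<partial>lebesgue) = 0"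
    by (simp add: \<nu>_def emeasure_density)
  then have "AE x in lebesgue. ennreal (v x) * indicator N x = 0"
    by (subst (asm) nn_integral_0_iff_AE) auto
  then show ?thesis
    by eventually_elim (auto simp: N_def v_def B_def indicator_def split: if_splits)
qed

text \<open>An open set is a countable union of boxes, so the exceptional null sets of the boxes add
  up to a null set.\<close>

lemma AE_nonneg_if_box_integrals_nonneg:
  fixes h :: "'a::euclidean_space \<Rightarrow> real"
  assumes "open C" and h: "\<And>a b. cbox a b \<subseteq> C \<Longrightarrow> h absolutely_integrable_on cbox a b"
    and pos: "\<And>c d. cbox c d \<subseteq> C \<Longrightarrow> 0 \<le> integral (cbox c d) h"
  shows "AE x in lebesgue. x \<in> C \<longrightarrow> 0 \<le> h x"
proof -
  obtain \<D> where D: "countable \<D>" "\<And>K. K \<in> \<D> \<Longrightarrow> K \<subseteq> C \<and> (\<exists>a b. K = cbox a b)" "\<Union>\<D> = C"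
    using open_countable_Union_open_cbox[OF \<open>open C\<close>] by (metis subsetD Pow_iff)
  have "AE x in lebesgue. x \<in> K \<longrightarrow> 0 \<le> h x" if "K \<in> \<D>" for K
  proof -
    from D(2)[OF that] obtain a b where "K = cbox a b" "cbox a b \<subseteq> C" by blast
    then show ?thesis using AE_nonneg_on_cbox[OF h pos, of a b] by auto
  qed
  then have "AE x in lebesgue. \<forall>K\<in>\<D>. x \<in> K \<longrightarrow> 0 \<le> h x"
    using D(1) by (subst AE_ball_countable) auto
  then show ?thesis
    by eventually_elim (use D(3) in blast)
qed


section \<open>The orthant and Borel representatives\<close>

lemma open_orthant: "open (orthant m :: (real ^ 'n::{finite,linorder}) set)"
proof -
  have "orthant m = (\<Inter>i\<in>{i::'n::{finite,linorder}. card {..<i} < m}. {x. 0 < x $ i})"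
    by (auto simp: orthant_def)
  moreover have "open {x :: real ^ 'n::{finite,linorder}. 0 < x $ i}" for i :: "'n::{finite,linorder}"
    using open_halfspace_component_gt_cart[of 0 i] by simp
  ultimately show ?thesis
    by (simp add: open_INT)
qed

lemma orthant_mono: "a \<in> orthant m \<Longrightarrow> (\<And>i. a $ i \<le> x $ i) \<Longrightarrow> x \<in> orthant m"
  by (force simp: orthant_def intro: less_le_trans)

lemma cbox_subset_orthant: "a \<in> orthant m \<Longrightarrow> cbox a b \<subseteq> orthant m"
  by (auto simp: mem_box_cart intro: orthant_mono)

lemma measurable_orthant [measurable]: "orthant m \<in> sets borel"
  by (simp add: open_orthant)

text \<open>Local integrability gives measurability on each box of a countable cover of
  \<open>C\<close>; the complement of \<open>C\<close> is the remaining piece, where the product is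
  0.\<close>

lemma locally_integrable_measurable:
  assumes "open C" "locally_integrable C g"
  shows "(\<lambda>x. indicator C x * g x) \<in> borel_measurable lebesgue"
proof -
  obtain \<D> where D: "countable \<D>" "\<And>K. K \<in> \<D> \<Longrightarrow> K \<subseteq> C \<and> (\<exists>a b. K = cbox a b)" "\<Union>\<D> = C"
    using open_countable_Union_open_cbox[OF \<open>open C\<close>] by (metis subsetD Pow_iff)
  have C: "C \<in> sets lebesgue" using \<open>open C\<close> by auto
  show ?thesis
  proof (rule measurable_piecewise_restrict[of "insert (- C) \<D>"])
    show "countable (insert (- C) \<D>)" using D by simp
    show "\<Omega> \<inter> space lebesgue \<in> sets lebesgue" if "\<Omega> \<in> insert (- C) \<D>" for \<Omega>
      using that D(2) C by (force simp: Compl_in_sets_lebesgue)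
    show "space lebesgue \<subseteq> \<Union>(insert (- C) \<D>)" using D(3) by auto
    show "(\<lambda>x. indicator C x * g x) \<in> borel_measurable (lebesgue_on \<Omega>)" if \<Omega>: "\<Omega> \<in> insert (- C) \<D>" for \<Omega>
    proof (cases "\<Omega> = - C")
      case True
      have "(\<lambda>x. 0 :: real) \<in> borel_measurable (lebesgue_on \<Omega>)" by simp
      also have "?this \<longleftrightarrow> ?thesis"
        using True by (intro measurable_cong) auto
      finally show ?thesis .
    next
      case False
      obtain a b where ab: "\<Omega> = cbox a b" "cbox a b \<subseteq> C" using False \<Omega> D(2) by blast
      then have "g absolutely_integrable_on \<Omega>"
        using assms by (auto simp: locally_integrable_def)
      then have "g \<in> borel_measurable (lebesgue_on \<Omega>)"
        by (simp add: absolutely_integrable_measurable ab)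
      also have "?this \<longleftrightarrow> ?thesis"
        using ab by (intro measurable_cong) auto
      finally show ?thesis .
    qed
  qed
qed

text \<open>Lebesgue measurable functions are replaced by Borel ones, equal almost everywhere on
  \<open>C\<close> and 0 outside. This moves all later work to \<open>lborel\<close>, where Fubini's
  theorem, translations and dilations are at hand.\<close>

lemma borel_representative:
  fixes g :: "'a::euclidean_space \<Rightarrow> real"
  assumes C: "C \<in> sets borel" and g: "(\<lambda>x. indicator C x * g x) \<in> borel_measurable lebesgue"
  obtains g' where "g' \<in> borel_measurable borel" "\<forall>x. x \<notin> C \<longrightarrow> g' x = 0"
    "AE x in lebesgue. x \<in> C \<longrightarrow> g x = g' x"
proof -
  obtain u where u: "u \<in> borel_measurable lborel" "AE x in lborel. indicator C x * g x = u x"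
    using completion_ex_borel_measurable_real[OF g] by blast
  show thesis
  proof
    show "(\<lambda>x. indicator C x * u x) \<in> borel_measurable borel"
      using u C by measurable
    show "AE x in lebesgue. x \<in> C \<longrightarrow> g x = indicator C x * u x"
      using AE_completion[OF u(2)] by eventually_elim auto
  qed auto
qed

lemma integral_borel_representative:
  fixes g :: "real ^ 'n \<Rightarrow> real"
  assumes C: "C \<in> sets borel" and g': "g' \<in> borel_measurable borel" "\<forall>x. x \<notin> C \<longrightarrow> g' x = 0"
    "AE x in lebesgue. x \<in> C \<longrightarrow> g x = g' x"
    and [measurable]: "\<phi> \<in> borel_measurable borel"
  shows "(LINT x:C|lebesgue. g x * \<phi> x) = (LINT x|lborel. g' x * \<phi> x)"
    and "set_integrable lebesgue C (\<lambda>x. g x * \<phi> x) \<longleftrightarrow> integrable lborel (\<lambda>x. g' x * \<phi> x)"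
proof -
  have [measurable]: "g' \<in> borel_measurable lborel" using g' by simp
  have b: "(\<lambda>x. g' x * \<phi> x) \<in> borel_measurable lborel" by measurable
  have ae: "AE x in lebesgue. g' x * \<phi> x = indicator C x *\<^sub>R (g x * \<phi> x)"
    using g'(3)
  proof eventually_elim
    case (elim x)
    then show ?case using g'(2) by (cases "x \<in> C") auto
  qed
  have ae': "AE x in lebesgue. indicator C x *\<^sub>R (g x * \<phi> x) = g' x * \<phi> x"
    using ae by eventually_elim (rule sym)
  have bl: "(\<lambda>x. g' x * \<phi> x) \<in> borel_measurable lebesgue"
    using b by (rule measurable_completion)
  have ml: "(\<lambda>x. indicator C x *\<^sub>R (g x * \<phi> x)) \<in> borel_measurable lebesgue"
    by (rule borel_measurable_AE[OF bl ae])
  show "(LINT x:C|lebesgue. g x * \<phi> x) = (LINT x|lborel. g' x * \<phi> x)"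
    unfolding set_lebesgue_integral_def
    using integral_cong_AE[OF ml bl ae'] integral_completion[OF b] by (rule trans)
  show "set_integrable lebesgue C (\<lambda>x. g x * \<phi> x) \<longleftrightarrow> integrable lborel (\<lambda>x. g' x * \<phi> x)"
    unfolding set_integrable_def
    using integrable_cong_AE[OF ml bl ae'] integrable_completion[OF b] by (rule trans)
qed

lemma smooth_partials_continuous: "smooth \<phi> \<Longrightarrow> continuous_on S (partials is \<phi>)"
  by (meson continuous_on_subset smooth_def subset_UNIV)

lemma smooth_partials_measurable: "smooth \<phi> \<Longrightarrow> partials is \<phi> \<in> borel_measurable borel"
  by (intro borel_measurable_continuous_onI smooth_partials_continuous)

lemma has_weak_partials_borelD:
  assumes w: "has_weak_partials C is f g" and C: "C \<in> sets borel"
    and f: "f' \<in> borel_measurable borel" "\<forall>x. x \<notin> C \<longrightarrow> f' x = 0" "AE x in lebesgue. x \<in> C \<longrightarrow> f x = f' x"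
    and g: "g' \<in> borel_measurable borel" "\<forall>x. x \<notin> C \<longrightarrow> g' x = 0" "AE x in lebesgue. x \<in> C \<longrightarrow> g x = g' x"
    and \<phi>: "test_function C \<phi>"
  shows "(LINT x|lborel. f' x * partials is \<phi> x) = (- 1) ^ length is * (LINT x|lborel. g' x * \<phi> x)"
proof -
  have "smooth \<phi>" using \<phi> by (simp add: test_function_def)
  then have m: "partials is \<phi> \<in> borel_measurable borel" "\<phi> \<in> borel_measurable borel"
    using smooth_partials_measurable[of \<phi> "[]"] smooth_partials_measurable[of \<phi> "is"] by (simp_all add: partials_def)
  have "(LINT x:C|lebesgue. f x * partials is \<phi> x) = (- 1) ^ length is * (LINT x:C|lebesgue. g x * \<phi> x)"
    using w \<phi> by (simp add: has_weak_partials_def)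
  then show ?thesis
    using integral_borel_representative(1)[OF C f m(1)] integral_borel_representative(1)[OF C g m(2)] by simp
qed

lemma integrable_borel_representative:
  assumes l: "locally_integrable C g" and C: "C \<in> sets borel"
    and g: "g' \<in> borel_measurable borel" "\<forall>x. x \<notin> C \<longrightarrow> g' x = 0" "AE x in lebesgue. x \<in> C \<longrightarrow> g x = g' x"
    and ab: "cbox a b \<subseteq> C"
  shows "integrable lborel (\<lambda>x. g' x * indicator (cbox a b) x)"
proof -
  have "set_integrable lebesgue (cbox a b) g"
    using l ab by (simp add: locally_integrable_def)
  then have "set_integrable lebesgue C (\<lambda>x. g x * indicator (cbox a b) x)"
    unfolding set_integrable_def
    by (rule Bochner_Integration.integrable_cong[THEN iffD1, rotated 2])
       (use ab in \<open>auto simp: indicator_def\<close>)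
  then show ?thesis
    using integral_borel_representative(2)[OF C g, of "indicator (cbox a b)"] by simp
qed

section \<open>Bumps approximating the indicator of a box\<close>

definition smooth_step :: "nat \<Rightarrow> real \<Rightarrow> real" where
  "smooth_step = (SOME S. deriv_seq S \<and> (\<forall>t. t \<le> 0 \<longrightarrow> S 0 t = 0) \<and> (\<forall>t. t \<ge> 1 \<longrightarrow> S 0 t = 1) \<and>
    (\<forall>t. S (Suc 0) t \<ge> 0) \<and> (\<forall>k t. t \<notin> {0..1} \<longrightarrow> S (Suc k) t = 0) \<and> (\<forall>s t. s \<le> t \<longrightarrow> S 0 s \<le> S 0 t))"

lemma smooth_step:
  shows "deriv_seq smooth_step" "\<And>t. t \<le> 0 \<Longrightarrow> smooth_step 0 t = 0" "\<And>t. t \<ge> 1 \<Longrightarrow> smooth_step 0 t = 1"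
    "\<And>t. smooth_step (Suc 0) t \<ge> 0" "\<And>k t. t \<notin> {0..1} \<Longrightarrow> smooth_step (Suc k) t = 0"
    "\<And>s t. s \<le> t \<Longrightarrow> smooth_step 0 s \<le> smooth_step 0 t"
proof -
  have "\<exists>S. deriv_seq S \<and> (\<forall>t. t \<le> 0 \<longrightarrow> S 0 t = 0) \<and> (\<forall>t. t \<ge> 1 \<longrightarrow> S 0 t = 1) \<and>
    (\<forall>t. S (Suc 0) t \<ge> 0) \<and> (\<forall>k t. t \<notin> {0..1} \<longrightarrow> S (Suc k) t = 0) \<and> (\<forall>s t. s \<le> t \<longrightarrow> S 0 s \<le> S 0 t)"
    by (metis exists_smooth_step)
  from someI_ex[OF this, folded smooth_step_def]
  show "deriv_seq smooth_step" "\<And>t. t \<le> 0 \<Longrightarrow> smooth_step 0 t = 0" "\<And>t. t \<ge> 1 \<Longrightarrow> smooth_step 0 t = 1"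
    "\<And>t. smooth_step (Suc 0) t \<ge> 0" "\<And>k t. t \<notin> {0..1} \<Longrightarrow> smooth_step (Suc k) t = 0"
    "\<And>s t. s \<le> t \<Longrightarrow> smooth_step 0 s \<le> smooth_step 0 t"
    by blast+
qed

lemma smooth_step_bounds: "0 \<le> smooth_step 0 t" "smooth_step 0 t \<le> 1"
  using smooth_step(6)[of "min t 0" t] smooth_step(6)[of t "max t 1"]
    smooth_step(2)[of "min t 0"] smooth_step(3)[of "max t 1"] by auto

text \<open>A step of width 1/c rising at \<open>a\<close> minus one rising at \<open>b\<close>. The
  support spills over beyond \<open>b\<close> only, up to \<open>bump_corner b c\<close>; this is
  harmless, because the orthant contains with a point all points above it.\<close>

definition bump_seq :: "real ^ 'n \<Rightarrow> real ^ 'n \<Rightarrow> real \<Rightarrow> 'n \<Rightarrow> nat \<Rightarrow> real \<Rightarrow> real" where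
  "bump_seq a b c i k t =
    c ^ k * smooth_step k (c * t + - c * a $ i) - c ^ k * smooth_step k (c * t + - c * b $ i)"

abbreviation box_bump :: "real ^ 'n \<Rightarrow> real ^ 'n \<Rightarrow> real \<Rightarrow> real ^ 'n \<Rightarrow> real" where
  "box_bump a b c \<equiv> prod_fun (bump_seq a b c) (\<lambda>_. 0)"

abbreviation bump_corner :: "real ^ 'n \<Rightarrow> real \<Rightarrow> real ^ 'n" where
  "bump_corner b c \<equiv> (\<chi> i. b $ i + 1 / c)"

lemma deriv_seq_bump_seq: "\<forall>i. deriv_seq (bump_seq a b c i)"
  unfolding bump_seq_def[abs_def] by (intro allI deriv_seq_diff deriv_seq_affine smooth_step(1))

lemma bump_seq_eq_0:
  assumes "c > 0" "a $ i \<le> b $ i" "t \<notin> {a $ i..bump_corner b c $ i}"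
  shows "bump_seq a b c i k t = 0"
proof -
  consider "c * t + - c * a $ i < 0" "c * t + - c * b $ i < 0" | "c * t + - c * a $ i > 1" "c * t + - c * b $ i > 1"
  proof (cases "t < a $ i")
    case True
    then have "c * t < c * a $ i" "c * t < c * b $ i" using assms by auto
    then show ?thesis using that(1) by simp
  next
    case False
    then have "t > b $ i + 1 / c" using assms by auto
    then have "c * t > c * (b $ i + 1 / c)" using assms by (simp only: mult_strict_left_mono)
    then have "c * t > c * b $ i + 1" using assms by (simp add: distrib_left)
    moreover have "c * b $ i \<ge> c * a $ i" using assms by simp
    ultimately show ?thesis using that(2) by simp
  qed
  then show ?thesis
    by cases (cases k; simp add: bump_seq_def smooth_step(2,3,5))+
qed

lemma bump_seq_bounds:
  assumes "c > 0" "a $ i \<le> b $ i"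
  shows "0 \<le> bump_seq a b c i 0 t" "bump_seq a b c i 0 t \<le> 1"
proof -
  have "c * t + - c * b $ i \<le> c * t + - c * a $ i" using assms by simp
  from smooth_step(6)[OF this] show "0 \<le> bump_seq a b c i 0 t" by (simp add: bump_seq_def)
  show "bump_seq a b c i 0 t \<le> 1"
    using smooth_step_bounds[of "c * t + - c * a $ i"] smooth_step_bounds[of "c * t + - c * b $ i"]
    by (simp add: bump_seq_def)
qed

lemma box_bump_bounds:
  assumes "c > 0" "\<And>i. a $ i \<le> b $ i"
  shows "0 \<le> box_bump a b c x" "box_bump a b c x \<le> 1"
  unfolding prod_fun_def using assms
  by (auto intro!: prod_nonneg prod_le_1 bump_seq_bounds)

lemma box_bump_eq_0:
  assumes "c > 0" "\<And>i. a $ i \<le> b $ i" "x \<notin> cbox a (bump_corner b c)"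
  shows "prod_fun (bump_seq a b c) k x = 0"
  by (rule prod_fun_eq_0[OF _ assms(3)]) (intro bump_seq_eq_0 assms)

lemma test_function_box_bump:
  assumes "c > 0" "\<And>i. a $ i \<le> b $ i" "cbox a (bump_corner b c) \<subseteq> C"
  shows "test_function C (prod_fun (bump_seq a b c) k)"
  by (rule test_function_prod_fun[OF deriv_seq_bump_seq _ assms(3)]) (intro bump_seq_eq_0 assms)

lemma box_bump_measurable [measurable]: "prod_fun (bump_seq a b c) k \<in> borel_measurable borel"
  by (intro prod_fun_borel deriv_seq_bump_seq)

text \<open>A step is 0 at its own foot for every slope. Hence the limit is the indicator of an
  interval without its left end but with its right end.\<close>

lemma bump_seq_tendsto:
  assumes "a $ i \<le> b $ i"
  shows "(\<lambda>n. bump_seq a b (real n + 1) i 0 t) \<longlonglongrightarrow> indicator {a $ i <.. b $ i} t"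
proof -
  have lim: "(\<lambda>n. smooth_step 0 ((real n + 1) * (t - r))) \<longlonglongrightarrow> indicator {r<..} t" for r
  proof (cases "t > r")
    case True
    have "filterlim (\<lambda>n. (real n + 1) * (t - r)) at_top sequentially"
      using True by real_asymp
    then have "eventually (\<lambda>n. (real n + 1) * (t - r) \<ge> 1) sequentially"
      by (simp add: filterlim_at_top)
    then show ?thesis
      using True by (intro tendsto_eventually) (auto elim!: eventually_mono simp: smooth_step(3))
  next
    case False
    then have "(real n + 1) * (t - r) \<le> 0" for n by (simp add: mult_nonneg_nonpos)
    then show ?thesis using False by (simp add: smooth_step(2))
  qed
  have "(\<lambda>n. smooth_step 0 ((real n + 1) * (t - a $ i)) - smooth_step 0 ((real n + 1) * (t - b $ i)))
     \<longlonglongrightarrow> indicator {a $ i<..} t - indicator {b $ i<..} t"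
    by (intro tendsto_intros lim)
  also have "indicator {a $ i<..} t - indicator {b $ i<..} t = (indicator {a $ i <.. b $ i} t :: real)"
    using assms by (auto simp: indicator_def)
  finally show ?thesis
    by (simp add: bump_seq_def algebra_simps)
qed

lemma box_bump_tendsto:
  assumes ab: "\<And>i. a $ i \<le> b $ i" and x: "x \<notin> cbox a b - box a b"
  shows "(\<lambda>n. box_bump a b (real n + 1) x) \<longlonglongrightarrow> indicator (cbox a b) x"
proof -
  have "(\<lambda>n. box_bump a b (real n + 1) x) \<longlonglongrightarrow> (\<Prod>i\<in>UNIV. indicator {a $ i <.. b $ i} (x $ i))"
    unfolding prod_fun_def by (intro tendsto_prod bump_seq_tendsto ab)
  also have "(\<Prod>i\<in>UNIV. indicator {a $ i <.. b $ i} (x $ i)) = (indicator (cbox a b) x :: real)"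
  proof (cases "x \<in> cbox a b")
    case True
    then have "x \<in> box a b" using x by auto
    then show ?thesis using True by (auto simp: mem_box_cart less_imp_le)
  next
    case False
    then obtain i where "\<not> (a $ i \<le> x $ i \<and> x $ i \<le> b $ i)" by (auto simp: mem_box_cart)
    then have "indicator {a $ i <.. b $ i} (x $ i) = (0 :: real)" by (auto simp: indicator_def)
    then have "(\<Prod>i\<in>UNIV. indicator {a $ i <.. b $ i} (x $ i)) = (0 :: real)"
      by (metis UNIV_I finite prod_zero_iff)
    then show ?thesis using False by simp
  qed
  finally show ?thesis .
qed

text \<open>For steepness at least 1 all bumps live in the fixed box
  \<open>cbox a (bump_corner b 1)\<close> and are bounded by 1, which gives the dominating
  function.\<close>

lemma box_bump_integral_tendsto:
  fixes u :: "real ^ 'n \<Rightarrow> real"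
  assumes ab: "\<And>i. a $ i \<le> b $ i" and [measurable]: "u \<in> borel_measurable borel"
    and int: "integrable lborel (\<lambda>x. u x * indicator (cbox a (bump_corner b 1)) x)"
  shows "(\<lambda>n. LINT x|lborel. u x * box_bump a b (real n + 1) x) \<longlonglongrightarrow> (LINT x|lborel. u x * indicator (cbox a b) x)"
proof (rule integral_dominated_convergence[where w="\<lambda>x. norm (u x * indicator (cbox a (bump_corner b 1)) x)"])
  show "integrable lborel (\<lambda>x. norm (u x * indicator (cbox a (bump_corner b 1)) x))"
    by (rule integrable_norm[OF int])
  have "AE x in lborel. x \<notin> cbox a b - box a b"
    by (rule AE_not_in[OF null_sets_cbox_Diff_box])
  then show "AE x in lborel. (\<lambda>n. u x * box_bump a b (real n + 1) x) \<longlonglongrightarrow> u x * indicator (cbox a b) x"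
    by eventually_elim (intro tendsto_intros box_bump_tendsto ab)
  show "AE x in lborel. norm (u x * box_bump a b (real n + 1) x) \<le> norm (u x * indicator (cbox a (bump_corner b 1)) x)" for n
  proof (rule AE_I2)
    fix x
    show "norm (u x * box_bump a b (real n + 1) x) \<le> norm (u x * indicator (cbox a (bump_corner b 1)) x)"
    proof (cases "x \<in> cbox a (bump_corner b 1)")
      case True
      have "\<bar>box_bump a b (real n + 1) x\<bar> \<le> 1"
        using box_bump_bounds[of "real n + 1" a b x] ab by simp
      then show ?thesis using True by (simp add: abs_mult mult_left_le)
    next
      case False
      have "cbox a (bump_corner b (real n + 1)) \<subseteq> cbox a (bump_corner b 1)"
      proof
        fix z assume z: "z \<in> cbox a (bump_corner b (real n + 1))"
        have "z $ i \<le> b $ i + 1 / 1" for i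
        proof -
          have "z $ i \<le> b $ i + 1 / (real n + 1)" using z by (simp add: mem_box_cart)
          also have "1 / (real n + 1) \<le> 1" by simp
          finally show ?thesis by simp
        qed
        then show "z \<in> cbox a (bump_corner b 1)" using z by (simp add: mem_box_cart)
      qed
      then have "box_bump a b (real n + 1) x = 0"
        using False ab by (intro box_bump_eq_0) auto
      then show ?thesis by simp
    qed
  qed
qed measurable

lemma prod_Basis_cart: "(\<Prod>b\<in>(Basis :: (real ^ 'n) set). f b) = (\<Prod>i\<in>UNIV. f (axis i 1))"
proof -
  have inj: "inj (\<lambda>i. axis i 1 :: real ^ 'n)" by (auto simp: inj_def axis_eq_axis)
  have B: "(Basis :: (real ^ 'n) set) = range (\<lambda>i. axis i 1)" by (auto simp: Basis_vec_def)
  show ?thesis unfolding B prod.reindex[OF inj] by simp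
qed

lemma nn_integral_lborel_prod_cart:
  assumes "\<And>i. f i \<in> borel_measurable borel"
  shows "(\<integral>\<^sup>+x. (\<Prod>i\<in>UNIV. f i (x $ i)) \<partial>(lborel :: (real ^ 'n) measure)) = (\<Prod>i\<in>UNIV. \<integral>\<^sup>+t. f i t \<partial>lborel)"
proof -
  define ix :: "real ^ 'n \<Rightarrow> 'n" where "ix = inv (\<lambda>i. axis i 1)"
  have "inj (\<lambda>i. axis i 1 :: real ^ 'n)" by (auto simp: inj_def axis_eq_axis)
  then have ix: "ix (axis i 1) = i" for i unfolding ix_def by (rule inv_f_f)
  have "(\<integral>\<^sup>+x. (\<Prod>b\<in>Basis. f (ix b) (x \<bullet> b)) \<partial>(lborel :: (real ^ 'n) measure)) = (\<Prod>b\<in>(Basis :: (real ^ 'n) set). \<integral>\<^sup>+t. f (ix b) t \<partial>lborel)"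
    by (rule nn_integral_lborel_prod) (use assms in auto)
  then show ?thesis
    unfolding prod_Basis_cart ix by (simp add: inner_axis)
qed

text \<open>In each coordinate the derivative is the difference of two step derivatives of integral
  1, so the product over d coordinates is at most 2^d. These are the 2^d corner values of a box in
  smoothed form.\<close>

lemma nn_integral_abs_deriv_box_bump:
  fixes a b :: "real ^ 'n"
  assumes "c > 0" "\<And>i. a $ i \<le> b $ i"
  shows "(\<integral>\<^sup>+x. ennreal \<bar>prod_fun (bump_seq a b c) (\<lambda>_. 1) x\<bar> \<partial>lborel) \<le> ennreal (2 ^ CARD('n))"
proof -
  note [measurable] = deriv_seq_borel[OF smooth_step(1)]
  have 1: "(\<integral>\<^sup>+t. ennreal \<bar>c * smooth_step (Suc 0) (c * t + r)\<bar> \<partial>lborel) = 1" for r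
    by (rule nn_integral_abs_deriv_step) (use smooth_step \<open>c > 0\<close> in auto)
  have 2: "(\<integral>\<^sup>+t. ennreal \<bar>bump_seq a b c i 1 t\<bar> \<partial>lborel) \<le> 2" for i
  proof -
    have "(\<integral>\<^sup>+t. ennreal \<bar>bump_seq a b c i 1 t\<bar> \<partial>lborel) \<le>
      (\<integral>\<^sup>+t. ennreal \<bar>c * smooth_step (Suc 0) (c * t + - c * a $ i)\<bar> + ennreal \<bar>c * smooth_step (Suc 0) (c * t + - c * b $ i)\<bar> \<partial>lborel)"
    proof (rule nn_integral_mono)
      fix t
      have "\<bar>bump_seq a b c i 1 t\<bar> \<le> \<bar>c * smooth_step (Suc 0) (c * t + - c * a $ i)\<bar> + \<bar>c * smooth_step (Suc 0) (c * t + - c * b $ i)\<bar>"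
        unfolding bump_seq_def One_nat_def power_Suc power_0 mult_1_right by (rule abs_triangle_ineq4)
      then show "ennreal \<bar>bump_seq a b c i 1 t\<bar> \<le> ennreal \<bar>c * smooth_step (Suc 0) (c * t + - c * a $ i)\<bar> + ennreal \<bar>c * smooth_step (Suc 0) (c * t + - c * b $ i)\<bar>"
        by (simp add: ennreal_leI flip: ennreal_plus)
    qed
    also have "\<dots> = 2"
      unfolding 1[symmetric] by (subst nn_integral_add) (simp_all only: 1, auto)
    finally show ?thesis .
  qed
  have "(\<integral>\<^sup>+x. ennreal \<bar>prod_fun (bump_seq a b c) (\<lambda>_. 1) x\<bar> \<partial>lborel)
     = (\<integral>\<^sup>+x. (\<Prod>i\<in>UNIV. ennreal \<bar>bump_seq a b c i 1 (x $ i)\<bar>) \<partial>lborel)"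
    by (simp add: prod_fun_def prod_ennreal abs_prod)
  also have "\<dots> = (\<Prod>i\<in>UNIV. \<integral>\<^sup>+t. ennreal \<bar>bump_seq a b c i 1 t\<bar> \<partial>lborel)"
    by (rule nn_integral_lborel_prod_cart) (use deriv_seq_borel[OF deriv_seq_bump_seq[rule_format]] in measurable)
  also have "\<dots> \<le> (\<Prod>i\<in>(UNIV :: 'n set). 2)"
    by (intro prod_mono_ennreal 2)
  also have "\<dots> = ennreal (2 ^ CARD('n))"
    by (simp add: ennreal_power[symmetric])
  finally show ?thesis .
qed

text \<open>Letting the bumps tend to indicators gives the bound for all boxes, that is, nonnegative
  box integrals of M + u and of M - u; the sign criterion for boxes does the rest.\<close>

lemma AE_abs_le_if_bump_integrals_le:
  fixes u :: "real ^ 'n::{finite,linorder} \<Rightarrow> real"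
  assumes u[measurable]: "u \<in> borel_measurable borel"
    and int: "\<And>a b. cbox a b \<subseteq> orthant m \<Longrightarrow> integrable lborel (\<lambda>x. u x * indicator (cbox a b) x)"
    and bound: "\<And>a b c. a \<in> orthant m \<Longrightarrow> (\<And>i. a $ i \<le> b $ i) \<Longrightarrow> c > 0 \<Longrightarrow>
      \<bar>LINT x|lborel. u x * box_bump a b c x\<bar> \<le> M * (LINT x|lborel. box_bump a b c x)"
  shows "AE x in lebesgue. x \<in> orthant m \<longrightarrow> \<bar>u x\<bar> \<le> M"
proof -
  have one: "integrable lborel (\<lambda>x. 1 * indicator (cbox a b) x :: real)" for a b :: "real ^ 'n::{finite,linorder}"
    using integrable_real_indicator[of "cbox a b" lborel] emeasure_lborel_cbox_finite[of a b] by simp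
  have le: "\<bar>LINT x|lborel. u x * indicator (cbox a b) x\<bar> \<le> M * (LINT x|lborel. 1 * indicator (cbox a b) x)"
    if "cbox a b \<subseteq> orthant m" for a b
  proof (cases "cbox a b = {}")
    case True then show ?thesis by simp
  next
    case False
    then have ab: "\<And>i. a $ i \<le> b $ i" by (simp add: interval_ne_empty_cart)
    then have a: "a \<in> orthant m" using that by (auto simp: mem_box_cart)
    show ?thesis
    proof (rule LIMSEQ_le)
      show "(\<lambda>n. \<bar>LINT x|lborel. u x * box_bump a b (real n + 1) x\<bar>) \<longlonglongrightarrow> \<bar>LINT x|lborel. u x * indicator (cbox a b) x\<bar>"
        by (intro tendsto_rabs box_bump_integral_tendsto ab u int cbox_subset_orthant a)
      show "(\<lambda>n. M * (LINT x|lborel. 1 * box_bump a b (real n + 1) x)) \<longlonglongrightarrow> M * (LINT x|lborel. 1 * indicator (cbox a b) x)"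
        by (intro tendsto_mult tendsto_const box_bump_integral_tendsto ab one borel_measurable_const)
    qed (use bound[OF a ab] in auto)
  qed
  have ae: "AE x in lebesgue. x \<in> orthant m \<longrightarrow> 0 \<le> M + s * u x" if s: "\<bar>s\<bar> = 1" for s
  proof (rule AE_nonneg_if_box_integrals_nonneg[OF open_orthant])
    fix a b :: "real ^ 'n::{finite,linorder}" assume ab: "cbox a b \<subseteq> orthant m"
    have i: "integrable lborel (\<lambda>x. M * (1 * indicator (cbox a b) x) + s * (u x * indicator (cbox a b) x))"
      by (intro Bochner_Integration.integrable_add integrable_mult_right one int ab)
    have eq: "(\<lambda>x. M * (1 * indicator (cbox a b) x) + s * (u x * indicator (cbox a b) x)) = (\<lambda>x. indicator (cbox a b) x *\<^sub>R (M + s * u x))"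
      by (auto simp: indicator_def)
    have b: "set_integrable lborel (cbox a b) (\<lambda>x. M + s * u x)"
      using i unfolding eq set_integrable_def .
    show c: "(\<lambda>x. M + s * u x) absolutely_integrable_on cbox a b"
      using b unfolding set_integrable_def by (subst integrable_completion) measurable
    have "integral (cbox a b) (\<lambda>x. M + s * u x) = (LINT x:cbox a b|lborel. M + s * u x)"
      by (rule set_borel_integral_eq_integral(2)[OF b, symmetric])
    also have "\<dots> = M * (LINT x|lborel. 1 * indicator (cbox a b) x) + s * (LINT x|lborel. u x * indicator (cbox a b) x)"
      unfolding set_lebesgue_integral_def eq[symmetric]
      by (subst Bochner_Integration.integral_add) (intro integrable_mult_right one int ab, intro integrable_mult_right one int ab, simp)
    also have "\<dots> \<ge> 0"
    proof -
      have "\<bar>s * (LINT x|lborel. u x * indicator (cbox a b) x)\<bar> \<le> M * (LINT x|lborel. 1 * indicator (cbox a b) x)"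
        using le[OF ab] s by (simp add: abs_mult)
      then show ?thesis by linarith
    qed
    finally show "0 \<le> integral (cbox a b) (\<lambda>x. M + s * u x)" .
  qed
  have "AE x in lebesgue. x \<in> orthant m \<longrightarrow> 0 \<le> M + u x" "AE x in lebesgue. x \<in> orthant m \<longrightarrow> 0 \<le> M - u x"
    using ae[of 1] ae[of "-1"] by simp_all
  then show ?thesis
    by eventually_elim auto
qed

section \<open>The averaging argument\<close>

text \<open>A non-integrable \<open>u\<close> is covered as well, its Bochner integral being 0 by
  convention.\<close>

lemma abs_integral_le_nn_integral:
  fixes u :: "'a \<Rightarrow> real"
  assumes "(\<integral>\<^sup>+x. ennreal \<bar>u x\<bar> \<partial>M) \<le> ennreal c" "0 \<le> c"
  shows "\<bar>integral\<^sup>L M u\<bar> \<le> c"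
proof (cases "integrable M u")
  case True
  have "ennreal \<bar>integral\<^sup>L M u\<bar> \<le> (\<integral>\<^sup>+x. ennreal \<bar>u x\<bar> \<partial>M)"
    using integral_norm_bound_ennreal[OF True] by simp
  then show ?thesis using assms by (meson ennreal_le_iff order_trans)
qed (use assms in \<open>simp add: not_integrable_integral_eq\<close>)

text \<open>An integrable function of one variable times a bounded kernel, with the other variable
  restricted to a set of finite measure, is integrable on the product.\<close>

lemma Fubini_bounded_kernel:
  fixes u :: "'a::euclidean_space \<Rightarrow> real" and D :: "'b::euclidean_space \<Rightarrow> 'a \<Rightarrow> real"
  assumes u: "integrable lborel u" and [measurable]: "(\<lambda>(t, z). D t z) \<in> borel_measurable (borel \<Otimes>\<^sub>M borel)"
    and K: "\<And>t z. \<bar>D t z\<bar> \<le> K" and S[measurable]: "S \<in> sets borel" and fin: "emeasure lborel S < \<infinity>"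
  shows "(LINT z|lborel. u z * (LINT t|lborel. indicator S t * D t z)) = (LINT t|lborel. indicator S t * (LINT z|lborel. u z * D t z))"
    and "integrable lborel (\<lambda>t. indicator S t * (LINT z|lborel. u z * D t z))"
proof -
  have [measurable]: "u \<in> borel_measurable borel" using u by auto
  have K0: "0 \<le> K" using K[of undefined undefined] by linarith
  define H where "H = (\<lambda>(t, z). indicator S t * (u z * D t z))"
  have [measurable]: "H \<in> borel_measurable (lborel \<Otimes>\<^sub>M lborel)" unfolding H_def by measurable
  have uD: "integrable lborel (\<lambda>z. u z * D t z)" for t
  proof (rule Bochner_Integration.integrable_bound[of _ "\<lambda>z. K * u z"])
    show "AE x in lborel. norm (u x * D t x) \<le> norm (K * u x)"
      using K K0 by (auto intro!: AE_I2 mult_right_mono simp: abs_mult mult.commute[of "\<bar>u _\<bar>"])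
  qed (use u in auto)
  have int: "integrable (lborel \<Otimes>\<^sub>M lborel) H"
  proof (rule lborel_pair.Fubini_integrable)
    show "AE t in lborel. integrable lborel (\<lambda>z. H (t, z))"
      unfolding H_def prod.case by (intro AE_I2 integrable_mult_right uD)
    show "integrable lborel (\<lambda>t. LINT z|lborel. norm (H (t, z)))"
    proof (rule Bochner_Integration.integrable_bound[of _ "\<lambda>t. indicator S t * (K * (LINT z|lborel. \<bar>u z\<bar>))"])
      show "integrable lborel (\<lambda>t. indicator S t * (K * (LINT z|lborel. \<bar>u z\<bar>)))"
        using fin by (intro integrable_mult_left integrable_real_indicator) auto
      show "AE t in lborel. norm (LINT z|lborel. norm (H (t, z))) \<le> norm (indicator S t * (K * (LINT z|lborel. \<bar>u z\<bar>)))"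
      proof (rule AE_I2)
        fix t
        have "(LINT z|lborel. norm (H (t, z))) \<le> (LINT z|lborel. indicator S t * (K * \<bar>u z\<bar>))"
        proof (rule integral_mono)
          show "integrable lborel (\<lambda>z. norm (H (t, z)))"
            unfolding H_def prod.case by (intro integrable_norm integrable_mult_right uD)
          show "integrable lborel (\<lambda>z. indicator S t * (K * \<bar>u z\<bar>))"
            using u by (intro integrable_mult_right integrable_abs)
          show "norm (H (t, z)) \<le> indicator S t * (K * \<bar>u z\<bar>)" for z
            unfolding H_def prod.case using K[of t z]
            by (auto simp: abs_mult indicator_def mult.commute[of "\<bar>u z\<bar>"] intro: mult_right_mono)
        qed
        also have "\<dots> = indicator S t * (K * (LINT z|lborel. \<bar>u z\<bar>))" by simp
        finally show "norm (LINT z|lborel. norm (H (t, z))) \<le> norm (indicator S t * (K * (LINT z|lborel. \<bar>u z\<bar>)))"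
          using K0 by (simp add: integral_nonneg_AE)
      qed
    qed measurable
  qed measurable
  have e1: "(LINT z|lborel. H (t, z)) = indicator S t * (LINT z|lborel. u z * D t z)" for t
    by (simp add: H_def)
  have e2: "(LINT t|lborel. H (t, z)) = u z * (LINT t|lborel. indicator S t * D t z)" for z
  proof -
    have "(LINT t|lborel. H (t, z)) = (LINT t|lborel. u z * (indicator S t * D t z))"
      by (intro Bochner_Integration.integral_cong) (auto simp: H_def)
    then show ?thesis by simp
  qed
  show "(LINT z|lborel. u z * (LINT t|lborel. indicator S t * D t z)) = (LINT t|lborel. indicator S t * (LINT z|lborel. u z * D t z))"
    using lborel_pair.Fubini_integral[of "\<lambda>t z. H (t, z)"] int by (simp add: e1 e2)
  show "integrable lborel (\<lambda>t. indicator S t * (LINT z|lborel. u z * D t z))"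
    using lborel_pair.integrable_fst'[OF int] by (simp add: e1)
qed

lemma prod_fun_bump_translate:
  "prod_fun (bump_seq a b c) k (z - w) = prod_fun (bump_seq (a + w) (b + w) c) k z"
  by (simp add: prod_fun_def bump_seq_def algebra_simps)

lemma prod_fun_bump_bounded:
  assumes "c > 0" "\<And>i. a $ i \<le> b $ i"
  shows "\<exists>K\<ge>0. \<forall>x. \<bar>prod_fun (bump_seq a b c) k x\<bar> \<le> K"
proof -
  have "bounded (prod_fun (bump_seq a b c) k ` cbox a (bump_corner b c))"
    by (intro compact_imp_bounded compact_continuous_image continuous_on_prod_fun deriv_seq_bump_seq compact_cbox)
  then obtain K where K: "\<And>x. x \<in> cbox a (bump_corner b c) \<Longrightarrow> \<bar>prod_fun (bump_seq a b c) k x\<bar> \<le> K"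
    by (auto simp: bounded_iff)
  have "\<bar>prod_fun (bump_seq a b c) k x\<bar> \<le> max 0 K" for x
    using K[of x] box_bump_eq_0[OF assms, of x k] by (cases "x \<in> cbox a (bump_corner b c)") auto
  then show ?thesis by (intro exI[of _ "max 0 K"]) auto
qed

lemma has_derivative_box_bump_line:
  "((\<lambda>t. box_bump a b c (z - t *\<^sub>R y)) has_real_derivative
     - (\<Sum>i\<in>UNIV. y $ i * prod_fun (bump_seq a b c) ((\<lambda>_. 0)(i := Suc 0)) (z - t *\<^sub>R y))) (at t)"
proof -
  define D where "D = bump_seq a b c"
  have dD: "(D i 0 has_real_derivative D i (Suc 0) s) (at s)" for i s
    using deriv_seqD[OF deriv_seq_bump_seq[rule_format]] by (simp add: D_def)
  have d: "((\<lambda>t. D i 0 (z $ i - t * y $ i)) has_derivative (\<lambda>h. h * (- y $ i * D i (Suc 0) (z $ i - t * y $ i)))) (at t)" for i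
  proof -
    have "((\<lambda>t. D i 0 (z $ i - t * y $ i)) has_real_derivative D i (Suc 0) (z $ i - t * y $ i) * (- y $ i)) (at t)"
      by (rule DERIV_chain2[OF dD]) (auto intro!: derivative_eq_intros)
    then show ?thesis
      unfolding has_field_derivative_def by (rule has_derivative_eq_rhs) (auto simp: mult_ac)
  qed
  have p: "prod_fun D ((\<lambda>_. 0)(i := Suc 0)) x = D i (Suc 0) (x $ i) * (\<Prod>j\<in>UNIV - {i}. D j 0 (x $ j))" for i x
    unfolding prod_fun_def by (subst prod.remove[of _ i]) (auto intro!: prod.cong)
  have "((\<lambda>t. \<Prod>i\<in>UNIV. D i 0 (z $ i - t * y $ i)) has_derivative
     (\<lambda>h. \<Sum>i\<in>UNIV. (h * (- y $ i * D i (Suc 0) (z $ i - t * y $ i))) * (\<Prod>j\<in>UNIV - {i}. D j 0 (z $ j - t * y $ j)))) (at t)"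
    by (rule has_derivative_prod[OF d])
  also have "(\<lambda>h. \<Sum>i\<in>UNIV. (h * (- y $ i * D i (Suc 0) (z $ i - t * y $ i))) * (\<Prod>j\<in>UNIV - {i}. D j 0 (z $ j - t * y $ j)))
     = (*) (- (\<Sum>i\<in>UNIV. y $ i * prod_fun D ((\<lambda>_. 0)(i := Suc 0)) (z - t *\<^sub>R y)))"
    by (simp add: fun_eq_iff p sum_distrib_left sum_negf[symmetric] mult_ac)
  finally have "((\<lambda>t. \<Prod>i\<in>UNIV. D i 0 (z $ i - t * y $ i)) has_derivative
     (*) (- (\<Sum>i\<in>UNIV. y $ i * prod_fun D ((\<lambda>_. 0)(i := Suc 0)) (z - t *\<^sub>R y)))) (at t)" .
  moreover have "(\<lambda>t. \<Prod>i\<in>UNIV. D i 0 (z $ i - t * y $ i)) = (\<lambda>t. prod_fun D (\<lambda>_. 0) (z - t *\<^sub>R y))"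
    by (simp add: prod_fun_def)
  ultimately show ?thesis
    unfolding has_field_derivative_def D_def by (simp only:)
qed

lemma count_list_sorted_list_of_set: "count_list (sorted_list_of_set (UNIV :: 'n::{finite,linorder} set)) i = 1"
proof -
  have "distinct xs \<Longrightarrow> count_list xs i = (if i \<in> set xs then 1 else 0)" for xs :: "'n list"
    by (induction xs) auto
  from this[of "sorted_list_of_set UNIV"] show ?thesis by simp
qed

text \<open>What averaging uses of Borel representatives of f, of its mixed derivative and of the
  gradient: integrability over boxes in the orthant and the two identities with test functions.
  \<open>F\<close> can bound f on the whole space because the representatives are taken to be 0 off
  the orthant.\<close>

locale weak_data =
  fixes m :: nat and f g :: "real ^ 'n::{finite,linorder} \<Rightarrow> real"
    and G :: "'n::{finite,linorder} \<Rightarrow> real ^ 'n::{finite,linorder} \<Rightarrow> real" and F :: real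
  assumes f_meas [measurable]: "f \<in> borel_measurable borel"
    and g_meas [measurable]: "g \<in> borel_measurable borel"
    and G_meas [measurable]: "\<And>i. G i \<in> borel_measurable borel"
    and F_nonneg: "0 \<le> F" and f_bound: "AE x in lborel. \<bar>f x\<bar> \<le> F"
    and g_int: "\<And>a b. cbox a b \<subseteq> orthant m \<Longrightarrow> integrable lborel (\<lambda>x. g x * indicator (cbox a b) x)"
    and G_int: "\<And>i a b. cbox a b \<subseteq> orthant m \<Longrightarrow> integrable lborel (\<lambda>x. G i x * indicator (cbox a b) x)"
    and mixed: "\<And>\<phi>. test_function (orthant m) \<phi> \<Longrightarrow>
      (LINT x|lborel. f x * partials (sorted_list_of_set UNIV) \<phi> x) = (- 1) ^ CARD('n) * (LINT x|lborel. g x * \<phi> x)"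
    and grad: "\<And>i \<phi>. test_function (orthant m) \<phi> \<Longrightarrow>
      (LINT x|lborel. g x * partial i \<phi> x) = - (LINT x|lborel. G i x * \<phi> x)"
begin

text \<open>The mixed derivative takes every coordinate of the bump once, so f is integrated against
  a function of L1 norm at most 2^d.\<close>

lemma bump_integral_le:
  assumes a: "a \<in> orthant m" and ab: "\<And>i. a $ i \<le> b $ i" and c: "c > 0"
  shows "\<bar>LINT x|lborel. g x * box_bump a b c x\<bar> \<le> 2 ^ CARD('n) * F"
proof -
  let ?P = "prod_fun (bump_seq a b c) (\<lambda>_. 1)"
  have "test_function (orthant m) (box_bump a b c)"
    by (intro test_function_box_bump ab c cbox_subset_orthant a)
  from mixed[OF this] have "(LINT x|lborel. f x * ?P x) = (- 1) ^ CARD('n) * (LINT x|lborel. g x * box_bump a b c x)"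
    by (simp add: partials_prod_fun[OF deriv_seq_bump_seq] count_list_sorted_list_of_set)
  then have "\<bar>LINT x|lborel. g x * box_bump a b c x\<bar> = \<bar>LINT x|lborel. f x * ?P x\<bar>"
    by (simp add: abs_mult)
  also have "\<dots> \<le> 2 ^ CARD('n) * F"
  proof (rule abs_integral_le_nn_integral)
    have "(\<integral>\<^sup>+x. ennreal \<bar>f x * ?P x\<bar> \<partial>lborel) \<le> (\<integral>\<^sup>+x. ennreal F * ennreal \<bar>?P x\<bar> \<partial>lborel)"
    proof (rule nn_integral_mono_AE)
      show "AE x in lborel. ennreal \<bar>f x * ?P x\<bar> \<le> ennreal F * ennreal \<bar>?P x\<bar>"
        using f_bound by eventually_elim
          (auto simp: abs_mult F_nonneg ennreal_mult[symmetric] intro!: ennreal_leI mult_right_mono)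
    qed
    also have "\<dots> = ennreal F * (\<integral>\<^sup>+x. ennreal \<bar>?P x\<bar> \<partial>lborel)"
      by (rule nn_integral_cmult) measurable
    also have "\<dots> \<le> ennreal F * ennreal (2 ^ CARD('n))"
      by (intro mult_left_mono nn_integral_abs_deriv_box_bump c ab) auto
    also have "\<dots> = ennreal (2 ^ CARD('n) * F)"
      using F_nonneg by (simp add: ennreal_mult mult.commute)
    finally show "(\<integral>\<^sup>+x. ennreal \<bar>f x * ?P x\<bar> \<partial>lborel) \<le> ennreal (2 ^ CARD('n) * F)" .
  qed (use F_nonneg in simp)
  finally show ?thesis .
qed

text \<open>Limit of steep bumps. It replaces the bound for an alternating sum of corner values of
  f, which make no sense for a function defined almost everywhere.\<close>

lemma box_integral_le:
  assumes a: "cbox a b \<subseteq> orthant m"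
  shows "\<bar>LINT x|lborel. g x * indicator (cbox a b) x\<bar> \<le> 2 ^ CARD('n) * F"
proof (cases "cbox a b = {}")
  case True
  then show ?thesis using F_nonneg by simp
next
  case False
  then have ab: "\<And>i. a $ i \<le> b $ i" by (simp add: interval_ne_empty_cart)
  then have a': "a \<in> orthant m" using a by (auto simp: mem_box_cart)
  have "(\<lambda>n. \<bar>LINT x|lborel. g x * box_bump a b (real n + 1) x\<bar>) \<longlonglongrightarrow> \<bar>LINT x|lborel. g x * indicator (cbox a b) x\<bar>"
    by (intro tendsto_rabs box_bump_integral_tendsto ab g_meas g_int cbox_subset_orthant a')
  then show ?thesis
    by (rule LIMSEQ_le_const2) (use bump_integral_le[OF a' ab] in auto)
qed

end

lemma integrable_mult_bounded_support:
  fixes u P :: "real ^ 'n \<Rightarrow> real"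
  assumes u: "integrable lborel (\<lambda>x. u x * indicator B x)" and um[measurable]: "u \<in> borel_measurable borel"
    and [measurable]: "P \<in> borel_measurable borel"
    and K: "\<And>x. \<bar>P x\<bar> \<le> K" and 0: "\<And>x. x \<notin> B \<Longrightarrow> P x = 0"
  shows "integrable lborel (\<lambda>x. u x * P x)"
proof (rule Bochner_Integration.integrable_bound[of _ "\<lambda>x. K * (u x * indicator B x)"])
  show "integrable lborel (\<lambda>x. K * (u x * indicator B x))" using u by (rule integrable_mult_right)
  show "AE x in lborel. norm (u x * P x) \<le> norm (K * (u x * indicator B x))"
  proof (rule AE_I2)
    fix x
    have "\<bar>u x\<bar> * \<bar>P x\<bar> \<le> \<bar>u x\<bar> * \<bar>K\<bar>" using K[of x] by (intro mult_left_mono) auto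
    then show "norm (u x * P x) \<le> norm (K * (u x * indicator B x))"
      using 0[of x] by (cases "x \<in> B") (auto simp: abs_mult mult.commute)
  qed
qed measurable

lemma orthant_add:
  "a \<in> orthant m \<Longrightarrow> (\<And>i. card {..<i} < m \<Longrightarrow> 0 \<le> y $ i) \<Longrightarrow> a + y \<in> orthant m"
  by (force simp: orthant_def intro: add_pos_nonneg)

lemma nn_integral_lborel_translate:
  fixes u :: "'a::euclidean_space \<Rightarrow> ennreal"
  assumes "u \<in> borel_measurable borel"
  shows "(\<integral>\<^sup>+x. u (x + a) \<partial>lborel) = (\<integral>\<^sup>+x. u x \<partial>lborel)"
proof -
  have "(\<integral>\<^sup>+x. u x \<partial>lborel) = (\<integral>\<^sup>+x. u x \<partial>distr lborel borel ((+) a))"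
    by (simp add: lborel_distr_plus)
  also have "\<dots> = (\<integral>\<^sup>+x. u (a + x) \<partial>lborel)"
    using assms by (subst nn_integral_distr) auto
  finally show ?thesis by (simp add: add.commute)
qed

lemma lebesgue_integral_lborel_translate:
  fixes u :: "'a::euclidean_space \<Rightarrow> real"
  assumes "u \<in> borel_measurable borel"
  shows "(LINT x|lborel. u (x + a)) = (LINT x|lborel. u x)"
proof -
  have "(LINT x|lborel. u x) = (LINT x|distr lborel borel ((+) a). u x)"
    by (simp add: lborel_distr_plus)
  also have "\<dots> = (LINT x|lborel. u (a + x))"
    using assms by (subst integral_distr) auto
  finally show ?thesis by (simp add: add.commute)
qed

lemma lebesgue_integral_lborel_reflect:
  fixes u :: "'a::euclidean_space \<Rightarrow> real"
  assumes "u \<in> borel_measurable borel"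
  shows "(LINT x|lborel. u (a - x)) = (LINT x|lborel. u x)"
proof -
  have "lborel = distr lborel borel (\<lambda>x. a + (- 1) *\<^sub>R x :: 'a)"
    using lborel_affine[of "-1" a] by (simp add: density_1)
  then have "(LINT x|lborel. u x) = (LINT x|distr lborel borel (\<lambda>x. a + (- 1) *\<^sub>R x). u x)"
    by simp
  also have "\<dots> = (LINT x|lborel. u (a + (- 1) *\<^sub>R x))"
    using assms by (subst integral_distr) auto
  finally show ?thesis by simp
qed

lemma ennreal_abs_integral_le: "ennreal \<bar>integral\<^sup>L M u\<bar> \<le> (\<integral>\<^sup>+x. ennreal \<bar>u x\<bar> \<partial>M)"
  using integral_norm_bound_ennreal[of M u] by (cases "integrable M u") (auto simp: not_integrable_integral_eq)

lemma infnorm_borel [measurable]: "infnorm \<in> borel_measurable (borel :: 'a::euclidean_space measure)"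
  by (intro borel_measurable_continuous_onI continuous_intros)

lemma integrable_indicator_cbox: "integrable lborel (indicator (cbox a b) :: 'a::euclidean_space \<Rightarrow> real)"
  by (intro integrable_real_indicator emeasure_lborel_cbox_finite) simp

lemma integrable_box_bump:
  assumes "c > 0" "\<And>i. a $ i \<le> b $ i"
  shows "integrable lborel (box_bump a b c)"
proof -
  have "integrable lborel (\<lambda>x. 1 * indicator (cbox a (bump_corner b c)) x :: real)"
    using integrable_indicator_cbox by simp
  from integrable_mult_bounded_support[OF this, of "box_bump a b c" 1]
    box_bump_bounds[OF assms] box_bump_eq_0[OF assms]
  show ?thesis by simp
qed

section \<open>Differences along segments and averages over boxes\<close>

context weak_data
begin

text \<open>Translating by \<open>y\<close> keeps the support in the orthant because the first m
  entries of \<open>y\<close> are nonnegative; this is why averages are taken over such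
  \<open>y\<close> only.\<close>

lemma bump_translate_integral:
  assumes a: "a \<in> orthant m" and ab: "\<And>i. a $ i \<le> b $ i" and c: "c > 0"
    and y: "\<And>i. card {..<i} < m \<Longrightarrow> 0 \<le> y $ i"
  shows "(LINT z|lborel. g z * prod_fun (bump_seq a b c) ((\<lambda>_. 0)(i := Suc 0)) (z - y))
    = - (LINT z|lborel. G i z * box_bump a b c (z - y))"
proof -
  have "test_function (orthant m) (box_bump (a + y) (b + y) c)"
    using ab by (intro test_function_box_bump c cbox_subset_orthant orthant_add a y) auto
  from grad[OF this, of i] show ?thesis
    by (simp add: partial_prod_fun[OF deriv_seq_bump_seq] prod_fun_bump_translate)
qed

text \<open>This is g(x + y) - g(x) = integral over t in [0,1] of y . grad g(x + t y), tested
  against the bump in x. The translation is moved to the bump, which is differentiated along the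
  segment; Fubini's theorem and the weak gradient move the derivative back to g.\<close>

lemma difference_formula:
  assumes a: "a \<in> orthant m" and ab: "\<And>i. a $ i \<le> b $ i" and c: "c > 0"
    and y: "\<And>i. card {..<i} < m \<Longrightarrow> 0 \<le> y $ i"
  shows "(LINT z|lborel. g z * box_bump a b c (z - y)) - (LINT z|lborel. g z * box_bump a b c z)
    = (LINT t|lborel. indicator {0..1} t * (\<Sum>i\<in>UNIV. y $ i * (LINT z|lborel. G i z * box_bump a b c (z - t *\<^sub>R y))))"
proof -
  let ?\<eta> = "box_bump a b c" and ?\<eta>' = "\<lambda>i. prod_fun (bump_seq a b c) ((\<lambda>_. 0)(i := Suc 0))"
  \<comment> \<open>Lower corner of a box containing the support translated by t y for all t in
    [0,1]; it stays in the orthant because \<open>min 0 (y $ i)\<close> is 0 for the first m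
    coordinates.\<close>
  define a' where "a' = (\<chi> i. a $ i + min 0 (y $ i))"
  define b' where "b' = (\<chi> i. bump_corner b c $ i + max 0 (y $ i))"
  define B where "B = cbox a' b'"
  have a'C: "a' \<in> orthant m"
    using a y by (auto simp: orthant_def a'_def min_def)
  then have BC: "B \<subseteq> orthant m" unfolding B_def by (rule cbox_subset_orthant)
  have supp: "prod_fun (bump_seq a b c) k (z - t *\<^sub>R y) = 0" if t: "t \<in> {0..1}" and z: "z \<notin> B" for k z t
  proof (rule box_bump_eq_0[OF c ab])
    have "z \<in> B" if "z - t *\<^sub>R y \<in> cbox a (bump_corner b c)"
      unfolding B_def mem_box_cart
    proof
      fix i
      have 1: "a $ i \<le> z $ i - t * y $ i" "z $ i - t * y $ i \<le> b $ i + 1 / c"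
        using that by (auto simp: mem_box_cart)
      have "min 0 (y $ i) \<le> t * y $ i \<and> t * y $ i \<le> max 0 (y $ i)"
      proof (cases "0 \<le> y $ i")
        case True
        then show ?thesis using t mult_right_mono[of t 1 "y $ i"] by (auto simp: mult_nonneg_nonneg)
      next
        case False
        then show ?thesis using t mult_right_mono_neg[of t 1 "y $ i"] by (auto simp: mult_nonneg_nonpos)
      qed
      then show "a' $ i \<le> z $ i \<and> z $ i \<le> b' $ i" using 1 by (auto simp: a'_def b'_def)
    qed
    then show "z - t *\<^sub>R y \<notin> cbox a (bump_corner b c)" using z by blast
  qed
  have supp0: "prod_fun (bump_seq a b c) k z = 0" if "z \<notin> B" for k z
    using supp[of 0 z k] that by simp
  have supp1: "prod_fun (bump_seq a b c) k (z - y) = 0" if "z \<notin> B" for k z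
    using supp[of 1 z k] that by simp
  define u where "u = (\<lambda>z. g z * indicator B z)"
  have u: "integrable lborel u" unfolding u_def B_def by (intro g_int BC[unfolded B_def])
  define D where "D = (\<lambda>t z. - (\<Sum>i\<in>UNIV. y $ i * ?\<eta>' i (z - t *\<^sub>R y)))"
  obtain K where K: "\<And>k x. k \<in> range (\<lambda>i. (\<lambda>_. 0)(i := Suc 0)) \<union> {\<lambda>_. 0} \<Longrightarrow> \<bar>prod_fun (bump_seq a b c) k x\<bar> \<le> K k" "\<And>k. 0 \<le> K k"
    using prod_fun_bump_bounded[OF c ab] by metis
  have D: "\<bar>D t z\<bar> \<le> (\<Sum>i\<in>UNIV. \<bar>y $ i\<bar> * K ((\<lambda>_. 0)(i := Suc 0)))" for t z
    unfolding D_def abs_minus_cancel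
    by (rule order_trans[OF sum_abs]) (auto intro!: sum_mono mult_left_mono K simp: abs_mult)
  have Dm: "(\<lambda>(t, z). D t z) \<in> borel_measurable (borel \<Otimes>\<^sub>M borel)"
    unfolding D_def by measurable
  have inner: "(LINT t|lborel. indicator {0..1} t * D t z) = ?\<eta> (z - y) - ?\<eta> z" for z
  proof -
    have "continuous_on UNIV (\<lambda>t. D t z)"
      unfolding D_def
      by (intro continuous_intros continuous_on_compose2[OF continuous_on_prod_fun[OF deriv_seq_bump_seq, of UNIV]]) auto
    then have "isCont (\<lambda>t. D t z) t" for t by (simp add: continuous_on_eq_continuous_at)
    then have "(LINT t|lborel. D t z * indicator {0..1} t) = ?\<eta> (z - 1 *\<^sub>R y) - ?\<eta> (z - 0 *\<^sub>R y)"
      by (intro integral_FTC_Icc_real[where F="\<lambda>t. ?\<eta> (z - t *\<^sub>R y)"])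
         (auto simp: D_def intro: has_derivative_box_bump_line)
    then show ?thesis by (simp add: mult.commute)
  qed
  have int: "integrable lborel (\<lambda>z. w z * prod_fun (bump_seq a b c) k (z - t *\<^sub>R y))"
    if "t \<in> {0..1}" "k \<in> range (\<lambda>i. (\<lambda>_. 0)(i := Suc 0)) \<union> {\<lambda>_. 0}"
      "w \<in> borel_measurable borel" "integrable lborel (\<lambda>x. w x * indicator B x)" for t k w
  proof (rule integrable_mult_bounded_support[where B=B and K="K k"])
    show "(\<lambda>x. prod_fun (bump_seq a b c) k (x - t *\<^sub>R y)) \<in> borel_measurable borel" by measurable
  qed (use that K supp in auto)
  have "(LINT z|lborel. g z * ?\<eta> (z - y)) - (LINT z|lborel. g z * ?\<eta> z)
      = (LINT z|lborel. g z * ?\<eta> (z - y) - g z * ?\<eta> z)"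
    using int[of 1 "\<lambda>_. 0" g] int[of 0 "\<lambda>_. 0" g] u g_meas
    by (subst Bochner_Integration.integral_diff) (auto simp: u_def)
  also have "\<dots> = (LINT z|lborel. u z * (LINT t|lborel. indicator {0..1} t * D t z))"
    unfolding inner using supp0 supp1
    by (intro Bochner_Integration.integral_cong) (auto simp: u_def indicator_def right_diff_distrib)
  also have "\<dots> = (LINT t|lborel. indicator {0..1} t * (LINT z|lborel. u z * D t z))"
    by (rule Fubini_bounded_kernel(1)[OF u Dm D]) auto
  also have "\<dots> = (LINT t|lborel. indicator {0..1} t * (\<Sum>i\<in>UNIV. y $ i * (LINT z|lborel. G i z * ?\<eta> (z - t *\<^sub>R y))))"
  proof (intro Bochner_Integration.integral_cong refl)
    fix t :: real
    show "indicator {0..1} t * (LINT z|lborel. u z * D t z) =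
      indicator {0..1} t * (\<Sum>i\<in>UNIV. y $ i * (LINT z|lborel. G i z * ?\<eta> (z - t *\<^sub>R y)))"
    proof (cases "t \<in> {0..1}")
      case True
      have "(LINT z|lborel. u z * D t z) = (LINT z|lborel. (\<Sum>i\<in>UNIV. - y $ i * (g z * ?\<eta>' i (z - t *\<^sub>R y))))"
        using supp[OF True] by (intro Bochner_Integration.integral_cong)
          (auto simp: u_def D_def indicator_def sum_distrib_left sum_negf mult_ac)
      also have "\<dots> = (\<Sum>i\<in>UNIV. - y $ i * (LINT z|lborel. g z * ?\<eta>' i (z - t *\<^sub>R y)))"
        using int[OF True, of _ g] u by (subst Bochner_Integration.integral_sum) (auto simp: u_def)
      \<comment> \<open>The minus sign from differentiating along -y cancels the one of the weak
        gradient.\<close>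
      also have "\<dots> = (\<Sum>i\<in>UNIV. y $ i * (LINT z|lborel. G i z * ?\<eta> (z - t *\<^sub>R y)))"
        using bump_translate_integral[OF a ab c, of "t *\<^sub>R y"] y True by simp
      finally show ?thesis by simp
    qed simp
  qed
  finally show ?thesis .
qed

text \<open>After exchanging the integrals, the inner one is the integral of g over the averaging
  box shifted by a point x in the support of the bump, and \<open>box_integral_le\<close> bounds it
  by 2^d F.\<close>

lemma bump_average:
  assumes a: "a \<in> orthant m" and ab: "\<And>i. a $ i \<le> b $ i" and c: "c > 0"
    and l: "\<And>i. card {..<i} < m \<Longrightarrow> 0 \<le> l $ i"
  shows "\<bar>LINT y|lborel. indicator (cbox l h) y * (LINT z|lborel. g z * box_bump a b c (z - y))\<bar>
      \<le> 2 ^ CARD('n) * F * (LINT x|lborel. box_bump a b c x)"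
    and "integrable lborel (\<lambda>y. indicator (cbox l h) y * (LINT z|lborel. g z * box_bump a b c (z - y)))"
proof -
  let ?\<eta> = "box_bump a b c"
  define B where "B = cbox a (bump_corner b c)"
  \<comment> \<open>Contains every z with z - y in the support box and y in the averaging box.
    Cutting g off there makes it integrable on the whole space, as Fubini's theorem demands.\<close>
  define B' where "B' = cbox (a + l) (bump_corner b c + h)"
  have B': "z \<in> B'" if "z - y \<in> B" "y \<in> cbox l h" for z y
    unfolding B'_def mem_box_cart
  proof
    fix i
    have "a $ i \<le> z $ i - y $ i" "z $ i - y $ i \<le> bump_corner b c $ i" "l $ i \<le> y $ i" "y $ i \<le> h $ i"
      using that by (simp_all add: B_def mem_box_cart)
    then show "(a + l) $ i \<le> z $ i \<and> z $ i \<le> (bump_corner b c + h) $ i" by simp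
  qed
  have C': "a + l \<in> orthant m" by (rule orthant_add[OF a l])
  define u where "u = (\<lambda>z. g z * indicator B' z)"
  have u: "integrable lborel u" unfolding u_def B'_def by (intro g_int cbox_subset_orthant C')
  have \<eta>0: "?\<eta> x = 0" if "x \<notin> B" for x
    using box_bump_eq_0[OF c ab, of x] that by (simp add: B_def)
  have \<eta>b: "\<bar>?\<eta> x\<bar> \<le> 1" "0 \<le> ?\<eta> x" for x using box_bump_bounds[OF c ab, of x] by auto
  have eq: "indicator (cbox l h) y * (LINT z|lborel. g z * ?\<eta> (z - y)) = indicator (cbox l h) y * (LINT z|lborel. u z * ?\<eta> (z - y))" for y
  proof (cases "y \<in> cbox l h")
    case True
    have "(\<lambda>z. g z * ?\<eta> (z - y)) = (\<lambda>z. u z * ?\<eta> (z - y))"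
    proof (intro ext)
      fix z
      show "g z * ?\<eta> (z - y) = u z * ?\<eta> (z - y)"
        using B'[of z y] \<eta>0[of "z - y"] True by (cases "z \<in> B'") (auto simp: u_def)
    qed
    then show ?thesis by (simp only:)
  qed simp
  have Dm: "(\<lambda>(y, z). ?\<eta> (z - y)) \<in> borel_measurable (borel \<Otimes>\<^sub>M borel)" by measurable
  note fub = Fubini_bounded_kernel[OF u Dm \<eta>b(1) borel_closed[OF closed_cbox] emeasure_lborel_cbox_finite, of l h]
  show int: "integrable lborel (\<lambda>y. indicator (cbox l h) y * (LINT z|lborel. g z * ?\<eta> (z - y)))"
    unfolding eq by (rule fub(2))
  have Dm2: "(\<lambda>(x, z). ?\<eta> x * indicator (cbox l h) (z - x)) \<in> borel_measurable (borel \<Otimes>\<^sub>M borel)" by measurable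
  have "\<bar>?\<eta> x * indicator (cbox l h) (z - x)\<bar> \<le> 1" for x z
    using \<eta>b(1)[of x] by (auto simp: indicator_def)
  note fub2 = Fubini_bounded_kernel[OF u Dm2 this borel_closed[OF closed_cbox] emeasure_lborel_cbox_finite, of a "bump_corner b c", folded B_def]
  have "(LINT y|lborel. indicator (cbox l h) y * (LINT z|lborel. g z * ?\<eta> (z - y)))
      = (LINT z|lborel. u z * (LINT y|lborel. indicator (cbox l h) y * ?\<eta> (z - y)))"
    unfolding eq by (rule fub(1)[symmetric])
  also have "\<dots> = (LINT z|lborel. u z * (LINT x|lborel. indicator B x * (?\<eta> x * indicator (cbox l h) (z - x))))"
  proof (rule Bochner_Integration.integral_cong[OF refl])
    fix z
    \<comment> \<open>Substitution x = z - y: now the bump is the fixed factor and the box the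
      moving one.\<close>
    have "(LINT y|lborel. indicator (cbox l h) y * ?\<eta> (z - y)) = (LINT x|lborel. indicator (cbox l h) (z - x) * ?\<eta> (z - (z - x)))"
      by (rule lebesgue_integral_lborel_reflect[symmetric]) measurable
    also have "\<dots> = (LINT x|lborel. indicator B x * (?\<eta> x * indicator (cbox l h) (z - x)))"
      using \<eta>0 by (intro Bochner_Integration.integral_cong) (auto simp: indicator_def)
    finally show "u z * (LINT y|lborel. indicator (cbox l h) y * ?\<eta> (z - y))
      = u z * (LINT x|lborel. indicator B x * (?\<eta> x * indicator (cbox l h) (z - x)))"
      by (simp only:)
  qed
  also have "\<dots> = (LINT x|lborel. indicator B x * (LINT z|lborel. u z * (?\<eta> x * indicator (cbox l h) (z - x))))"
    by (rule fub2(1))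
  finally have E: "(LINT y|lborel. indicator (cbox l h) y * (LINT z|lborel. g z * ?\<eta> (z - y)))
     = (LINT x|lborel. indicator B x * (LINT z|lborel. u z * (?\<eta> x * indicator (cbox l h) (z - x))))" .
  have i2: "integrable lborel (\<lambda>x. indicator B x * (LINT z|lborel. u z * (?\<eta> x * indicator (cbox l h) (z - x))))"
    by (rule fub2(2))
  have \<eta>i: "integrable lborel ?\<eta>" by (rule integrable_box_bump[OF c ab])
  have pt: "\<bar>indicator B x * (LINT z|lborel. u z * (?\<eta> x * indicator (cbox l h) (z - x)))\<bar> \<le> 2 ^ CARD('n) * F * ?\<eta> x" for x
  proof (cases "x \<in> B")
    case True
    then have xC: "x + l \<in> orthant m"
      using C' by (intro orthant_mono[OF C']) (auto simp: B_def mem_box_cart)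
    have ind: "indicator (cbox l h) (z - x) = (indicator (cbox (x + l) (x + h)) z :: real)" for z
      by (auto simp: indicator_def mem_box_cart algebra_simps)
    have "(LINT z|lborel. u z * (?\<eta> x * indicator (cbox l h) (z - x))) = (LINT z|lborel. ?\<eta> x * (g z * indicator (cbox (x + l) (x + h)) z))"
    proof (intro Bochner_Integration.integral_cong refl)
      fix z
      show "u z * (?\<eta> x * indicator (cbox l h) (z - x)) = ?\<eta> x * (g z * indicator (cbox (x + l) (x + h)) z)"
        unfolding ind[symmetric] using B'[of z "z - x"] True by (auto simp: u_def indicator_def)
    qed
    also have "\<bar>\<dots>\<bar> = ?\<eta> x * \<bar>LINT z|lborel. g z * indicator (cbox (x + l) (x + h)) z\<bar>"
      using \<eta>b(2)[of x] by (simp add: abs_mult)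
    also have "\<dots> \<le> ?\<eta> x * (2 ^ CARD('n) * F)"
      by (intro mult_left_mono box_integral_le cbox_subset_orthant xC \<eta>b)
    finally show ?thesis using True by (simp add: mult_ac)
  qed (use \<eta>0 in simp)
  have "\<bar>LINT x|lborel. indicator B x * (LINT z|lborel. u z * (?\<eta> x * indicator (cbox l h) (z - x)))\<bar>
      \<le> (LINT x|lborel. \<bar>indicator B x * (LINT z|lborel. u z * (?\<eta> x * indicator (cbox l h) (z - x)))\<bar>)"
    by (rule integral_abs_bound)
  also have "\<dots> \<le> (LINT x|lborel. 2 ^ CARD('n) * F * ?\<eta> x)"
    by (intro integral_mono integrable_abs i2 integrable_mult_right \<eta>i pt)
  finally show "\<bar>LINT y|lborel. indicator (cbox l h) y * (LINT z|lborel. g z * ?\<eta> (z - y))\<bar>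
      \<le> 2 ^ CARD('n) * F * (LINT x|lborel. ?\<eta> x)"
    unfolding E by simp
qed

text \<open>The maximum norm of \<open>y\<close> is paired with the sum norm of the gradient, its
  dual. The bound is a nonnegative integral, so later changes of the order of integration are
  instances of Tonelli's theorem.\<close>

lemma ennreal_abs_difference_le:
  assumes a: "a \<in> orthant m" and ab: "\<And>i. a $ i \<le> b $ i" and c: "c > 0"
    and y: "\<And>i. card {..<i} < m \<Longrightarrow> 0 \<le> y $ i"
  shows "ennreal \<bar>(LINT z|lborel. g z * box_bump a b c (z - y)) - (LINT z|lborel. g z * box_bump a b c z)\<bar>
    \<le> (\<integral>\<^sup>+t. (\<integral>\<^sup>+x. ennreal (box_bump a b c x) * (indicator {0..1} t * (ennreal (infnorm y) * ennreal (\<Sum>i\<in>UNIV. \<bar>G i (x + t *\<^sub>R y)\<bar>))) \<partial>lborel) \<partial>lborel)"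
proof -
  let ?\<eta> = "box_bump a b c"
  have pos: "0 \<le> ?\<eta> x" for x by (rule box_bump_bounds[OF c ab])
  have pt: "ennreal \<bar>indicator {0..1} t * (\<Sum>i\<in>UNIV. y $ i * (LINT z|lborel. G i z * ?\<eta> (z - t *\<^sub>R y)))\<bar>
     \<le> (\<integral>\<^sup>+x. ennreal (?\<eta> x) * (indicator {0..1} t * (ennreal (infnorm y) * ennreal (\<Sum>i\<in>UNIV. \<bar>G i (x + t *\<^sub>R y)\<bar>))) \<partial>lborel)" for t
  proof (cases "t \<in> {0..1}")
    case True
    have "ennreal \<bar>\<Sum>i\<in>UNIV. y $ i * (LINT z|lborel. G i z * ?\<eta> (z - t *\<^sub>R y))\<bar>
        \<le> ennreal (\<Sum>i\<in>UNIV. infnorm y * \<bar>LINT z|lborel. G i z * ?\<eta> (z - t *\<^sub>R y)\<bar>)"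
      by (intro ennreal_leI order_trans[OF sum_abs] sum_mono)
        (auto simp: abs_mult intro!: mult_right_mono component_le_infnorm_cart)
    also have "\<dots> = (\<Sum>i\<in>UNIV. ennreal (infnorm y) * ennreal \<bar>LINT z|lborel. G i z * ?\<eta> (z - t *\<^sub>R y)\<bar>)"
      by (simp add: sum_ennreal[symmetric] ennreal_mult infnorm_pos_le)
    also have "\<dots> \<le> (\<Sum>i\<in>UNIV. ennreal (infnorm y) * (\<integral>\<^sup>+z. ennreal \<bar>G i z * ?\<eta> (z - t *\<^sub>R y)\<bar> \<partial>lborel))"
      by (intro sum_mono mult_left_mono ennreal_abs_integral_le) auto
    also have "\<dots> = (\<Sum>i\<in>UNIV. ennreal (infnorm y) * (\<integral>\<^sup>+x. ennreal \<bar>G i (x + t *\<^sub>R y) * ?\<eta> x\<bar> \<partial>lborel))"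
    proof (intro sum.cong refl arg_cong2[where f="(*)"])
      show "(\<integral>\<^sup>+z. ennreal \<bar>G i z * ?\<eta> (z - t *\<^sub>R y)\<bar> \<partial>lborel) = (\<integral>\<^sup>+x. ennreal \<bar>G i (x + t *\<^sub>R y) * ?\<eta> x\<bar> \<partial>lborel)" for i
        using nn_integral_lborel_translate[of "\<lambda>z. ennreal \<bar>G i z * ?\<eta> (z - t *\<^sub>R y)\<bar>" "t *\<^sub>R y"] by simp
    qed
    also have "\<dots> = (\<integral>\<^sup>+x. (\<Sum>i\<in>UNIV. ennreal (infnorm y) * ennreal \<bar>G i (x + t *\<^sub>R y) * ?\<eta> x\<bar>) \<partial>lborel)"
      by (simp add: nn_integral_sum nn_integral_cmult)
    also have "\<dots> = (\<integral>\<^sup>+x. ennreal (?\<eta> x) * (ennreal (infnorm y) * ennreal (\<Sum>i\<in>UNIV. \<bar>G i (x + t *\<^sub>R y)\<bar>)) \<partial>lborel)"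
    proof (intro nn_integral_cong)
      fix x
      have "(\<Sum>i\<in>UNIV. ennreal (infnorm y) * ennreal \<bar>G i (x + t *\<^sub>R y) * ?\<eta> x\<bar>)
          = ennreal (\<Sum>i\<in>UNIV. infnorm y * (\<bar>G i (x + t *\<^sub>R y)\<bar> * ?\<eta> x))"
        using pos by (simp add: abs_mult ennreal_mult infnorm_pos_le sum_ennreal[symmetric])
      also have "\<dots> = ennreal (?\<eta> x * (infnorm y * (\<Sum>i\<in>UNIV. \<bar>G i (x + t *\<^sub>R y)\<bar>)))"
        by (simp add: sum_distrib_left mult_ac)
      also have "\<dots> = ennreal (?\<eta> x) * (ennreal (infnorm y) * ennreal (\<Sum>i\<in>UNIV. \<bar>G i (x + t *\<^sub>R y)\<bar>))"
        using pos by (simp add: ennreal_mult infnorm_pos_le sum_nonneg)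
      finally show "(\<Sum>i\<in>UNIV. ennreal (infnorm y) * ennreal \<bar>G i (x + t *\<^sub>R y) * ?\<eta> x\<bar>) = \<dots>" .
    qed
    finally show ?thesis using True by simp
  qed simp
  have "(LINT z|lborel. g z * ?\<eta> (z - y)) - (LINT z|lborel. g z * ?\<eta> z)
      = (LINT t|lborel. indicator {0..1} t * (\<Sum>i\<in>UNIV. y $ i * (LINT z|lborel. G i z * ?\<eta> (z - t *\<^sub>R y))))"
    by (rule difference_formula[OF a ab c y])
  then show ?thesis
    by (simp only:) (rule order_trans[OF ennreal_abs_integral_le], intro nn_integral_mono pt)
qed

text \<open>With T y the integral of g against the bump translated by y, |Q| T 0 is the integral
  over Q of T y minus that of T y - T 0. The first part is \<open>bump_average\<close>; in the
  second, Tonelli's theorem puts the integral over x outside, and \<open>H\<close> bounds what is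
  inside for each x in the orthant.\<close>

lemma bump_integral_bound:
  assumes a: "a \<in> orthant m" and ab: "\<And>i. a $ i \<le> b $ i" and c: "c > 0"
    and l: "\<And>i. card {..<i} < m \<Longrightarrow> 0 \<le> l $ i" and H0: "0 \<le> H"
    and H: "\<And>x. x \<in> orthant m \<Longrightarrow> (\<integral>\<^sup>+y. indicator (cbox l h) y * (\<integral>\<^sup>+t. indicator {0..1} t *
       (ennreal (infnorm y) * ennreal (\<Sum>i\<in>UNIV. \<bar>G i (x + t *\<^sub>R y)\<bar>)) \<partial>lborel) \<partial>lborel) \<le> ennreal H"
  shows "measure lborel (cbox l h) * \<bar>LINT x|lborel. g x * box_bump a b c x\<bar>
     \<le> (2 ^ CARD('n) * F + H) * (LINT x|lborel. box_bump a b c x)"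
proof -
  let ?\<eta> = "box_bump a b c" and ?Q = "cbox l h"
  let ?\<gamma> = "\<lambda>y t x. indicator {0..1::real} t * (ennreal (infnorm y) * ennreal (\<Sum>i\<in>UNIV. \<bar>G i (x + t *\<^sub>R y)\<bar>))"
  define I where "I = (LINT x|lborel. g x * ?\<eta> x)"
  define T where "T = (\<lambda>y. LINT z|lborel. g z * ?\<eta> (z - y))"
  have pos: "0 \<le> ?\<eta> x" "?\<eta> x \<le> 1" for x by (rule box_bump_bounds[OF c ab])+
  have \<eta>C: "x \<in> orthant m" if "?\<eta> x \<noteq> 0" for x
    using box_bump_eq_0[OF c ab, of x] cbox_subset_orthant[OF a] that by blast
  have \<eta>i: "integrable lborel ?\<eta>" by (rule integrable_box_bump[OF c ab])
  have iT: "integrable lborel (\<lambda>y. indicator ?Q y * T y)"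
    unfolding T_def by (rule bump_average(2)[OF a ab c l])
  have iI: "integrable lborel (\<lambda>y. indicator ?Q y * I)"
    using integrable_indicator_cbox[of l h] by simp
  have "(\<integral>\<^sup>+y. ennreal \<bar>indicator ?Q y * (T y - I)\<bar> \<partial>lborel)
     \<le> (\<integral>\<^sup>+y. indicator ?Q y * (\<integral>\<^sup>+t. (\<integral>\<^sup>+x. ennreal (?\<eta> x) * ?\<gamma> y t x \<partial>lborel) \<partial>lborel) \<partial>lborel)"
  proof (rule nn_integral_mono)
    fix y
    show "ennreal \<bar>indicator ?Q y * (T y - I)\<bar>
      \<le> indicator ?Q y * (\<integral>\<^sup>+t. (\<integral>\<^sup>+x. ennreal (?\<eta> x) * ?\<gamma> y t x \<partial>lborel) \<partial>lborel)"
    proof (cases "y \<in> ?Q")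
      case True
      then have "0 \<le> y $ i" if "card {..<i} < m" for i
        using l[OF that] by (auto simp: mem_box_cart intro: order_trans)
      from ennreal_abs_difference_le[OF a ab c this] True show ?thesis
        by (simp add: T_def I_def)
    qed simp
  qed
  also have "\<dots> = (\<integral>\<^sup>+y. (\<integral>\<^sup>+x. indicator ?Q y * (\<integral>\<^sup>+t. ennreal (?\<eta> x) * ?\<gamma> y t x \<partial>lborel) \<partial>lborel) \<partial>lborel)"
  proof (intro nn_integral_cong)
    fix y :: "real ^ 'n::{finite,linorder}"
    have "(\<integral>\<^sup>+t. (\<integral>\<^sup>+x. ennreal (?\<eta> x) * ?\<gamma> y t x \<partial>lborel) \<partial>lborel) = (\<integral>\<^sup>+x. (\<integral>\<^sup>+t. ennreal (?\<eta> x) * ?\<gamma> y t x \<partial>lborel) \<partial>lborel)"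
      by (rule lborel_pair.Fubini') measurable
    then show "indicator ?Q y * (\<integral>\<^sup>+t. (\<integral>\<^sup>+x. ennreal (?\<eta> x) * ?\<gamma> y t x \<partial>lborel) \<partial>lborel)
      = (\<integral>\<^sup>+x. indicator ?Q y * (\<integral>\<^sup>+t. ennreal (?\<eta> x) * ?\<gamma> y t x \<partial>lborel) \<partial>lborel)"
      by (subst nn_integral_cmult) auto
  qed
  also have "\<dots> = (\<integral>\<^sup>+x. (\<integral>\<^sup>+y. indicator ?Q y * (\<integral>\<^sup>+t. ennreal (?\<eta> x) * ?\<gamma> y t x \<partial>lborel) \<partial>lborel) \<partial>lborel)"
    by (rule lborel_pair.Fubini') measurable
  also have "\<dots> = (\<integral>\<^sup>+x. ennreal (?\<eta> x) * (\<integral>\<^sup>+y. indicator ?Q y * (\<integral>\<^sup>+t. ?\<gamma> y t x \<partial>lborel) \<partial>lborel) \<partial>lborel)"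
  proof (intro nn_integral_cong)
    fix x :: "real ^ 'n::{finite,linorder}"
    have 1: "(\<integral>\<^sup>+t. ennreal (?\<eta> x) * ?\<gamma> y t x \<partial>lborel) = ennreal (?\<eta> x) * (\<integral>\<^sup>+t. ?\<gamma> y t x \<partial>lborel)" for y
      by (rule nn_integral_cmult) measurable
    show "(\<integral>\<^sup>+y. indicator ?Q y * (\<integral>\<^sup>+t. ennreal (?\<eta> x) * ?\<gamma> y t x \<partial>lborel) \<partial>lborel)
      = ennreal (?\<eta> x) * (\<integral>\<^sup>+y. indicator ?Q y * (\<integral>\<^sup>+t. ?\<gamma> y t x \<partial>lborel) \<partial>lborel)"
      unfolding 1 mult.left_commute[of "indicator ?Q _"] by (rule nn_integral_cmult) measurable
  qed
  also have "\<dots> \<le> (\<integral>\<^sup>+x. ennreal (?\<eta> x) * ennreal H \<partial>lborel)"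
  proof (rule nn_integral_mono)
    fix x
    \<comment> \<open>\<open>H\<close> speaks of points of the orthant only; elsewhere the bump
      vanishes.\<close>
    show "ennreal (?\<eta> x) * (\<integral>\<^sup>+y. indicator ?Q y * (\<integral>\<^sup>+t. ?\<gamma> y t x \<partial>lborel) \<partial>lborel) \<le> ennreal (?\<eta> x) * ennreal H"
      using H[OF \<eta>C[of x]] by (cases "?\<eta> x = 0") (auto intro: mult_left_mono)
  qed
  also have "\<dots> = ennreal (H * (LINT x|lborel. ?\<eta> x))"
    using \<eta>i pos H0 by (simp add: nn_integral_multc nn_integral_eq_integral ennreal_mult mult.commute[of H])
  finally have "\<bar>LINT y|lborel. indicator ?Q y * (T y - I)\<bar> \<le> H * (LINT x|lborel. ?\<eta> x)"
    using H0 pos by (intro abs_integral_le_nn_integral) (auto intro!: mult_nonneg_nonneg integral_nonneg_AE)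
  moreover have "(LINT y|lborel. indicator ?Q y * (T y - I)) = (LINT y|lborel. indicator ?Q y * T y) - measure lborel ?Q * I"
    using iT iI by (simp add: right_diff_distrib Bochner_Integration.integral_diff)
  moreover have "\<bar>LINT y|lborel. indicator ?Q y * T y\<bar> \<le> 2 ^ CARD('n) * F * (LINT x|lborel. ?\<eta> x)"
    unfolding T_def by (rule bump_average(1)[OF a ab c l])
  ultimately have "\<bar>measure lborel ?Q * I\<bar> \<le> (2 ^ CARD('n) * F + H) * (LINT x|lborel. ?\<eta> x)"
    unfolding distrib_right by linarith
  then show ?thesis by (simp add: abs_mult I_def)
qed

lemma essential_bound:
  assumes l: "\<And>i. card {..<i} < m \<Longrightarrow> 0 \<le> l $ i" and H0: "0 \<le> H" and Q: "0 < measure lborel (cbox l h)"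
    and H: "\<And>x. x \<in> orthant m \<Longrightarrow> (\<integral>\<^sup>+y. indicator (cbox l h) y * (\<integral>\<^sup>+t. indicator {0..1} t *
       (ennreal (infnorm y) * ennreal (\<Sum>i\<in>UNIV. \<bar>G i (x + t *\<^sub>R y)\<bar>)) \<partial>lborel) \<partial>lborel) \<le> ennreal H"
  shows "AE x in lebesgue. x \<in> orthant m \<longrightarrow> \<bar>g x\<bar> \<le> (2 ^ CARD('n) * F + H) / measure lborel (cbox l h)"
  using bump_integral_bound[OF _ _ _ l H0 H] Q
  by (intro AE_abs_le_if_bump_integrals_le g_meas g_int) (auto simp: field_simps)

end

section \<open>The kernel of the averaging argument\<close>

text \<open>The increments of size at most \<open>r\<close> that map the orthant into itself:
  one-sided in the first m coordinates, two-sided in the others.\<close>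

definition corner_box :: "nat \<Rightarrow> real \<Rightarrow> (real ^ 'n::{finite,linorder}) set" where
  "corner_box m r = cbox (\<chi> i. if card {..<i} < m then 0 else - r) (\<chi> i. r)"

lemma infnorm_le_iff: "infnorm (x :: real ^ 'n) \<le> r \<longleftrightarrow> (\<forall>i. \<bar>x $ i\<bar> \<le> r)"
proof
  show "infnorm x \<le> r" if "\<forall>i. \<bar>x $ i\<bar> \<le> r"
    unfolding infnorm_cart using that by (intro cSup_least) auto
qed (meson component_le_infnorm_cart order_trans)

lemma mem_corner_box:
  "x \<in> corner_box m r \<longleftrightarrow> infnorm x \<le> r \<and> (\<forall>i. card {..<i} < m \<longrightarrow> 0 \<le> x $ i)"
  by (auto simp: corner_box_def mem_box_cart infnorm_le_iff abs_le_iff split: if_splits)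
     (smt (verit))+

text \<open>Counting predecessors enumerates the indices: the map from i to
  \<open>card {..<i}\<close> is strictly increasing, hence a bijection onto the numbers below
  d.\<close>

lemma card_first_indices:
  assumes "m \<le> CARD('n::{finite,linorder})"
  shows "card {i :: 'n::{finite,linorder}. card {..<i} < m} = m"
proof -
  let ?f = "\<lambda>i :: 'n::{finite,linorder}. card {..<i}"
  have mono: "?f i < ?f j" if "i < j" for i j
    by (rule psubset_card_mono) (use that in auto)
  have inj: "inj ?f"
    by (rule injI) (metis mono less_irrefl linorder_neqE)
  have "?f ` UNIV \<subseteq> {..<CARD('n)}"
    by (auto intro!: psubset_card_mono)
  then have img: "?f ` UNIV = {..<CARD('n)}"
    by (rule card_subset_eq[rotated]) (use inj in \<open>simp_all add: card_image\<close>)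
  have "?f ` {i. ?f i < m} = {..<m}"
    using img assms by (auto simp: set_eq_iff image_iff) (metis lessThan_iff less_le_trans rangeE)
  then show ?thesis
    by (metis card_image card_lessThan inj inj_on_subset subset_UNIV)
qed

lemma measure_corner_box:
  assumes "m \<le> CARD('n::{finite,linorder})" "0 \<le> r"
  shows "measure lborel (corner_box m r :: (real ^ 'n::{finite,linorder}) set) = 2 ^ (CARD('n) - m) * r ^ CARD('n)"
proof -
  have "measure lborel (corner_box m r :: (real ^ 'n::{finite,linorder}) set) = (\<Prod>i\<in>(UNIV :: 'n::{finite,linorder} set). r * (if card {..<i} < m then 1 else 2))"
    unfolding corner_box_def using assms
    by (subst content_cbox_cart) (auto simp: interval_ne_empty_cart intro!: prod.cong)
  also have "\<dots> = r ^ CARD('n) * (\<Prod>i\<in>(UNIV :: 'n::{finite,linorder} set). if card {..<i} < m then 1 else 2)"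
    by (simp add: prod.distrib)
  also have "(\<Prod>i\<in>(UNIV :: 'n::{finite,linorder} set). if card {..<i} < m then 1 else 2) = (2 :: real) ^ card {i :: 'n::{finite,linorder}. \<not> card {..<i} < m}"
    by (simp add: prod.If_cases Collect_neg_eq)
  also have "card {i :: 'n::{finite,linorder}. \<not> card {..<i} < m} = CARD('n) - m"
    using card_Diff_subset[of "{i :: 'n::{finite,linorder}. card {..<i} < m}" UNIV] card_first_indices[OF assms(1)]
    by (simp add: Collect_neg_eq Compl_eq_Diff_UNIV)
  finally show ?thesis by (simp add: mult.commute)
qed

lemma corner_box_sets [measurable]: "corner_box m r \<in> sets borel"
  by (simp add: corner_box_def)

lemma emeasure_corner_box:
  assumes "m \<le> CARD('n::{finite,linorder})" "0 \<le> r"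
  shows "emeasure lborel (corner_box m r :: (real ^ 'n::{finite,linorder}) set) = ennreal (2 ^ (CARD('n) - m) * r ^ CARD('n))"
  using measure_corner_box[OF assms] emeasure_lborel_cbox_finite
  by (metis corner_box_def emeasure_eq_ennreal_measure less_irrefl infinity_ennreal_def)

text \<open>The push-forward of Lebesgue measure on the box under the norm has the distribution
  function 2^(d-m) (min a h)^d for a >= 0, the same as the density 2^(d-m) d r^(d-1) on [0,h].
  Finite Borel measures on the line with equal distribution functions coincide, which stands in for
  polar coordinates.\<close>

lemma nn_integral_corner_box_radial:
  fixes u :: "real \<Rightarrow> ennreal"
  assumes m: "m \<le> CARD('n::{finite,linorder})" and h: "0 \<le> h" and [measurable]: "u \<in> borel_measurable borel"
  shows "(\<integral>\<^sup>+y. indicator (corner_box m h) y * u (infnorm y) \<partial>(lborel :: (real ^ 'n::{finite,linorder}) measure))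
    = (\<integral>\<^sup>+r. ennreal (2 ^ (CARD('n) - m) * real CARD('n) * r ^ (CARD('n) - 1)) * indicator {0..h} r * u r \<partial>lborel)"
proof -
  let ?d = "CARD('n)" and ?V = "2 ^ (CARD('n) - m) :: real"
  define M1 :: "real measure" where "M1 = distr (density lborel (indicator (corner_box m h :: (real ^ 'n::{finite,linorder}) set))) borel infnorm"
  define M2 where "M2 = density lborel (\<lambda>r. ennreal (?V * real ?d * r ^ (?d - 1)) * indicator {0..h} r)"
  have [simp]: "sets M1 = sets borel" "sets M2 = sets borel" "space M1 = UNIV" "space M2 = UNIV"
    by (simp_all add: M1_def M2_def)
  have e1: "emeasure M1 {..a} = (if a < 0 then 0 else ennreal (?V * (min a h) ^ ?d))" for a
  proof -
    have "emeasure M1 {..a} = emeasure (density lborel (indicator (corner_box m h))) {y :: real ^ 'n::{finite,linorder}. infnorm y \<le> a}"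
      unfolding M1_def by (subst emeasure_distr) (auto simp: vimage_def)
    also have "\<dots> = (\<integral>\<^sup>+y. indicator (corner_box m h) y * indicator {y :: real ^ 'n::{finite,linorder}. infnorm y \<le> a} y \<partial>lborel)"
      by (subst emeasure_density) auto
    also have "\<dots> = (\<integral>\<^sup>+y. indicator (if a < 0 then {} else corner_box m (min a h)) (y :: real ^ 'n::{finite,linorder}) \<partial>lborel)"
    proof (rule nn_integral_cong)
      fix y :: "real ^ 'n::{finite,linorder}"
      show "indicator (corner_box m h) y * indicator {y. infnorm y \<le> a} y = (indicator (if a < 0 then {} else corner_box m (min a h)) y :: ennreal)"
        using infnorm_pos_le[of y] by (cases "a < 0") (auto simp: indicator_def mem_corner_box)
    qed
    also have "\<dots> = (if a < 0 then 0 else ennreal (?V * (min a h) ^ ?d))"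
      using emeasure_corner_box[OF m, of "min a h"] h by simp
    finally show ?thesis .
  qed
  have e2: "emeasure M2 {..a} = (if a < 0 then 0 else ennreal (?V * (min a h) ^ ?d))" for a
  proof (cases "a < 0")
    case True
    have "emeasure M2 {..a} = (\<integral>\<^sup>+r. 0 \<partial>(lborel :: real measure))"
      unfolding M2_def
    proof (subst emeasure_density)
      show "(\<integral>\<^sup>+r. ennreal (?V * real ?d * r ^ (?d - 1)) * indicator {0..h} r * indicator {..a} r \<partial>lborel) = (\<integral>\<^sup>+r. 0 \<partial>(lborel :: real measure))"
      proof (rule nn_integral_cong)
        show "ennreal (?V * real ?d * r ^ (?d - 1)) * indicator {0..h} r * indicator {..a} r = 0" for r
          using True by (cases "r \<le> a") auto
      qed
    qed auto
    then show ?thesis using True by simp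
  next
    case False
    have "emeasure M2 {..a} = (\<integral>\<^sup>+r. ennreal (?V * real ?d * r ^ (?d - 1)) * indicator {0..min a h} r \<partial>lborel)"
      unfolding M2_def by (subst emeasure_density) (auto intro!: nn_integral_cong simp: indicator_def)
    also have "\<dots> = ennreal (?V * (min a h) ^ ?d - ?V * 0 ^ ?d)"
      by (rule nn_integral_FTC_Icc) (use False h in \<open>auto intro!: derivative_eq_intros\<close>)
    finally show ?thesis using False by (simp add: power_0_left)
  qed
  have fin: "emeasure M1 {..h} < \<infinity>" "emeasure M1 UNIV = emeasure M1 {..h}" "emeasure M2 UNIV = emeasure M2 {..h}"
  proof -
    show "emeasure M1 {..h} < \<infinity>" by (simp add: e1)
    have "emeasure M1 UNIV = (\<integral>\<^sup>+y. indicator (corner_box m h) y \<partial>(lborel :: (real ^ 'n::{finite,linorder}) measure))"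
      unfolding M1_def by (subst emeasure_distr) (auto simp: emeasure_density)
    then show "emeasure M1 UNIV = emeasure M1 {..h}"
      using emeasure_corner_box[OF m h] h by (simp add: e1)
    show "emeasure M2 UNIV = emeasure M2 {..h}"
      unfolding M2_def by (subst (1 2) emeasure_density) (auto intro!: nn_integral_cong simp: indicator_def)
  qed
  have fb: "finite_borel_measure M1" "finite_borel_measure M2"
    using fin by (auto intro!: finite_borel_measure.intro finite_measureI simp: finite_borel_measure_axioms_def e1 e2)
  have "M1 = M2"
    by (rule cdf_unique'[OF fb]) (auto simp: cdf_def measure_def e1 e2)
  have "(\<integral>\<^sup>+y. indicator (corner_box m h) y * u (infnorm y) \<partial>(lborel :: (real ^ 'n::{finite,linorder}) measure)) = (\<integral>\<^sup>+r. u r \<partial>M1)"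
    unfolding M1_def by (simp add: nn_integral_distr nn_integral_density)
  also have "\<dots> = (\<integral>\<^sup>+r. ennreal (?V * real ?d * r ^ (?d - 1)) * indicator {0..h} r * u r \<partial>lborel)"
    unfolding \<open>M1 = M2\<close> M2_def by (subst nn_integral_density) auto
  finally show ?thesis .
qed

lemma nn_integral_lborel_scale:
  fixes u :: "'a::euclidean_space \<Rightarrow> ennreal"
  assumes [measurable]: "u \<in> borel_measurable borel" and "c > 0"
  shows "(\<integral>\<^sup>+x. u x \<partial>lborel) = ennreal (c ^ DIM('a)) * (\<integral>\<^sup>+x. u (c *\<^sub>R x) \<partial>lborel)"
  by (subst lborel_affine[of c 0]) (use \<open>c > 0\<close> in \<open>simp_all add: nn_integral_density nn_integral_distr nn_integral_cmult\<close>)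

text \<open>\<open>kern d h r\<close>, divided by the volume of the box, is the density with which the gradient at distance \<open>r\<close>
  enters the difference of a value and the box average.\<close>

definition kern :: "nat \<Rightarrow> real \<Rightarrow> real \<Rightarrow> real" where
  "kern d h r = r * ((h / r) ^ d - 1) / real d"

lemma kern_nonneg: "0 \<le> r \<Longrightarrow> r \<le> h \<Longrightarrow> 0 \<le> kern d h r"
  by (cases "r = 0") (auto simp: kern_def intro!: divide_nonneg_nonneg mult_nonneg_nonneg one_le_power)

lemma kern_measurable [measurable]: "kern d h \<in> borel_measurable borel"
  unfolding kern_def[abs_def] by measurable

lemma nn_integral_inverse_power:
  assumes "0 < s" "s \<le> 1" "0 < d"
  shows "(\<integral>\<^sup>+t. ennreal (1 / t ^ (d + 1)) * indicator {s..1} t \<partial>lborel) = ennreal (((1 / s) ^ d - 1) / real d)"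
proof -
  let ?F = "\<lambda>t. - (1 / real d) * (1 / t) ^ d"
  have der: "(?F has_real_derivative 1 / t ^ (d + 1)) (at t)" if t: "s \<le> t" for t
  proof -
    obtain k where k: "d = Suc k" using \<open>0 < d\<close> gr0_implies_Suc by blast
    have "(?F has_real_derivative - (1 / real d) * (real d * (1 / t) ^ (d - 1) * - (1 / t\<^sup>2))) (at t)"
      using assms t by (auto intro!: derivative_eq_intros simp: power2_eq_square)
    moreover have "- (1 / real d) * (real d * (1 / t) ^ (d - 1) * - (1 / t\<^sup>2)) = 1 / t ^ (d + 1)"
      using assms t by (simp add: k power_divide power2_eq_square)
    ultimately show ?thesis by simp
  qed
  have "(\<integral>\<^sup>+t. ennreal (1 / t ^ (d + 1)) * indicator {s..1} t \<partial>lborel) = ennreal (?F 1 - ?F s)"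
    by (rule nn_integral_FTC_Icc[where F="?F"]) (use der assms in \<open>auto intro: has_field_derivative_at_within\<close>)
  then show ?thesis by (simp add: diff_divide_distrib)
qed

lemma corner_box_scale: "t > 0 \<Longrightarrow> (1 / t) *\<^sub>R z \<in> corner_box m h \<longleftrightarrow> z \<in> corner_box m (t * h)"
  by (auto simp: mem_corner_box infnorm_mul pos_divide_le_eq mult.commute zero_le_divide_iff)

text \<open>For fixed t substitute z = t y: dy = t^(-d) dz and |y| = |z| / t. For fixed z in the box
  the values of t that occur form [|z|/h, 1], and |z| times the integral of t^(-d-1) over this
  interval is \<open>kern\<close>.\<close>

lemma nn_integral_segments_corner_box:
  fixes \<gamma> :: "real ^ 'n::{finite,linorder} \<Rightarrow> ennreal"
  assumes h: "h > 0" and [measurable]: "\<gamma> \<in> borel_measurable borel"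
  shows "(\<integral>\<^sup>+y. indicator (corner_box m h) y * (\<integral>\<^sup>+t. indicator {0..1} t * (ennreal (infnorm y) * \<gamma> (t *\<^sub>R y)) \<partial>lborel) \<partial>lborel)
    = (\<integral>\<^sup>+z. indicator (corner_box m h) z * (\<gamma> z * ennreal (kern CARD('n) h (infnorm z))) \<partial>lborel)"
proof -
  let ?d = "CARD('n)" and ?Q = "corner_box m h :: (real ^ 'n::{finite,linorder}) set"
  have "(\<integral>\<^sup>+y. indicator ?Q y * (\<integral>\<^sup>+t. indicator {0..1} t * (ennreal (infnorm y) * \<gamma> (t *\<^sub>R y)) \<partial>lborel) \<partial>lborel)
      = (\<integral>\<^sup>+y. (\<integral>\<^sup>+t. indicator {0..1} t * (indicator ?Q y * (ennreal (infnorm y) * \<gamma> (t *\<^sub>R y))) \<partial>lborel) \<partial>lborel)"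
    by (intro nn_integral_cong) (subst nn_integral_cmult[symmetric], measurable, simp add: mult.left_commute)
  also have "\<dots> = (\<integral>\<^sup>+t. (\<integral>\<^sup>+y. indicator {0..1} t * (indicator ?Q y * (ennreal (infnorm y) * \<gamma> (t *\<^sub>R y))) \<partial>lborel) \<partial>lborel)"
    by (rule lborel_pair.Fubini') measurable
  also have "\<dots> = (\<integral>\<^sup>+t. (\<integral>\<^sup>+z. \<gamma> z * (ennreal (infnorm z) * (indicator {0<..1} t * indicator (corner_box m (t * h)) z * ennreal (1 / t ^ (?d + 1)))) \<partial>lborel) \<partial>lborel)"
  proof (rule nn_integral_cong_AE)
    have "AE t in lborel. t \<noteq> (0::real)" by (rule AE_lborel_singleton)
    then show "AE t in lborel. (\<integral>\<^sup>+y. indicator {0..1} t * (indicator ?Q y * (ennreal (infnorm y) * \<gamma> (t *\<^sub>R y))) \<partial>lborel)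
       = (\<integral>\<^sup>+z. \<gamma> z * (ennreal (infnorm z) * (indicator {0<..1} t * indicator (corner_box m (t * h)) z * ennreal (1 / t ^ (?d + 1)))) \<partial>lborel)"
    proof eventually_elim
      case (elim t)
      show ?case
      proof (cases "t \<in> {0<..1}")
        case True
        then have t: "t > 0" "t \<le> 1" by auto
        have "(\<integral>\<^sup>+y. indicator ?Q y * (ennreal (infnorm y) * \<gamma> (t *\<^sub>R y)) \<partial>lborel)
          = ennreal ((1 / t) ^ ?d) * (\<integral>\<^sup>+z. indicator ?Q ((1 / t) *\<^sub>R z) * (ennreal (infnorm ((1 / t) *\<^sub>R z)) * \<gamma> (t *\<^sub>R ((1 / t) *\<^sub>R z))) \<partial>lborel)"
          using t by (subst nn_integral_lborel_scale[of _ "1 / t"]) auto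
        also have "\<dots> = (\<integral>\<^sup>+z. ennreal ((1 / t) ^ ?d) * (indicator ?Q ((1 / t) *\<^sub>R z) * (ennreal (infnorm ((1 / t) *\<^sub>R z)) * \<gamma> (t *\<^sub>R ((1 / t) *\<^sub>R z)))) \<partial>lborel)"
          by (rule nn_integral_cmult[symmetric]) measurable
        also have "\<dots> = (\<integral>\<^sup>+z. \<gamma> z * (ennreal (infnorm z) * (indicator (corner_box m (t * h)) z * ennreal (1 / t ^ (?d + 1)))) \<partial>lborel)"
        proof (rule nn_integral_cong)
          fix z
          have 1: "indicator ?Q ((1 / t) *\<^sub>R z) = (indicator (corner_box m (t * h)) z :: ennreal)"
            using corner_box_scale[OF t(1), of z m h] by (simp add: indicator_def)
          have 2: "ennreal (infnorm ((1 / t) *\<^sub>R z)) * ennreal ((1 / t) ^ ?d) = ennreal (infnorm z) * ennreal (1 / t ^ (?d + 1))"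
            using t by (simp add: infnorm_mul ennreal_mult[symmetric] infnorm_pos_le power_divide)
          have "ennreal ((1 / t) ^ ?d) * (indicator ?Q ((1 / t) *\<^sub>R z) * (ennreal (infnorm ((1 / t) *\<^sub>R z)) * \<gamma> z))
            = (ennreal (infnorm ((1 / t) *\<^sub>R z)) * ennreal ((1 / t) ^ ?d)) * (indicator ?Q ((1 / t) *\<^sub>R z) * \<gamma> z)"
            by (simp only: mult_ac)
          also have "\<dots> = \<gamma> z * (ennreal (infnorm z) * (indicator (corner_box m (t * h)) z * ennreal (1 / t ^ (?d + 1))))"
            unfolding 1 2 by (simp only: mult_ac)
          finally show "ennreal ((1 / t) ^ ?d) * (indicator ?Q ((1 / t) *\<^sub>R z) * (ennreal (infnorm ((1 / t) *\<^sub>R z)) * \<gamma> (t *\<^sub>R ((1 / t) *\<^sub>R z)))) = \<dots>"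
            using t by simp
        qed
        finally show ?thesis using t by simp
      qed (use elim in auto)
    qed
  qed
  also have "\<dots> = (\<integral>\<^sup>+z. (\<integral>\<^sup>+t. \<gamma> z * (ennreal (infnorm z) * (indicator {0<..1} t * indicator (corner_box m (t * h)) z * ennreal (1 / t ^ (?d + 1)))) \<partial>lborel) \<partial>lborel)"
  proof (rule lborel_pair.Fubini')
    \<comment> \<open>The moving box enters as a set of pairs (z, t); it is closed, which gives the
      joint measurability for Tonelli's theorem.\<close>
    have "{(z :: real ^ 'n::{finite,linorder}, t). z \<in> corner_box m (t * h)} \<in> sets (borel \<Otimes>\<^sub>M borel)"
    proof -
      have "{(z :: real ^ 'n::{finite,linorder}, t). z \<in> corner_box m (t * h)}
        = {p. infnorm (fst p) \<le> snd p * h} \<inter> (\<Inter>i\<in>{i. card {..<i} < m}. {p. 0 \<le> fst p $ i})"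
        by (auto simp: mem_corner_box)
      also have "closed \<dots>"
        by (intro closed_Int closed_INT ballI closed_Collect_le continuous_intros)
      finally show ?thesis unfolding borel_prod by (rule borel_closed)
    qed
    note S = this
    have [measurable]: "(\<lambda>(z :: real ^ 'n::{finite,linorder}, t). indicator (corner_box m (t * h)) z :: ennreal) \<in> borel_measurable (borel \<Otimes>\<^sub>M borel)"
    proof -
      have "(\<lambda>(z :: real ^ 'n::{finite,linorder}, t). indicator (corner_box m (t * h)) z :: ennreal)
        = indicator {(z, t). z \<in> corner_box m (t * h)}"
        by (auto simp: indicator_def fun_eq_iff)
      then show ?thesis using S by (simp only: borel_measurable_indicator)
    qed
    show "(\<lambda>(z, t). \<gamma> z * (ennreal (infnorm z) * (indicator {0<..1} t * indicator (corner_box m (t * h)) z * ennreal (1 / t ^ (?d + 1)))))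
      \<in> borel_measurable (lborel \<Otimes>\<^sub>M lborel)"
      by measurable
  qed
  also have "\<dots> = (\<integral>\<^sup>+z. indicator ?Q z * (\<gamma> z * ennreal (kern ?d h (infnorm z))) \<partial>lborel)"
  proof (rule nn_integral_cong_AE)
    have "AE z in lborel. z \<noteq> (0 :: real ^ 'n::{finite,linorder})" by (rule AE_lborel_singleton)
    then show "AE z in lborel. (\<integral>\<^sup>+t. \<gamma> z * (ennreal (infnorm z) * (indicator {0<..1} t * indicator (corner_box m (t * h)) z * ennreal (1 / t ^ (?d + 1)))) \<partial>lborel)
       = indicator ?Q z * (\<gamma> z * ennreal (kern ?d h (infnorm z)))"
    proof eventually_elim
      case (elim z)
      have pos: "infnorm z > 0" using elim by (simp add: infnorm_pos_lt)
      have mem: "z \<in> corner_box m (t * h) \<longleftrightarrow> infnorm z / h \<le> t \<and> (\<forall>i. card {..<i} < m \<longrightarrow> 0 \<le> z $ i)" for t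
        using h by (simp add: mem_corner_box pos_divide_le_eq)
      show ?case
      proof (cases "z \<in> ?Q")
        case True
        then have "infnorm z \<le> h" "\<forall>i. card {..<i} < m \<longrightarrow> 0 \<le> z $ i" by (auto simp: mem_corner_box)
        then have eq: "indicator {0<..1} t * indicator (corner_box m (t * h)) z * ennreal (1 / t ^ (?d + 1))
            = ennreal (1 / t ^ (?d + 1)) * indicator {infnorm z / h..1} t" for t
          using pos h less_le_trans[of 0 "infnorm z / h" t] by (auto simp: indicator_def mem)
        have "(\<integral>\<^sup>+t. \<gamma> z * (ennreal (infnorm z) * (ennreal (1 / t ^ (?d + 1)) * indicator {infnorm z / h..1} t)) \<partial>lborel)
           = \<gamma> z * (ennreal (infnorm z) * (\<integral>\<^sup>+t. ennreal (1 / t ^ (?d + 1)) * indicator {infnorm z / h..1} t \<partial>lborel))"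
          by (subst nn_integral_cmult, measurable)+
        also have "(\<integral>\<^sup>+t. ennreal (1 / t ^ (?d + 1)) * indicator {infnorm z / h..1} t \<partial>lborel) = ennreal (((1 / (infnorm z / h)) ^ ?d - 1) / real ?d)"
          using pos h \<open>infnorm z \<le> h\<close> by (intro nn_integral_inverse_power) auto
        also have "ennreal (infnorm z) * \<dots> = ennreal (kern ?d h (infnorm z))"
          using pos h \<open>infnorm z \<le> h\<close> by (subst ennreal_mult[symmetric]) (auto simp: kern_def intro!: one_le_power divide_nonneg_pos)
        finally show ?thesis unfolding eq using True by simp
      next
        case False
        have z0: "indicator {0<..1} t * indicator (corner_box m (t * h)) z = (0 :: ennreal)" for t
        proof (cases "t \<in> {0<..1}")
          case True
          then have "t * h \<le> h" using h by (intro mult_left_le_one_le) auto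
          then have "z \<notin> corner_box m (t * h)" using False by (auto simp: mem_corner_box)
          then show ?thesis by simp
        qed simp
        show ?thesis unfolding z0 using False by simp
      qed
    qed
  qed
  finally show ?thesis .
qed

text \<open>Young's inequality for u / A^(1/p) and v / B^(1/q), integrated. This scaling fails if
  one of the bounds is 0, but then the product vanishes almost everywhere.\<close>

lemma Holder_nn_integral:
  assumes pq: "p > 1" "q > 1" "1 / p + 1 / q = 1"
    and u[measurable]: "u \<in> borel_measurable M" "\<And>x. 0 \<le> u x" and v[measurable]: "v \<in> borel_measurable M" "\<And>x. 0 \<le> v x"
    and A: "(\<integral>\<^sup>+x. ennreal (u x powr p) \<partial>M) \<le> ennreal A" "0 \<le> A"
    and B: "(\<integral>\<^sup>+x. ennreal (v x powr q) \<partial>M) \<le> ennreal B" "0 \<le> B"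
  shows "(\<integral>\<^sup>+x. ennreal (u x * v x) \<partial>M) \<le> ennreal (A powr (1 / p) * B powr (1 / q))"
proof (cases "A = 0 \<or> B = 0")
  case True
  then have "AE x in M. u x * v x = 0"
  proof
    assume "A = 0"
    then have "AE x in M. ennreal (u x powr p) = 0"
      using A by (subst nn_integral_0_iff_AE[symmetric]) auto
    then show ?thesis by eventually_elim (auto simp: ennreal_eq_0_iff)
  next
    assume "B = 0"
    then have "AE x in M. ennreal (v x powr q) = 0"
      using B by (subst nn_integral_0_iff_AE[symmetric]) auto
    then show ?thesis by eventually_elim (auto simp: ennreal_eq_0_iff)
  qed
  then have "(\<integral>\<^sup>+x. ennreal (u x * v x) \<partial>M) = 0"
    by (subst nn_integral_0_iff_AE) auto
  then show ?thesis by simp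
next
  case False
  then have AB: "A > 0" "B > 0" using A B by auto
  define \<alpha> \<beta> where "\<alpha> = A powr (1 / p)" and "\<beta> = B powr (1 / q)"
  have ab: "\<alpha> > 0" "\<beta> > 0" "\<alpha> powr p = A" "\<beta> powr q = B"
    using AB pq by (auto simp: \<alpha>_def \<beta>_def powr_powr)
  have "(\<integral>\<^sup>+x. ennreal (u x * v x) \<partial>M) \<le> (\<integral>\<^sup>+x. ennreal (\<alpha> * \<beta> / (p * A)) * ennreal (u x powr p) + ennreal (\<alpha> * \<beta> / (q * B)) * ennreal (v x powr q) \<partial>M)"
  proof (rule nn_integral_mono)
    fix x
    have "(u x / \<alpha>) * (v x / \<beta>) \<le> (u x / \<alpha>) powr p / p + (v x / \<beta>) powr q / q"
      using u v ab pq by (intro Youngs_inequality) auto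
    also have "\<dots> = u x powr p / (p * A) + v x powr q / (q * B)"
      using u(2)[of x] v(2)[of x] ab by (simp add: powr_divide mult.commute)
    finally have "u x * v x \<le> \<alpha> * \<beta> * (u x powr p / (p * A) + v x powr q / (q * B))"
      using ab by (simp add: field_simps)
    also have "\<dots> = \<alpha> * \<beta> / (p * A) * u x powr p + \<alpha> * \<beta> / (q * B) * v x powr q"
      by (simp add: algebra_simps)
    finally show "ennreal (u x * v x) \<le> ennreal (\<alpha> * \<beta> / (p * A)) * ennreal (u x powr p) + ennreal (\<alpha> * \<beta> / (q * B)) * ennreal (v x powr q)"
      using ab AB pq by (simp add: ennreal_mult[symmetric] ennreal_plus[symmetric] ennreal_leI del: ennreal_plus)
  qed
  also have "\<dots> = ennreal (\<alpha> * \<beta> / (p * A)) * (\<integral>\<^sup>+x. ennreal (u x powr p) \<partial>M) + ennreal (\<alpha> * \<beta> / (q * B)) * (\<integral>\<^sup>+x. ennreal (v x powr q) \<partial>M)"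
    by (simp add: nn_integral_add nn_integral_cmult)
  also have "\<dots> \<le> ennreal (\<alpha> * \<beta> / (p * A)) * ennreal A + ennreal (\<alpha> * \<beta> / (q * B)) * ennreal B"
    using A B by (intro add_mono mult_left_mono) auto
  also have "\<dots> = ennreal (\<alpha> * \<beta> / p + \<alpha> * \<beta> / q)"
    using ab AB pq by (simp add: ennreal_mult[symmetric] ennreal_plus[symmetric] del: ennreal_plus)
  also have "\<alpha> * \<beta> / p + \<alpha> * \<beta> / q = \<alpha> * \<beta> * (1 / p + 1 / q)"
    by (simp add: algebra_simps)
  finally show ?thesis using pq by (simp add: \<alpha>_def \<beta>_def)
qed

lemma nn_integral_Beta:
  assumes "a > 0" "b > (0::real)"
  shows "(\<integral>\<^sup>+s. ennreal (s powr (a - 1) * (1 - s) powr (b - 1)) * indicator {0..1} s \<partial>lborel) = ennreal (Beta a b)"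
  by (rule nn_integral_has_integral_lebesgue'[OF _ has_integral_Beta_real[OF assms]]) auto

text \<open>With s = (r/h)^d one has kern = (h/d) s^(1/d - 1) (1 - s) and d r^(d-1) dr = h^d ds, so
  the integral of kern^q becomes the Beta integral with parameters 1 - (d-1) q / d and q + 1. The
  first parameter is positive exactly when q (d-1) < d.\<close>

lemma nn_integral_kern_powr:
  assumes m: "m \<le> CARD('n::{finite,linorder})" and h: "h > 0" and q: "q \<ge> 1" "q * (real CARD('n) - 1) < real CARD('n)"
  shows "(\<integral>\<^sup>+z. indicator (corner_box m h) z * ennreal (kern CARD('n) h (infnorm z) powr q) \<partial>(lborel :: (real ^ 'n::{finite,linorder}) measure))
    = ennreal (2 ^ (CARD('n) - m) * h ^ CARD('n) * (h / real CARD('n)) powr q * Beta (1 - (real CARD('n) - 1) * q / real CARD('n)) (q + 1))"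
proof -
  define d where "d = CARD('n)"
  have d: "d > 0" by (simp add: d_def)
  define V where "V = (2 :: real) ^ (d - m)"
  have V: "V > 0" by (simp add: V_def)
  define a where "a = 1 - (real d - 1) * q / real d"
  have a: "a > 0" using q d by (simp add: a_def d_def[symmetric] mult.commute)
  define c where "c = V * h ^ d * (h / real d) powr q"
  have c: "c \<ge> 0" using V h by (simp add: c_def)
  define \<phi> where "\<phi> = (\<lambda>s. s powr (a - 1) * (1 - s) powr (q + 1 - 1))"
  have "(\<integral>\<^sup>+z. indicator (corner_box m h) z * ennreal (kern d h (infnorm z) powr q) \<partial>(lborel :: (real ^ 'n::{finite,linorder}) measure))
      = (\<integral>\<^sup>+r. ennreal (V * real d * r ^ (d - 1)) * indicator {0..h} r * ennreal (kern d h r powr q) \<partial>lborel)"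
    unfolding d_def V_def by (rule nn_integral_corner_box_radial[OF m]) (use h in auto)
  also have "\<dots> = (\<integral>\<^sup>+r. ennreal c * ennreal (\<phi> ((r / h) ^ d)) * ennreal (real d * r ^ (d - 1) / h ^ d) * indicator {0..h} r \<partial>lborel)"
  proof (rule nn_integral_cong_AE)
    have "AE r in lborel. r \<noteq> (0::real)" by (rule AE_lborel_singleton)
    then show "AE r in lborel. ennreal (V * real d * r ^ (d - 1)) * indicator {0..h} r * ennreal (kern d h r powr q)
       = ennreal c * ennreal (\<phi> ((r / h) ^ d)) * ennreal (real d * r ^ (d - 1) / h ^ d) * indicator {0..h} r"
    proof eventually_elim
      case (elim r)
      show ?case
      proof (cases "r \<in> {0..h}")
        case True
        then have r: "0 < r" "r \<le> h" using elim by auto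
        define s where "s = (r / h) ^ d"
        have s: "0 < s" "s \<le> 1" using r h by (auto simp: s_def power_le_one)
        have sr: "s powr (1 / real d) = r / h"
          using r h d by (simp add: s_def powr_realpow[symmetric] powr_powr)
        have "kern d h r = (h / real d) * (s powr (1 / real d - 1) * (1 - s))"
        proof -
          have "s powr (1 / real d - 1) = (r / h) / s"
            using s by (simp add: powr_diff sr)
          moreover have "(h / r) ^ d = 1 / s" by (simp add: s_def power_divide)
          ultimately show ?thesis
            using r h s d unfolding kern_def by (simp add: field_simps)
        qed
        note k0 = this
        have "kern d h r powr q = (h / real d) powr q * ((s powr (1 / real d - 1)) powr q * (1 - s) powr q)"
        proof -
          have pm: "(x * y) powr q = x powr q * y powr q" if "0 \<le> x" "0 \<le> y" for x y :: real
            using that by (simp add: powr_mult)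
          have "(h / real d * (s powr (1 / real d - 1) * (1 - s))) powr q = (h / real d) powr q * (s powr (1 / real d - 1) * (1 - s)) powr q"
            by (rule pm) (use h s in auto)
          also have "(s powr (1 / real d - 1) * (1 - s)) powr q = (s powr (1 / real d - 1)) powr q * (1 - s) powr q"
            by (rule pm) (use s in auto)
          finally show ?thesis by (simp only: k0)
        qed
        also have "(s powr (1 / real d - 1)) powr q = s powr (a - 1)"
          using d by (simp add: powr_powr a_def field_simps)
        finally have k: "kern d h r powr q = (h / real d) powr q * \<phi> s" by (simp add: \<phi>_def)
        have "V * real d * r ^ (d - 1) * kern d h r powr q = c * \<phi> s * (real d * r ^ (d - 1) / h ^ d)"
          using h by (simp add: k c_def)
        then show ?thesis
          using True r h V c by (simp add: s_def ennreal_mult[symmetric] \<phi>_def)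
      qed simp
    qed
  qed
  also have "\<dots> = (\<integral>\<^sup>+s. ennreal c * ennreal (\<phi> s) * indicator {(0 / h) ^ d..(h / h) ^ d} s \<partial>lborel)"
  proof (rule nn_integral_substitution_aux[symmetric])
    show "((\<lambda>r. (r / h) ^ d) has_real_derivative real d * r ^ (d - 1) / h ^ d) (at r)" for r
    proof -
      have "h ^ d = h * h ^ (d - 1)" using d by (simp add: power_eq_if)
      then show ?thesis
        using h by (auto intro!: derivative_eq_intros simp: power_divide)
    qed
    show "continuous_on {0..h} (\<lambda>r. real d * r ^ (d - 1) / h ^ d)"
      using h by (intro continuous_intros) auto
  qed (use h in \<open>auto simp: \<phi>_def\<close>)
  also have "\<dots> = ennreal c * (\<integral>\<^sup>+s. ennreal (\<phi> s) * indicator {0..1} s \<partial>lborel)"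
    using h d by (subst nn_integral_cmult[symmetric]) (auto simp: \<phi>_def power_0_left mult.assoc)
  also have "\<dots> = ennreal c * ennreal (Beta a (q + 1))"
    unfolding \<phi>_def using a q by (subst nn_integral_Beta) auto
  also have "\<dots> = ennreal (c * Beta a (q + 1))"
    using a q by (subst ennreal_mult[symmetric]) (auto simp: Beta_def intro!: c divide_nonneg_nonneg mult_nonneg_nonneg Gamma_real_nonneg)
  finally show ?thesis by (simp add: c_def V_def d_def a_def)
qed

section \<open>The additive inequality\<close>

lemma infnorm_attained: "\<exists>k. infnorm (z :: real ^ 'n) = \<bar>z $ k\<bar>"
proof -
  have "infnorm z \<in> range (\<lambda>i. \<bar>z $ i\<bar>)"
    unfolding infnorm_cart setcompr_eq_image by (subst cSup_eq_Max) (auto intro: Max_in)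
  then show ?thesis by auto
qed

lemma infnorm_less_iff: "infnorm (x :: real ^ 'n) < r \<longleftrightarrow> (\<forall>i. \<bar>x $ i\<bar> < r)"
  using infnorm_attained[of x] component_le_infnorm_cart[of x] by (auto intro: le_less_trans)

text \<open>The cube is open, so the infimum runs over the open ray of all l exceeding the maximum
  norm.\<close>

lemma cube_norm_eq_infnorm: "cube_norm x = infnorm x"
proof -
  have "0 < l \<and> x \<in> (\<lambda>y. l *\<^sub>R y) ` cube \<longleftrightarrow> infnorm x < l" for l
  proof
    assume "0 < l \<and> x \<in> (\<lambda>y. l *\<^sub>R y) ` cube"
    then obtain y where y: "0 < l" "x = l *\<^sub>R y" "\<And>i. \<bar>y $ i\<bar> < 1"
      by (auto simp: cube_def abs_less_iff minus_less_iff)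
    have "l * \<bar>y $ i\<bar> < l" for i
      using mult_strict_left_mono[OF y(3)[of i] y(1)] by simp
    then show "infnorm x < l"
      using y by (simp add: infnorm_less_iff abs_mult)
  next
    assume l: "infnorm x < l"
    then have "0 < l" using infnorm_pos_le[of x] by linarith
    moreover have "(1 / l) *\<^sub>R x \<in> cube"
      using l \<open>0 < l\<close> by (auto simp: cube_def infnorm_less_iff abs_less_iff divide_simps) (metis minus_less_iff)
    ultimately show "0 < l \<and> x \<in> (\<lambda>y. l *\<^sub>R y) ` cube"
      by (auto intro!: image_eqI[of _ _ "(1 / l) *\<^sub>R x"])
  qed
  then have "{l. 0 < l \<and> x \<in> (\<lambda>y. l *\<^sub>R y) ` cube} = {infnorm x<..}" by auto
  then show ?thesis by (simp add: cube_norm_def)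
qed

text \<open>The vector of signs of \<open>z\<close> has norm at most 1 and attains the sum of the
  moduli.\<close>

lemma cube_dual_norm_eq_sum: "cube_dual_norm z = (\<Sum>i\<in>UNIV. \<bar>z $ i\<bar>)"
  unfolding cube_dual_norm_def
proof (rule cSup_eq_maximum)
  have "(\<chi> i. sgn (z $ i)) \<bullet> z = (\<Sum>i\<in>UNIV. \<bar>z $ i\<bar>)"
    by (auto simp: inner_vec_def abs_sgn mult.commute intro!: sum.cong)
  then show "(\<Sum>i\<in>UNIV. \<bar>z $ i\<bar>) \<in> (\<lambda>x. x \<bullet> z) ` {x. cube_norm x \<le> 1}"
    by (auto simp: cube_norm_eq_infnorm infnorm_le_iff abs_sgn_eq intro!: image_eqI[of _ _ "\<chi> i. sgn (z $ i)"])
next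
  fix y assume "y \<in> (\<lambda>x. x \<bullet> z) ` {x. cube_norm x \<le> 1}"
  then obtain x where x: "y = x \<bullet> z" "\<And>i. \<bar>x $ i\<bar> \<le> 1"
    by (auto simp: cube_norm_eq_infnorm infnorm_le_iff)
  have "x $ i * z $ i \<le> \<bar>z $ i\<bar>" for i
    using mult_right_mono[OF x(2)[of i], of "\<bar>z $ i\<bar>"] abs_ge_self[of "x $ i * z $ i"] by (simp add: abs_mult)
  then show "y \<le> (\<Sum>i\<in>UNIV. \<bar>z $ i\<bar>)"
    unfolding x(1) inner_vec_def by (auto intro: sum_mono)
qed

section \<open>Essential suprema and bounds for norms\<close>

lemma AE_lebesgue_on_iff:
  "C \<in> sets lebesgue \<Longrightarrow> (AE x in lebesgue_on C. P x) \<longleftrightarrow> (AE x in lebesgue. x \<in> C \<longrightarrow> P x)"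
  by (subst AE_restrict_space_iff) auto

lemma borel_measurable_lebesgue_on_indicator:
  fixes u :: "'a::euclidean_space \<Rightarrow> real"
  assumes "C \<in> sets lebesgue"
  shows "u \<in> borel_measurable (lebesgue_on C) \<longleftrightarrow> (\<lambda>x. indicator C x * u x) \<in> borel_measurable lebesgue"
  using assms borel_measurable_restrict_space_iff[of C lebesgue u] by simp

text \<open>\<open>Lp_norm\<close> passes through \<open>real_of_ereal\<close>. The essential
  supremum of a modulus is negative only on a null space, where it is minus infinity and is sent to
  0, so both claims survive this case.\<close>

lemma Linf_AE:
  assumes "in_Lp \<infinity> C u" "C \<in> sets lebesgue"
  shows "AE x in lebesgue. x \<in> C \<longrightarrow> \<bar>u x\<bar> \<le> Lp_norm \<infinity> C u" "0 \<le> Lp_norm \<infinity> C u"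
proof -
  let ?E = "esssup (lebesgue_on C) (\<lambda>x. ereal \<bar>u x\<bar>)"
  have fin: "?E < \<infinity>" and N: "Lp_norm \<infinity> C u = real_of_ereal ?E" and [measurable]: "u \<in> borel_measurable (lebesgue_on C)"
    using assms by (auto simp: in_Lp_def Lp_norm_def)
  have le: "AE x in lebesgue_on C. ereal \<bar>u x\<bar> \<le> ?E" by (rule esssup_AE)
  have "(AE x in lebesgue_on C. \<bar>u x\<bar> \<le> real_of_ereal ?E) \<and> 0 \<le> real_of_ereal ?E"
  proof (cases "?E < 0")
    case True
    have ae: "AE x in lebesgue_on C. False"
      using le
    proof (rule eventually_mono)
      show False if "ereal \<bar>u x\<bar> \<le> ?E" for x
        using le_less_trans[OF that True] by simp
    qed
    then have "emeasure (lebesgue_on C) (space (lebesgue_on C)) = 0"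
      by (metis ae_filter_eq_bot_iff eventually_False)
    then have "?E = -\<infinity>" by (intro esssup_zero_space) auto
    then have "real_of_ereal ?E = 0" by simp
    then show ?thesis using ae by (auto elim!: eventually_mono)
  next
    case False
    then obtain r where r: "?E = ereal r" using fin by (cases ?E) auto
    with le False show ?thesis by (auto elim!: eventually_mono)
  qed
  then show "AE x in lebesgue. x \<in> C \<longrightarrow> \<bar>u x\<bar> \<le> Lp_norm \<infinity> C u" "0 \<le> Lp_norm \<infinity> C u"
    unfolding N AE_lebesgue_on_iff[OF assms(2)] by auto
qed

lemma Linf_le:
  assumes C: "C \<in> sets lebesgue" and u: "u \<in> borel_measurable (lebesgue_on C)"
    and M: "AE x in lebesgue. x \<in> C \<longrightarrow> \<bar>u x\<bar> \<le> M" "0 \<le> M"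
  shows "in_Lp \<infinity> C u" "Lp_norm \<infinity> C u \<le> M"
proof -
  let ?E = "esssup (lebesgue_on C) (\<lambda>x. ereal \<bar>u x\<bar>)"
  have "?E \<le> ereal M"
    using u M by (intro esssup_I) (auto simp: AE_lebesgue_on_iff[OF C])
  then show "in_Lp \<infinity> C u" "Lp_norm \<infinity> C u \<le> M"
    using u M by (auto simp: in_Lp_def Lp_norm_def) (cases ?E; auto)
qed

lemma nn_integral_lebesgue_on_borel:
  fixes u' :: "'a::euclidean_space \<Rightarrow> ennreal"
  assumes C: "C \<in> sets lebesgue" and [measurable]: "u' \<in> borel_measurable borel" and 0: "\<forall>x. x \<notin> C \<longrightarrow> u' x = 0"
    and ae: "AE x in lebesgue. x \<in> C \<longrightarrow> u x = u' x"
  shows "(\<integral>\<^sup>+x. u x \<partial>lebesgue_on C) = (\<integral>\<^sup>+x. u' x \<partial>lborel)"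
proof -
  have "(\<integral>\<^sup>+x. u x \<partial>lebesgue_on C) = (\<integral>\<^sup>+x. u x * indicator C x \<partial>lebesgue)"
    using C by (subst nn_integral_restrict_space) auto
  also have "\<dots> = (\<integral>\<^sup>+x. u' x \<partial>lebesgue)"
  proof (rule nn_integral_cong_AE)
    show "AE x in lebesgue. u x * indicator C x = u' x"
      using ae by eventually_elim (use 0 in \<open>auto simp: indicator_def\<close>)
  qed
  also have "\<dots> = (\<integral>\<^sup>+x. u' x \<partial>lborel)"
    by (simp add: nn_integral_completion)
  finally show ?thesis .
qed

text \<open>An upper bound for the norm of a function on the whole space. Phrased with
  \<open>lborel\<close> and nonnegative integrals, it feeds Hoelder's inequality for finite and
  infinite p alike.\<close>

definition Lnorm_bound :: "ereal \<Rightarrow> (real ^ 'n \<Rightarrow> real) \<Rightarrow> real \<Rightarrow> bool" where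
  "Lnorm_bound p u N \<longleftrightarrow> (if p = \<infinity> then AE x in lborel. \<bar>u x\<bar> \<le> N
     else (\<integral>\<^sup>+x. ennreal (\<bar>u x\<bar> powr real_of_ereal p) \<partial>lborel) \<le> ennreal (N powr real_of_ereal p))"

lemma Lnorm_bound_Lp_norm:
  assumes C: "C \<in> sets borel" and p: "1 < p" and L: "in_Lp p C u"
    and u': "u' \<in> borel_measurable borel" "\<forall>x. x \<notin> C \<longrightarrow> u' x = 0" "AE x in lebesgue. x \<in> C \<longrightarrow> u x = u' x"
  shows "Lnorm_bound p u' (Lp_norm p C u)" "0 \<le> Lp_norm p C u"
proof -
  have Cl: "C \<in> sets lebesgue" using C by auto
  show "0 \<le> Lp_norm p C u"
    using Linf_AE(2)[OF _ Cl] L by (cases "p = \<infinity>") (auto simp: Lp_norm_def)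
  show "Lnorm_bound p u' (Lp_norm p C u)"
  proof (cases "p = \<infinity>")
    case True
    have "AE x in lebesgue. \<bar>u' x\<bar> \<le> Lp_norm \<infinity> C u"
      using Linf_AE(1)[OF L[unfolded True] Cl] u'(3)
    proof eventually_elim
      case (elim x)
      then show ?case using u'(2) Linf_AE(2)[OF L[unfolded True] Cl] by (cases "x \<in> C") auto
    qed
    then have "AE x in lborel. \<bar>u' x\<bar> \<le> Lp_norm \<infinity> C u"
      using u'(1) by (subst (asm) AE_completion_iff) auto
    then show ?thesis using True by (simp add: Lnorm_bound_def)
  next
    case False
    then obtain r where r: "p = ereal r" "r > 1" using p by (cases p) (auto simp: one_ereal_def)
    have int: "integrable (lebesgue_on C) (\<lambda>x. \<bar>u x\<bar> powr r)" using L by (simp add: in_Lp_def r)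
    have "(\<integral>\<^sup>+x. ennreal (\<bar>u' x\<bar> powr r) \<partial>lborel) = (\<integral>\<^sup>+x. ennreal (\<bar>u x\<bar> powr r) \<partial>lebesgue_on C)"
    proof (rule nn_integral_lebesgue_on_borel[OF Cl, symmetric])
      show "AE x in lebesgue. x \<in> C \<longrightarrow> ennreal (\<bar>u x\<bar> powr r) = ennreal (\<bar>u' x\<bar> powr r)"
        using u'(3) by eventually_elim auto
    qed (use u' in \<open>auto simp: measurable_abs_powr\<close>)
    also have "\<dots> = ennreal (LINT x|lebesgue_on C. \<bar>u x\<bar> powr r)"
      by (rule nn_integral_eq_integral[OF int]) auto
    also have "(LINT x|lebesgue_on C. \<bar>u x\<bar> powr r) = Lp_norm p C u powr r"
      using r by (simp add: Lp_norm_def powr_powr integral_nonneg_AE)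
    finally show ?thesis using r by (simp add: Lnorm_bound_def)
  qed
qed

text \<open>Each term is at most the largest one, whose power occurs on the right. The crude
  constant suffices, as only membership in L_p is at stake.\<close>

lemma powr_sum_le:
  fixes a :: "'i \<Rightarrow> real"
  assumes "finite I" "I \<noteq> {}" "\<And>i. i \<in> I \<Longrightarrow> 0 \<le> a i" "r > 0"
  shows "(\<Sum>i\<in>I. a i) powr r \<le> real (card I) powr r * (\<Sum>i\<in>I. a i powr r)"
proof -
  define M where "M = Max (a ` I)"
  have "M \<in> a ` I" unfolding M_def using assms by (intro Max_in) auto
  then obtain j where j: "j \<in> I" "M = a j" by auto
  have le: "a i \<le> M" if "i \<in> I" for i unfolding M_def using assms that by auto
  have "(\<Sum>i\<in>I. a i) \<le> real (card I) * M"
    using sum_bounded_above[of I a M] le by simp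
  then have "(\<Sum>i\<in>I. a i) powr r \<le> (real (card I) * M) powr r"
    using assms by (intro powr_mono2) (auto intro: sum_nonneg)
  also have "\<dots> = real (card I) powr r * a j powr r"
    using assms j by (simp add: powr_mult)
  also have "\<dots> \<le> real (card I) powr r * (\<Sum>i\<in>I. a i powr r)"
    using assms j by (intro mult_left_mono member_le_sum) auto
  finally show ?thesis .
qed

lemma in_Lp_sum_abs:
  fixes G :: "real ^ 'n \<Rightarrow> real ^ 'n"
  assumes C: "C \<in> sets lebesgue" and p: "1 < p" and G: "\<And>i. in_Lp p C (\<lambda>x. G x $ i)"
  shows "in_Lp p C (\<lambda>x. \<Sum>i\<in>UNIV. \<bar>G x $ i\<bar>)"
proof -
  have m[measurable]: "(\<lambda>x. G x $ i) \<in> borel_measurable (lebesgue_on C)" for i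
    using G[of i] by (simp add: in_Lp_def)
  have ms: "(\<lambda>x. \<Sum>i\<in>UNIV. \<bar>G x $ i\<bar>) \<in> borel_measurable (lebesgue_on C)" by measurable
  show ?thesis
  proof (cases "p = \<infinity>")
    case True
    have "AE x in lebesgue. \<forall>i\<in>UNIV. x \<in> C \<longrightarrow> \<bar>G x $ i\<bar> \<le> Lp_norm \<infinity> C (\<lambda>x. G x $ i)"
      using Linf_AE(1)[OF G[unfolded True] C] by (intro AE_finite_allI) auto
    then have "AE x in lebesgue. x \<in> C \<longrightarrow> \<bar>\<Sum>i\<in>UNIV. \<bar>G x $ i\<bar>\<bar> \<le> (\<Sum>i\<in>UNIV. Lp_norm \<infinity> C (\<lambda>x. G x $ i))"
      by eventually_elim (auto intro!: sum_mono simp: sum_nonneg)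
    then show ?thesis
      using True Linf_le(1)[OF C ms] Linf_AE(2)[OF G[unfolded True] C] by (auto intro: sum_nonneg)
  next
    case False
    then obtain r where r: "p = ereal r" "r > 1" using p by (cases p) (auto simp: one_ereal_def)
    have int: "integrable (lebesgue_on C) (\<lambda>x. \<bar>G x $ i\<bar> powr r)" for i using G[of i] by (simp add: in_Lp_def r)
    have "integrable (lebesgue_on C) (\<lambda>x. \<bar>\<Sum>i\<in>UNIV. \<bar>G x $ i\<bar>\<bar> powr r)"
    proof (rule Bochner_Integration.integrable_bound)
      show "integrable (lebesgue_on C) (\<lambda>x. real CARD('n) powr r * (\<Sum>i\<in>UNIV. \<bar>G x $ i\<bar> powr r))"
        by (intro integrable_mult_right Bochner_Integration.integrable_sum int)
      show "AE x in lebesgue_on C. norm (\<bar>\<Sum>i\<in>UNIV. \<bar>G x $ i\<bar>\<bar> powr r) \<le> norm (real CARD('n) powr r * (\<Sum>i\<in>UNIV. \<bar>G x $ i\<bar> powr r))"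
        using powr_sum_le[of UNIV "\<lambda>i. \<bar>G _ $ i\<bar>" r] r by (intro AE_I2) (simp add: sum_nonneg)
    qed measurable
    then show ?thesis using r ms by (simp add: in_Lp_def)
  qed
qed

section \<open>The conjugate exponent and Hoelder's estimate\<close>

lemma conj_exp_props:
  assumes "ereal (real d) < p" "d > 0"
  shows "conj_exp p \<ge> 1" "conj_exp p * (real d - 1) < real d" "1 - (real d - 1) * conj_exp p / real d > 0"
    "1 < p" "1 / conj_exp p = 1 - recip p"
proof -
  have d1: "real d \<ge> 1" using assms(2) by simp
  then have "ereal 1 \<le> ereal (real d)" by simp
  then show "1 < p" using assms(1) by (metis le_less_trans one_ereal_def)
  have "conj_exp p \<ge> 1 \<and> conj_exp p * (real d - 1) < real d \<and> 1 / conj_exp p = 1 - recip p"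
  proof (cases "p = \<infinity>")
    case True
    then show ?thesis by (simp add: conj_exp_def recip_def)
  next
    case False
    then obtain r where r: "p = ereal r" "r > real d" using assms by (cases p) auto
    then have "r > 1" using d1 by simp
    \<comment> \<open>This is r > d after expansion; it makes the kernel integrable to the power
      p'.\<close>
    have "r * (real d - 1) < real d * (r - 1)" using r by (simp add: algebra_simps)
    then show ?thesis
      using r \<open>r > 1\<close> by (auto simp: conj_exp_def recip_def field_simps)
  qed
  then show "conj_exp p \<ge> 1" and *: "conj_exp p * (real d - 1) < real d" and "1 / conj_exp p = 1 - recip p" by auto
  show "1 - (real d - 1) * conj_exp p / real d > 0"
    using * assms(2) by (simp add: mult.commute)
qed

lemma Beta_real_pos: "a > 0 \<Longrightarrow> b > 0 \<Longrightarrow> 0 < Beta a (b :: real)"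
  by (simp add: Beta_def Gamma_real_pos)

text \<open>Origin of A(d,p): Hoelder's inequality takes the root 1/p' of the Beta value, while
  (h/d)^p' becomes h/d, whose factor 1/d goes into A(d,p).\<close>

lemma Beta_powr_eq_const_A:
  assumes p: "ereal (real d) < p" and d: "d > 0" and h: "h > 0" and W: "0 \<le> W"
  shows "(W * (h / real d) powr conj_exp p * Beta (1 - (real d - 1) * conj_exp p / real d) (conj_exp p + 1)) powr (1 / conj_exp p)
    = W powr (1 / conj_exp p) * (h * const_A d p)"
proof -
  note q = conj_exp_props[OF p d]
  have "0 < Beta (1 - (real d - 1) * conj_exp p / real d) (conj_exp p + 1)"
    using q by (intro Beta_real_pos) auto
  then show ?thesis
    using h W q(1) by (simp add: const_A_def powr_mult powr_powr powr_divide)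
qed

text \<open>Hoelder's inequality for the translated gradient and the kernel, whose q-th power
  integral is known. For p = \<infinity> the exponent q is 1 and the gradient is simply bounded by
  \<open>N\<close>.\<close>

lemma kernel_Holder:
  fixes \<gamma> :: "real ^ 'n::{finite,linorder} \<Rightarrow> real"
  assumes m: "m \<le> CARD('n)" and p: "ereal (real CARD('n)) < p" and h: "h > 0"
    and [measurable]: "\<gamma> \<in> borel_measurable borel" and \<gamma>0: "\<And>x. 0 \<le> \<gamma> x" and N: "0 \<le> N" "Lnorm_bound p \<gamma> N"
  shows "(\<integral>\<^sup>+z. indicator (corner_box m h) z * (ennreal (\<gamma> (x + z)) * ennreal (kern CARD('n) h (infnorm z))) \<partial>lborel)
    \<le> ennreal (N * (2 ^ (CARD('n) - m) * h ^ CARD('n)) powr (1 / conj_exp p) * (h * const_A CARD('n) p))"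
proof -
  let ?d = "CARD('n)" and ?Q = "corner_box m h :: (real ^ 'n::{finite,linorder}) set"
  define q where "q = conj_exp p"
  note q = conj_exp_props[OF p, simplified, folded q_def]
  define J where "J = 2 ^ (?d - m) * h ^ ?d * (h / real ?d) powr q * Beta (1 - (real ?d - 1) * q / real ?d) (q + 1)"
  have B: "0 < Beta (1 - (real ?d - 1) * q / real ?d) (q + 1)"
    using q by (intro Beta_real_pos) auto
  have J0: "J \<ge> 0" unfolding J_def using h B by simp
  have Jq: "J powr (1 / q) = (2 ^ (?d - m) * h ^ ?d) powr (1 / q) * (h * const_A ?d p)"
    unfolding J_def q_def by (rule Beta_powr_eq_const_A[OF p _ h]) (use h in auto)
  have K: "(\<integral>\<^sup>+z. indicator ?Q z * ennreal (kern ?d h (infnorm z) powr q) \<partial>lborel) = ennreal J"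
    unfolding J_def using q by (intro nn_integral_kern_powr m h) auto
  define v where "v = (\<lambda>z :: real ^ 'n::{finite,linorder}. indicator ?Q z * kern ?d h (infnorm z))"
  have v[measurable]: "v \<in> borel_measurable borel" unfolding v_def by measurable
  have v0: "0 \<le> v z" for z
    unfolding v_def by (auto simp: indicator_def mem_corner_box intro!: kern_nonneg infnorm_pos_le)
  have eq: "indicator ?Q z * (ennreal (\<gamma> (x + z)) * ennreal (kern ?d h (infnorm z))) = ennreal (\<gamma> (x + z) * v z)" for z
    using \<gamma>0 by (auto simp: v_def indicator_def ennreal_mult' )
  have Kv: "(\<integral>\<^sup>+z. ennreal (v z powr q) \<partial>lborel) = ennreal J"
    unfolding K[symmetric] using q by (intro nn_integral_cong) (auto simp: v_def indicator_def)
  have "(\<integral>\<^sup>+z. ennreal (\<gamma> (x + z) * v z) \<partial>lborel) \<le> ennreal (N * J powr (1 / q))"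
  proof (cases "p = \<infinity>")
    case True
    then have q1: "q = 1" by (simp add: q_def conj_exp_def)
    have "AE z in lborel. \<gamma> z \<le> N" using N True \<gamma>0 by (simp add: Lnorm_bound_def)
    \<comment> \<open>Translation invariance carries the bound over to the gradient seen from
      \<open>x\<close>.\<close>
    then have "AE z in distr lborel borel ((+) x). \<gamma> z \<le> N" by (subst lborel_distr_plus)
    then have ae: "AE z in lborel. \<gamma> (x + z) \<le> N" by (subst (asm) AE_distr_iff) auto
    have "(\<integral>\<^sup>+z. ennreal (\<gamma> (x + z) * v z) \<partial>lborel) \<le> (\<integral>\<^sup>+z. ennreal N * ennreal (v z powr q) \<partial>lborel)"
    proof (rule nn_integral_mono_AE)
      show "AE z in lborel. ennreal (\<gamma> (x + z) * v z) \<le> ennreal N * ennreal (v z powr q)"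
        using ae by eventually_elim
          (use N v0 in \<open>auto simp: ennreal_mult[symmetric] q1 intro!: ennreal_leI mult_right_mono\<close>)
    qed
    also have "\<dots> = ennreal N * (\<integral>\<^sup>+z. ennreal (v z powr q) \<partial>lborel)"
      by (rule nn_integral_cmult) measurable
    also have "\<dots> = ennreal (N * J powr (1 / q))"
      unfolding Kv using N J0 by (simp add: ennreal_mult q1)
    finally show ?thesis .
  next
    case False
    then obtain r where r: "p = ereal r" "r > real ?d" using p by (cases p) auto
    moreover have "real ?d \<ge> 1" by (simp add: Suc_le_eq)
    ultimately have r1: "r > 1" by linarith
    have qr: "q > 1" "1 / r + 1 / q = 1"
      using r r1 by (auto simp: q_def conj_exp_def field_simps)
    have "(\<integral>\<^sup>+z. ennreal (\<gamma> (x + z) * v z) \<partial>lborel) \<le> ennreal ((N powr r) powr (1 / r) * J powr (1 / q))"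
    proof (rule Holder_nn_integral[OF r1 qr])
      have "(\<integral>\<^sup>+z. ennreal (\<gamma> (z + x) powr r) \<partial>lborel) = (\<integral>\<^sup>+z. ennreal (\<gamma> z powr r) \<partial>lborel)"
        by (rule nn_integral_lborel_translate) measurable
      also have "\<dots> \<le> ennreal (N powr r)" using N \<gamma>0 r by (simp add: Lnorm_bound_def)
      finally show "(\<integral>\<^sup>+z. ennreal (\<gamma> (x + z) powr r) \<partial>lborel) \<le> ennreal (N powr r)" by (simp add: add.commute)
    qed (use \<gamma>0 v0 J0 Kv in auto)
    then show ?thesis using N r1 by (simp add: powr_powr)
  qed
  then show ?thesis unfolding eq Jq q_def[symmetric] by (simp add: mult.assoc)
qed

section \<open>Uniqueness of weak derivatives and the averaging bound\<close>

lemma Lp_norm_cong_AE: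
  assumes C: "C \<in> sets lebesgue" and u: "u \<in> borel_measurable (lebesgue_on C)" and v: "v \<in> borel_measurable (lebesgue_on C)"
    and ae: "AE x in lebesgue. x \<in> C \<longrightarrow> u x = v x"
  shows "Lp_norm p C u = Lp_norm p C v"
proof -
  have ae': "AE x in lebesgue_on C. u x = v x" using ae by (simp add: AE_lebesgue_on_iff[OF C])
  have "esssup (lebesgue_on C) (\<lambda>x. ereal \<bar>u x\<bar>) = esssup (lebesgue_on C) (\<lambda>x. ereal \<bar>v x\<bar>)"
    using u v ae' by (intro esssup_AE_cong) auto
  moreover have "(LINT x|lebesgue_on C. \<bar>u x\<bar> powr r) = (LINT x|lebesgue_on C. \<bar>v x\<bar> powr r)" for r
    using u v ae' by (intro integral_cong_AE) auto
  ultimately show ?thesis by (simp add: Lp_norm_def)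
qed

lemma locally_integrable_borel_representative:
  fixes g :: "real ^ 'n::{finite,linorder} \<Rightarrow> real"
  assumes "locally_integrable (orthant m) g"
  obtains g' where "g' \<in> borel_measurable borel" "\<forall>x. x \<notin> orthant m \<longrightarrow> g' x = 0"
    "AE x in lebesgue. x \<in> orthant m \<longrightarrow> g x = g' x"
  by (rule borel_representative[OF measurable_orthant locally_integrable_measurable[OF open_orthant assms]])

text \<open>The difference of two candidates has vanishing integral against every bump, so the
  criterion for |u| <= M applies with M = 0. It links the gradient hidden in \<open>in_W1\<close>,
  whose components lie in L_p, to the gradient named in \<open>admissible\<close>.\<close>

lemma weak_partial_unique:
  fixes g u v :: "real ^ 'n::{finite,linorder} \<Rightarrow> real"
  assumes u: "has_weak_partials (orthant m) is g u" and v: "has_weak_partials (orthant m) is g v"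
  shows "AE x in lebesgue. x \<in> orthant m \<longrightarrow> u x = v x"
proof -
  let ?C = "orthant m :: (real ^ 'n::{finite,linorder}) set"
  have C: "?C \<in> sets borel" by measurable
  have li: "locally_integrable ?C g" "locally_integrable ?C u" "locally_integrable ?C v"
    using u v by (auto simp: has_weak_partials_def)
  obtain g' where g': "g' \<in> borel_measurable borel" "\<forall>x. x \<notin> ?C \<longrightarrow> g' x = 0" "AE x in lebesgue. x \<in> ?C \<longrightarrow> g x = g' x"
    using locally_integrable_borel_representative[OF li(1)] by blast
  obtain u' where u': "u' \<in> borel_measurable borel" "\<forall>x. x \<notin> ?C \<longrightarrow> u' x = 0" "AE x in lebesgue. x \<in> ?C \<longrightarrow> u x = u' x"
    using locally_integrable_borel_representative[OF li(2)] by blast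
  obtain v' where v': "v' \<in> borel_measurable borel" "\<forall>x. x \<notin> ?C \<longrightarrow> v' x = 0" "AE x in lebesgue. x \<in> ?C \<longrightarrow> v x = v' x"
    using locally_integrable_borel_representative[OF li(3)] by blast
  note iu = integrable_borel_representative[OF li(2) C u'(1) u'(2) u'(3)]
    and iv = integrable_borel_representative[OF li(3) C v'(1) v'(2) v'(3)]
  have "AE x in lebesgue. x \<in> ?C \<longrightarrow> \<bar>u' x - v' x\<bar> \<le> 0"
  proof (rule AE_abs_le_if_bump_integrals_le)
    show "(\<lambda>x. u' x - v' x) \<in> borel_measurable borel" using u'(1) v'(1) by measurable
    show "integrable lborel (\<lambda>x. (u' x - v' x) * indicator (cbox a b) x)" if "cbox a b \<subseteq> ?C" for a b
      using iu[OF that] iv[OF that] by (simp add: left_diff_distrib)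
    fix a b :: "real ^ 'n::{finite,linorder}" and c :: real
    assume a: "a \<in> ?C" and ab: "\<And>i. a $ i \<le> b $ i" and c: "c > 0"
    have t: "test_function ?C (box_bump a b c)"
      by (intro test_function_box_bump c ab cbox_subset_orthant a)
    have bb: "\<bar>box_bump a b c x\<bar> \<le> 1" for x using box_bump_bounds[OF c ab, of x] by auto
    note sub = cbox_subset_orthant[OF a, of "bump_corner b c"]
    have "integrable lborel (\<lambda>x. u' x * box_bump a b c x)"
      by (rule integrable_mult_bounded_support[OF iu[OF sub] u'(1) box_bump_measurable bb]) (rule box_bump_eq_0[OF c ab])
    moreover have "integrable lborel (\<lambda>x. v' x * box_bump a b c x)"
      by (rule integrable_mult_bounded_support[OF iv[OF sub] v'(1) box_bump_measurable bb]) (rule box_bump_eq_0[OF c ab])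
    moreover have "(LINT x|lborel. u' x * box_bump a b c x) = (LINT x|lborel. v' x * box_bump a b c x)"
      using has_weak_partials_borelD[OF u C g' u' t] has_weak_partials_borelD[OF v C g' v' t] by simp
    ultimately show "\<bar>LINT x|lborel. (u' x - v' x) * box_bump a b c x\<bar> \<le> 0 * (LINT x|lborel. box_bump a b c x)"
      by (simp add: left_diff_distrib)
  qed
  then show ?thesis using u'(3) v'(3) by eventually_elim auto
qed

text \<open>With W the volume of the box, Hoelder's factor W^(1/q) divided by W is W^(-1/p), which
  produces 2^((m-d)/p) and h^(-d/p); and 2^d / W is 2^m h^(-d).\<close>

lemma additive_bound_alt:
  assumes m: "m \<le> d" and h: "h > 0" and q: "1 / q = 1 - \<rho>"
  shows "(2 ^ d * F + N * (2 ^ (d - m) * h ^ d) powr (1 / q) * (h * A)) / (2 ^ (d - m) * h ^ d)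
    = A * h powr (1 - real d * \<rho>) * 2 powr ((real m - real d) * \<rho>) * N + 2 ^ m * h powr (- real d) * F"
proof -
  define W where "W = 2 ^ (d - m) * h ^ d"
  have W: "W = 2 powr (real d - real m) * h powr real d"
    using m h by (simp add: W_def powr_realpow[symmetric] of_nat_diff)
  have W0: "W > 0" using h by (simp add: W_def)
  have "W powr (1 / q) = W / W powr \<rho>"
    unfolding q using W0 by (simp add: powr_diff)
  then have "W powr (1 / q) / W = W powr (- \<rho>)"
    using W0 by (simp add: powr_minus divide_inverse)
  also have "\<dots> = 2 powr ((real m - real d) * \<rho>) * h powr (- real d * \<rho>)"
    using h by (simp add: W powr_mult powr_powr algebra_simps)
  finally have 1: "W powr (1 / q) / W * h = h powr (1 - real d * \<rho>) * 2 powr ((real m - real d) * \<rho>)"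
    using h by (simp add: powr_diff powr_minus divide_inverse)
  have 2: "2 ^ d / W = 2 ^ m * h powr (- real d)"
  proof -
    have "(2 :: real) ^ d = 2 ^ m * 2 ^ (d - m)" using m by (simp add: power_add[symmetric])
    then show ?thesis using h by (simp add: W_def powr_minus powr_realpow divide_inverse)
  qed
  have "(2 ^ d * F + N * W powr (1 / q) * (h * A)) / W = (2 ^ d / W) * F + A * (W powr (1 / q) / W * h) * N"
    using W0 by (simp add: field_simps)
  then show ?thesis unfolding 1 2 W_def[symmetric] by simp
qed

lemma additive_inequality:
  fixes f g :: "real ^ 'n::{finite,linorder} \<Rightarrow> real"
  assumes m: "m \<le> CARD('n)" and p: "ereal (real CARD('n)) < p" and h: "h > 0"
    and adm: "admissible (orthant m) p f g G"
  shows "in_Lp \<infinity> (orthant m) g" "Lp_norm \<infinity> (orthant m) g \<le> additive_bound m p h f G"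
    "0 \<le> Lp_norm p (orthant m) (\<lambda>x. cube_dual_norm (G x))"
proof -
  let ?C = "orthant m :: (real ^ 'n::{finite,linorder}) set" and ?d = "CARD('n)"
  have C: "?C \<in> sets borel" by measurable
  then have Cl: "?C \<in> sets lebesgue" by auto
  note q = conj_exp_props[OF p, simplified]
  have f: "in_Lp \<infinity> ?C f" and wmixed: "has_weak_partials ?C (sorted_list_of_set UNIV) f g"
    and W1: "in_W1 p ?C g" and wgrad: "\<And>i. has_weak_partials ?C [i] g (\<lambda>x. G x $ i)"
    using adm by (auto simp: admissible_def has_mixed_deriv_def has_weak_gradient_def)
  \<comment> \<open>The gradient provided by \<open>in_W1\<close>, with components in L_p; it agrees
    with \<open>G\<close> almost everywhere and so has the same norm.\<close>
  obtain H where H: "\<And>i. has_weak_partials ?C [i] g (\<lambda>x. H x $ i)" "\<And>i. in_Lp p ?C (\<lambda>x. H x $ i)"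
    using W1 by (auto simp: in_W1_def has_weak_gradient_def)
  have li: "locally_integrable ?C f" "locally_integrable ?C g" "\<And>i. locally_integrable ?C (\<lambda>x. G x $ i)"
    using wmixed wgrad by (auto simp: has_weak_partials_def)
  obtain f' where f': "f' \<in> borel_measurable borel" "\<forall>x. x \<notin> ?C \<longrightarrow> f' x = 0" "AE x in lebesgue. x \<in> ?C \<longrightarrow> f x = f' x"
    using locally_integrable_borel_representative[OF li(1)] by blast
  obtain g' where g': "g' \<in> borel_measurable borel" "\<forall>x. x \<notin> ?C \<longrightarrow> g' x = 0" "AE x in lebesgue. x \<in> ?C \<longrightarrow> g x = g' x"
    using locally_integrable_borel_representative[OF li(2)] by blast
  have "\<exists>u. u \<in> borel_measurable borel \<and> (\<forall>x. x \<notin> ?C \<longrightarrow> u x = 0) \<and> (AE x in lebesgue. x \<in> ?C \<longrightarrow> G x $ i = u x)" for i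
  proof -
    obtain u where "u \<in> borel_measurable borel" "\<forall>x. x \<notin> ?C \<longrightarrow> u x = 0" "AE x in lebesgue. x \<in> ?C \<longrightarrow> G x $ i = u x"
      using locally_integrable_borel_representative[OF li(3)[of i]] by blast
    then show ?thesis by (intro exI[of _ u] conjI)
  qed
  then have "\<forall>i. \<exists>u. u \<in> borel_measurable borel \<and> (\<forall>x. x \<notin> ?C \<longrightarrow> u x = 0) \<and> (AE x in lebesgue. x \<in> ?C \<longrightarrow> G x $ i = u x)"
    by blast
  from choice[OF this] obtain G' where G': "\<And>i. G' i \<in> borel_measurable borel" "\<And>i. \<forall>x. x \<notin> ?C \<longrightarrow> G' i x = 0"
    "\<And>i. AE x in lebesgue. x \<in> ?C \<longrightarrow> G x $ i = G' i x"
    by blast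
  define F where "F = Lp_norm \<infinity> ?C f"
  have F0: "0 \<le> F" unfolding F_def by (rule Linf_AE(2)[OF f Cl])
  interpret weak_data m f' g' G' F
  proof
    show "AE x in lborel. \<bar>f' x\<bar> \<le> F"
    proof -
      have "AE x in lebesgue. \<bar>f' x\<bar> \<le> F"
        using Linf_AE(1)[OF f Cl, folded F_def] f'(3)
      proof eventually_elim
        case (elim x)
        then show ?case using F0 f'(2) by (cases "x \<in> ?C") auto
      qed
      then show ?thesis using f'(1) by (subst (asm) AE_completion_iff) auto
    qed
    show "(LINT x|lborel. f' x * partials (sorted_list_of_set UNIV) \<phi> x) = (- 1) ^ CARD('n) * (LINT x|lborel. g' x * \<phi> x)"
      if "test_function ?C \<phi>" for \<phi>
      using has_weak_partials_borelD[OF wmixed C f' g' that] by simp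
    show "(LINT x|lborel. g' x * partial i \<phi> x) = - (LINT x|lborel. G' i x * \<phi> x)" if "test_function ?C \<phi>" for i \<phi>
      using has_weak_partials_borelD[OF wgrad C g' G'(1,2,3) that] by (simp add: partials_def)
    show "integrable lborel (\<lambda>x. g' x * indicator (cbox a b) x)" if "cbox a b \<subseteq> ?C" for a b
      by (rule integrable_borel_representative[OF li(2) C g' that])
    show "integrable lborel (\<lambda>x. G' i x * indicator (cbox a b) x)" if "cbox a b \<subseteq> ?C" for i a b
      by (rule integrable_borel_representative[OF li(3) C G'(1,2,3) that])
  qed (use f' g' G' F0 in auto)
  define \<gamma> where "\<gamma> = (\<lambda>x. \<Sum>i\<in>UNIV. \<bar>G' i x\<bar>)"
  have [measurable]: "\<gamma> \<in> borel_measurable borel" unfolding \<gamma>_def by measurable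
  have \<gamma>0: "0 \<le> \<gamma> x" for x by (simp add: \<gamma>_def sum_nonneg)
  have aeG: "AE x in lebesgue. \<forall>i\<in>UNIV. x \<in> ?C \<longrightarrow> G x $ i = G' i x"
    using G'(3) by (intro AE_finite_allI) auto
  have aeH: "AE x in lebesgue. \<forall>i\<in>UNIV. x \<in> ?C \<longrightarrow> G x $ i = H x $ i"
    using weak_partial_unique[OF wgrad H(1)] by (intro AE_finite_allI) auto
  define N where "N = Lp_norm p ?C (\<lambda>x. cube_dual_norm (G x))"
  have mG[measurable]: "(\<lambda>x. G x $ i) \<in> borel_measurable (lebesgue_on ?C)" for i
    using locally_integrable_measurable[OF open_orthant li(3)[of i]]
    by (simp add: borel_measurable_lebesgue_on_indicator[OF Cl])
  have mH[measurable]: "(\<lambda>x. H x $ i) \<in> borel_measurable (lebesgue_on ?C)" for i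
    using H(2)[of i] by (simp add: in_Lp_def)
  have N: "N = Lp_norm p ?C (\<lambda>x. \<Sum>i\<in>UNIV. \<bar>H x $ i\<bar>)"
    unfolding N_def cube_dual_norm_eq_sum
  proof (rule Lp_norm_cong_AE[OF Cl])
    show "AE x in lebesgue. x \<in> ?C \<longrightarrow> (\<Sum>i\<in>UNIV. \<bar>G x $ i\<bar>) = (\<Sum>i\<in>UNIV. \<bar>H x $ i\<bar>)"
      using aeH by eventually_elim auto
  qed measurable
  have "Lnorm_bound p \<gamma> N \<and> 0 \<le> N"
    unfolding N
  proof (intro conjI Lnorm_bound_Lp_norm[OF C q(4) in_Lp_sum_abs[OF Cl q(4) H(2)]])
    show "\<gamma> \<in> borel_measurable borel" "\<gamma> \<in> borel_measurable borel" by measurable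
    show "\<forall>x. x \<notin> ?C \<longrightarrow> \<gamma> x = 0" "\<forall>x. x \<notin> ?C \<longrightarrow> \<gamma> x = 0" using G'(2) by (auto simp: \<gamma>_def)
    show "AE x in lebesgue. x \<in> ?C \<longrightarrow> (\<Sum>i\<in>UNIV. \<bar>H x $ i\<bar>) = \<gamma> x"
      using aeH aeG by eventually_elim (auto simp: \<gamma>_def intro!: sum.cong)
    then show "AE x in lebesgue. x \<in> ?C \<longrightarrow> (\<Sum>i\<in>UNIV. \<bar>H x $ i\<bar>) = \<gamma> x" .
  qed
  then have NN: "0 \<le> N" "Lnorm_bound p \<gamma> N" by auto
  \<comment> \<open>Hoelder's bound for the gradient term; it plays the part of \<open>H\<close> in
    \<open>essential_bound\<close>.\<close>
  define R where "R = N * (2 ^ (?d - m) * h ^ ?d) powr (1 / conj_exp p) * (h * const_A ?d p)"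
  have A0: "0 \<le> const_A ?d p"
    by (simp add: const_A_def)
  have R0: "0 \<le> R" unfolding R_def using NN h A0 by simp
  have bound: "(\<integral>\<^sup>+y. indicator (corner_box m h) y * (\<integral>\<^sup>+t. indicator {0..1} t *
       (ennreal (infnorm y) * ennreal (\<Sum>i\<in>UNIV. \<bar>G' i (x + t *\<^sub>R y)\<bar>)) \<partial>lborel) \<partial>lborel) \<le> ennreal R" for x
    using nn_integral_segments_corner_box[OF h, of "\<lambda>y. ennreal (\<gamma> (x + y))" m]
      kernel_Holder[OF m p h _ \<gamma>0 NN, of x]
    by (simp add: \<gamma>_def R_def)
  have Q: "measure lborel (corner_box m h :: (real ^ 'n::{finite,linorder}) set) = 2 ^ (?d - m) * h ^ ?d"
    using h by (intro measure_corner_box m) auto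
  have "AE x in lebesgue. x \<in> ?C \<longrightarrow> \<bar>g' x\<bar> \<le> (2 ^ ?d * F + R) / measure lborel (corner_box m h :: (real ^ 'n::{finite,linorder}) set)"
    using bound Q h unfolding corner_box_def by (intro essential_bound R0) auto
  then have "AE x in lebesgue. x \<in> ?C \<longrightarrow> \<bar>g x\<bar> \<le> additive_bound m p h f G"
    using g'(3)
    unfolding Q R_def additive_bound_alt[OF m h q(5)] additive_bound_def N_def[symmetric] F_def[symmetric]
    by eventually_elim (auto simp: mult_ac)
  moreover have "g \<in> borel_measurable (lebesgue_on ?C)"
    using locally_integrable_measurable[OF open_orthant li(2)]
    by (simp add: borel_measurable_lebesgue_on_indicator[OF Cl])
  moreover have "0 \<le> additive_bound m p h f G"
    using A0 NN(1) F0 h by (simp add: additive_bound_def N_def F_def)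
  ultimately show "in_Lp \<infinity> (orthant m) g" "Lp_norm \<infinity> (orthant m) g \<le> additive_bound m p h f G"
    "0 \<le> Lp_norm p (orthant m) (\<lambda>x. cube_dual_norm (G x))"
    using Linf_le[OF Cl] NN(1) unfolding N_def by blast+
qed

section \<open>The multiplicative inequality\<close>

text \<open>Weighted AM-GM with weights \<alpha> and 1 - \<alpha> such that a \<alpha> = d (1 -
  \<alpha>): then the powers of h cancel in the geometric mean. Equality holds when the two terms,
  each divided by its weight, agree; this determines h.\<close>

lemma powr_AM_GM_scale:
  fixes a d P Q h :: real
  assumes a: "a > 0" and d: "d > 0" and P: "P > 0" and Q: "Q > 0" and h: "h > 0"
  defines "\<alpha> \<equiv> d / (a + d)"
  shows "(a / d) powr \<alpha> * (d / a + 1) * P powr \<alpha> * Q powr (1 - \<alpha>) \<le> P * h powr a + Q * h powr (- d)"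
    and "\<exists>h>0. P * h powr a + Q * h powr (- d) = (a / d) powr \<alpha> * (d / a + 1) * P powr \<alpha> * Q powr (1 - \<alpha>)"
proof -
  have \<alpha>: "0 < \<alpha>" "\<alpha> < 1" "1 - \<alpha> = a / (a + d)" using a d by (auto simp: \<alpha>_def field_simps)
  have const: "(a / d) powr \<alpha> * (d / a + 1) = (1 / \<alpha>) powr \<alpha> * (1 / (1 - \<alpha>)) powr (1 - \<alpha>)"
  proof -
    have "(1 / x) powr (1 - \<alpha>) = (1 / x) * x powr \<alpha>" if "x > 0" for x :: real
      using that by (simp add: powr_diff powr_divide)
    from this[of "1 - \<alpha>"] \<alpha>(2) have "(1 / (1 - \<alpha>)) powr (1 - \<alpha>) = (1 / (1 - \<alpha>)) * (1 - \<alpha>) powr \<alpha>"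
      by simp
    then have "(1 / \<alpha>) powr \<alpha> * (1 / (1 - \<alpha>)) powr (1 - \<alpha>) = ((1 / \<alpha>) powr \<alpha> * (1 - \<alpha>) powr \<alpha>) * (1 / (1 - \<alpha>))"
      by simp
    also have "(1 / \<alpha>) powr \<alpha> * (1 - \<alpha>) powr \<alpha> = ((1 / \<alpha>) * (1 - \<alpha>)) powr \<alpha>"
      using \<alpha> by (subst powr_mult) auto
    also have "(1 / \<alpha>) * (1 - \<alpha>) = a / d" using a d unfolding \<alpha>(3) by (simp add: \<alpha>_def)
    finally have "(1 / \<alpha>) powr \<alpha> * (1 / (1 - \<alpha>)) powr (1 - \<alpha>) = (a / d) powr \<alpha> * (1 / (1 - \<alpha>))" .
    moreover have "1 / (1 - \<alpha>) = d / a + 1" using a d unfolding \<alpha>(3) by (simp add: field_simps)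
    ultimately show ?thesis by (simp only:)
  qed
  have prod: "(P * h powr a / \<alpha>) powr \<alpha> * (Q * h powr (- d) / (1 - \<alpha>)) powr (1 - \<alpha>)
      = (a / d) powr \<alpha> * (d / a + 1) * P powr \<alpha> * Q powr (1 - \<alpha>)" if h: "h > 0" for h
  proof -
    have e: "a * \<alpha> + - d * (1 - \<alpha>) = 0" using a d unfolding \<alpha>(3) by (simp add: \<alpha>_def)
    have "(P * h powr a / \<alpha>) powr \<alpha> = P powr \<alpha> * h powr (a * \<alpha>) * (1 / \<alpha>) powr \<alpha>"
      using P \<alpha> h by (simp add: powr_mult powr_divide powr_powr)
    moreover have "(Q * h powr (- d) / (1 - \<alpha>)) powr (1 - \<alpha>) = Q powr (1 - \<alpha>) * h powr (- d * (1 - \<alpha>)) * (1 / (1 - \<alpha>)) powr (1 - \<alpha>)"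
      using Q \<alpha>(1,2) h by (simp add: powr_mult powr_divide powr_powr)
    ultimately have "(P * h powr a / \<alpha>) powr \<alpha> * (Q * h powr (- d) / (1 - \<alpha>)) powr (1 - \<alpha>)
      = ((1 / \<alpha>) powr \<alpha> * (1 / (1 - \<alpha>)) powr (1 - \<alpha>)) * P powr \<alpha> * Q powr (1 - \<alpha>) * (h powr (a * \<alpha>) * h powr (- d * (1 - \<alpha>)))"
      by (simp only: mult_ac)
    also have "h powr (a * \<alpha>) * h powr (- d * (1 - \<alpha>)) = 1"
      using h by (simp only: powr_add[symmetric] e) simp
    finally show ?thesis unfolding const by simp
  qed
  have "(P * h powr a / \<alpha>) powr \<alpha> * (Q * h powr (- d) / (1 - \<alpha>)) powr (1 - \<alpha>)
      \<le> \<alpha> * (P * h powr a / \<alpha>) + (1 - \<alpha>) * (Q * h powr (- d) / (1 - \<alpha>))"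
    using P Q h \<alpha>(1,2) by (intro Youngs_inequality_0) auto
  also have "\<dots> = P * h powr a + Q * h powr (- d)" using \<alpha>(1,2) by simp
  finally show "(a / d) powr \<alpha> * (d / a + 1) * P powr \<alpha> * Q powr (1 - \<alpha>) \<le> P * h powr a + Q * h powr (- d)"
    unfolding prod[OF h] .
  \<comment> \<open>The zero of the derivative in h, that is, the solution of a P h^(a+d) = d
    Q.\<close>
  define k where "k = (d * Q / (a * P)) powr (1 / (a + d))"
  have k: "k > 0" using a d P Q by (simp add: k_def)
  have "k powr (a + d) = d * Q / (a * P)" using a d P Q by (simp add: k_def powr_powr)
  then have "k powr a * P * a = d * Q * k powr (- d)"
    using a P k by (simp add: powr_add powr_minus field_simps)
  then have eq: "P * k powr a / \<alpha> = Q * k powr (- d) / (1 - \<alpha>)"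
    using a d unfolding \<alpha>(3) by (simp add: \<alpha>_def field_simps)
  define X where "X = P * k powr a / \<alpha>"
  have X: "X > 0" using P k \<alpha> by (simp add: X_def)
  have "P * k powr a + Q * k powr (- d) = \<alpha> * (P * k powr a / \<alpha>) + (1 - \<alpha>) * (Q * k powr (- d) / (1 - \<alpha>))"
    using \<alpha>(1,2) by simp
  also have "\<dots> = X" unfolding eq[symmetric] X_def[symmetric] by (simp add: algebra_simps)
  also have "\<dots> = X powr \<alpha> * X powr (1 - \<alpha>)" using X by (simp add: powr_add[symmetric])
  also have "\<dots> = (P * k powr a / \<alpha>) powr \<alpha> * (Q * k powr (- d) / (1 - \<alpha>)) powr (1 - \<alpha>)"
    unfolding eq[symmetric] X_def ..
  finally show "\<exists>h>0. P * h powr a + Q * h powr (- d) = (a / d) powr \<alpha> * (d / a + 1) * P powr \<alpha> * Q powr (1 - \<alpha>)"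
    unfolding prod[OF k] using k by blast
qed

text \<open>For positive P and Q insert the minimiser. If P = 0, let h tend to infinity, and if Q =
  0, let h tend to 0: this gives L <= 0, and the right-hand side is 0 in both cases.\<close>

lemma optimize_scale:
  fixes a d P Q L :: real
  assumes a: "a > 0" and d: "d > 0" and P: "P \<ge> 0" and Q: "Q \<ge> 0"
    and L: "\<And>h. h > 0 \<Longrightarrow> L \<le> P * h powr a + Q * h powr (- d)"
  shows "L \<le> (a / d) powr (d / (a + d)) * (d / a + 1) * P powr (d / (a + d)) * Q powr (1 - d / (a + d))"
proof -
  consider "P > 0" "Q > 0" | "P = 0" | "Q = 0" using P Q by linarith
  then show ?thesis
  proof cases
    case 1
    then show ?thesis
      using powr_AM_GM_scale(2)[OF a d 1, of 1] L by (metis zero_less_one)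
  next
    case 2
    have "((\<lambda>h. Q * h powr (- d)) \<longlongrightarrow> 0) at_top" using d by real_asymp
    moreover have "eventually (\<lambda>h. L \<le> Q * h powr (- d)) at_top"
      using eventually_gt_at_top[of 0] by eventually_elim (use L 2 in force)
    ultimately have "L \<le> 0" by (intro tendsto_lowerbound) auto
    then show ?thesis using 2 by simp
  next
    case 3
    have "((\<lambda>h. P * h powr a) \<longlongrightarrow> 0) (at_right 0)" using a by real_asymp
    moreover have "eventually (\<lambda>h. L \<le> P * h powr a) (at_right 0)"
      using eventually_at_right_less[of 0] by eventually_elim (use L 3 in force)
    ultimately have "L \<le> 0" by (intro tendsto_lowerbound) auto
    then show ?thesis using 3 by simp
  qed
qed

section \<open>The exponent alpha and the constant a(d,p)\<close>

lemma alpha_eq: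
  assumes "ereal (real d) < p" "d > 0"
  shows "alpha d p = real d / ((1 - real d * recip p) + real d)" "0 < 1 - real d * recip p"
proof -
  have "alpha d p = real d / ((1 - real d * recip p) + real d) \<and> 0 < 1 - real d * recip p"
  \<comment> \<open>Expressed through 1/p, both cases are one formula; at 1/p = 0 it is the value of
    the limit.\<close>
  proof (cases "p = \<infinity>")
    case True
    have "((\<lambda>q. q * real d / (q + (q - 1) * real d)) \<longlongrightarrow> real d / (1 + real d)) at_top"
      using assms(2) by (real_asymp simp: field_simps)
    then have "Lim at_top (\<lambda>q. q * real d / (q + (q - 1) * real d)) = real d / (1 + real d)"
      by (intro tendsto_Lim) auto
    then show ?thesis using True by (simp add: alpha_def extend_to_infinity_def recip_def)
  next
    case False
    then obtain r where r: "p = ereal r" "r > real d" using assms by (cases p) auto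
    then have r0: "r > 0" by (meson le_less_trans of_nat_0_le_iff)
    have "(1 - real d / r) + real d = (r + (r - 1) * real d) / r" using r0 by (simp add: field_simps)
    then show ?thesis using r r0 by (simp add: alpha_def extend_to_infinity_def recip_def mult.commute)
  qed
  then show "alpha d p = real d / ((1 - real d * recip p) + real d)" "0 < 1 - real d * recip p" by auto
qed

text \<open>A(d,p) depends on p only through the conjugate exponent, which tends to 1; the Beta
  function is continuous there because 1 - (d-1)/d is positive.\<close>

lemma const_A_tendsto:
  assumes "d > 0"
  shows "((\<lambda>q. const_A d (ereal q)) \<longlongrightarrow> const_A d \<infinity>) at_top"
proof -
  have c: "((\<lambda>q. conj_exp (ereal q)) \<longlongrightarrow> 1) at_top"
    unfolding conj_exp_def by simp real_asymp
  let ?a = "\<lambda>c. 1 - (real d - 1) * c / real d"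
  have pos: "?a 1 > 0" using assms by (simp add: field_simps)
  then have pos3: "3 - (real d - 1) / real d > 0" by simp
  have nn: "x \<notin> \<int>\<^sub>\<le>\<^sub>0" if "x > 0" for x :: real
    using that by (auto elim!: nonpos_Ints_cases)
  have "((\<lambda>q. Beta (?a (conj_exp (ereal q))) (conj_exp (ereal q) + 1)) \<longlongrightarrow> Beta (?a 1) (1 + 1)) at_top"
    unfolding Beta_def using nn[OF pos] nn[of 2] nn[OF pos3] assms
    by (intro tendsto_intros c) (auto simp: Gamma_eq_zero_iff)
  moreover have "Beta (?a 1) (1 + 1) > 0" using pos by (intro Beta_real_pos) auto
  ultimately have "((\<lambda>q. (1 / real d) * Beta (?a (conj_exp (ereal q))) (conj_exp (ereal q) + 1) powr (1 / conj_exp (ereal q)))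
      \<longlongrightarrow> (1 / real d) * Beta (?a 1) (1 + 1) powr (1 / 1)) at_top"
    by (intro tendsto_intros c) auto
  then show ?thesis by (simp add: const_A_def conj_exp_def)
qed

text \<open>With a = 1 - d/p, the exponent of h in the additive bound, (p-d)/(pd) is a/d and
  pd/(p-d) is d/a. So a(d,p) is the constant of \<open>powr_AM_GM_scale\<close> with A(d,p)
  absorbed.\<close>

lemma const_a_eq:
  assumes "ereal (real d) < p" "d > 0"
  defines "a \<equiv> 1 - real d * recip p"
  shows "const_a d p = (a / real d * const_A d p) powr (real d / (a + real d)) * (real d / a + 1)"
proof (cases "p = \<infinity>")
  case False
  then obtain r where r: "p = ereal r" "r > real d" using assms by (cases p) auto
  then have r0: "r > 0" by (meson le_less_trans of_nat_0_le_iff)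
  have "a = (r - real d) / r" using r r0 by (simp add: a_def recip_def field_simps)
  moreover have "alpha d p = real d / (a + real d)"
    unfolding a_def by (rule alpha_eq[OF assms(1,2)])
  ultimately show ?thesis
    using r r0 by (simp add: const_a_def extend_to_infinity_def mult.commute)
next
  case True
  have A: "const_A d \<infinity> > 0"
    using assms(2) Beta_real_pos[of "1 - (real d - 1) / real d" 2] by (simp add: const_A_def conj_exp_def field_simps)
  have l1: "((\<lambda>q. (q - real d) / (q * real d)) \<longlongrightarrow> 1 / real d) at_top"
    using assms(2) by (real_asymp simp: field_simps)
  have l2: "((\<lambda>q. q * real d / (q - real d)) \<longlongrightarrow> real d) at_top"
    by real_asymp
  have l3: "((\<lambda>q. alpha d (ereal q)) \<longlongrightarrow> real d / (1 + real d)) at_top"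
    unfolding alpha_def extend_to_infinity_def using assms(2) by simp (real_asymp simp: field_simps)
  have "((\<lambda>q. ((q - real d) / (q * real d) * const_A d (ereal q)) powr alpha d (ereal q) * (q * real d / (q - real d) + 1))
    \<longlongrightarrow> (1 / real d * const_A d \<infinity>) powr (real d / (1 + real d)) * (real d + 1)) at_top"
    using A assms(2) by (intro tendsto_intros l1 l2 l3 const_A_tendsto) auto
  then have "((\<lambda>q. ((q - real d) * const_A d (ereal q) / (q * real d)) powr alpha d (ereal q) * (q * real d / (q - real d) + 1))
    \<longlongrightarrow> (1 / real d * const_A d \<infinity>) powr (real d / (1 + real d)) * (real d + 1)) at_top"
    by simp
  then have "Lim at_top (\<lambda>q. ((q - real d) * const_A d (ereal q) / (q * real d)) powr alpha d (ereal q) * (q * real d / (q - real d) + 1))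
    = (1 / real d * const_A d \<infinity>) powr (real d / (1 + real d)) * (real d + 1)"
    by (intro tendsto_Lim) auto
  then show ?thesis using True by (simp add: const_a_def extend_to_infinity_def a_def recip_def)
qed

text \<open>Brings the additive bound to the form P h^a + Q h^(-d) and the multiplicative one to the
  value of its minimum for positive \<open>P\<close> and \<open>Q\<close>. The power of 2 in the
  latter collects 2^((m-d)/p) to the power \<alpha> and 2^m to the power 1 - \<alpha>.\<close>

lemma multiplicative_bound_alt:
  fixes f :: "real ^ 'n::{finite,linorder} \<Rightarrow> real" and G :: "real ^ 'n::{finite,linorder} \<Rightarrow> real ^ 'n::{finite,linorder}"
  assumes p: "ereal (real CARD('n)) < p"
    and N: "N = Lp_norm p (orthant m) (\<lambda>x. cube_dual_norm (G x))" "0 \<le> N"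
    and F: "F = Lp_norm \<infinity> (orthant m) f" "0 \<le> F"
  defines "d \<equiv> real CARD('n)" and "a \<equiv> 1 - real CARD('n) * recip p"
  defines "P \<equiv> const_A CARD('n) p * 2 powr ((real m - real CARD('n)) * recip p) * N" and "Q \<equiv> 2 ^ m * F"
  shows "multiplicative_bound m p f G = (a / d) powr (d / (a + d)) * (d / a + 1) * P powr (d / (a + d)) * Q powr (1 - d / (a + d))"
    and "h > 0 \<Longrightarrow> additive_bound m p h f G = P * h powr a + Q * h powr (- d)"
    and "0 < a" "0 < d" "0 \<le> P" "0 \<le> Q"
proof -
  have d: "0 < d" "CARD('n) > 0" by (simp_all add: d_def)
  have a: "0 < a" unfolding a_def by (rule alpha_eq(2)[OF p d(2)])
  have A: "0 \<le> const_A CARD('n) p" by (simp add: const_A_def)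
  show "0 < a" "0 < d" "0 \<le> P" "0 \<le> Q" using a d A N F by (auto simp: P_def Q_def)
  show "additive_bound m p h f G = P * h powr a + Q * h powr (- d)" if "h > 0"
    by (simp add: additive_bound_def P_def Q_def N F a_def d_def mult_ac)
  define \<alpha> where "\<alpha> = d / (a + d)"
  have al: "alpha CARD('n) p = \<alpha>"
    unfolding \<alpha>_def a_def d_def by (rule alpha_eq(1)[OF p d(2)])
  have ca: "const_a CARD('n) p = (a / d * const_A CARD('n) p) powr \<alpha> * (d / a + 1)"
    unfolding \<alpha>_def a_def d_def by (rule const_a_eq[OF p d(2)])
  \<comment> \<open>Comparison of the exponents of 2, by \<alpha> (a + d) = d.\<close>
  have e: "(real m - d) * recip p * \<alpha> + real m * (1 - \<alpha>) = \<alpha> * (real m / d - d * recip p)"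
  proof -
    have "\<alpha> * (a + d) = d" using a d by (simp add: \<alpha>_def)
    then have "\<alpha> * (1 - d * recip p + d) = d" by (simp add: a_def d_def)
    then have "real m * (\<alpha> * (1 - d * recip p + d)) / d = real m" using d by simp
    then show ?thesis using d by (simp add: field_simps)
  qed
  have Pp: "P powr \<alpha> = const_A CARD('n) p powr \<alpha> * 2 powr ((real m - d) * recip p * \<alpha>) * N powr \<alpha>"
    using A N by (simp add: P_def powr_mult powr_powr d_def)
  have Qp: "Q powr (1 - \<alpha>) = 2 powr (real m * (1 - \<alpha>)) * F powr (1 - \<alpha>)"
    using F by (simp add: Q_def powr_mult powr_powr powr_realpow[symmetric])
  have "(a / d) powr \<alpha> * (d / a + 1) * P powr \<alpha> * Q powr (1 - \<alpha>)
    = ((a / d) powr \<alpha> * const_A CARD('n) p powr \<alpha>) * (d / a + 1) *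
      (2 powr ((real m - d) * recip p * \<alpha>) * 2 powr (real m * (1 - \<alpha>))) * F powr (1 - \<alpha>) * N powr \<alpha>"
    unfolding Pp Qp by (simp only: mult_ac)
  also have "(a / d) powr \<alpha> * const_A CARD('n) p powr \<alpha> = (a / d * const_A CARD('n) p) powr \<alpha>"
    using a d A by (subst powr_mult) auto
  also have "2 powr ((real m - d) * recip p * \<alpha>) * 2 powr (real m * (1 - \<alpha>)) = 2 powr (\<alpha> * (real m / d - d * recip p))"
    unfolding e[symmetric] by (simp add: powr_add)
  finally have "(a / d) powr \<alpha> * (d / a + 1) * P powr \<alpha> * Q powr (1 - \<alpha>)
    = (a / d * const_A CARD('n) p) powr \<alpha> * (d / a + 1) * 2 powr (\<alpha> * (real m / d - d * recip p)) * F powr (1 - \<alpha>) * N powr \<alpha>" .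
  moreover have "multiplicative_bound m p f G
    = (a / d * const_A CARD('n) p) powr \<alpha> * (d / a + 1) * 2 powr (\<alpha> * (real m / d - d * recip p)) * F powr (1 - \<alpha>) * N powr \<alpha>"
    by (simp add: multiplicative_bound_def al ca N(1) F(1) d_def)
  ultimately show "multiplicative_bound m p f G = (a / d) powr (d / (a + d)) * (d / a + 1) * P powr (d / (a + d)) * Q powr (1 - d / (a + d))"
    unfolding \<alpha>_def by (simp only:)
qed

lemma admissible_norms_nonneg:
  assumes m: "m \<le> CARD('n::{finite,linorder})" and p: "ereal (real CARD('n)) < p"
    and adm: "admissible (orthant m) p (f :: real ^ 'n::{finite,linorder} \<Rightarrow> real) g G"
  shows "0 \<le> Lp_norm \<infinity> (orthant m) f" "0 \<le> Lp_norm p (orthant m) (\<lambda>x. cube_dual_norm (G x))"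
proof -
  have C: "(orthant m :: (real ^ 'n::{finite,linorder}) set) \<in> sets lebesgue" using measurable_orthant by auto
  show "0 \<le> Lp_norm \<infinity> (orthant m) f"
    using adm Linf_AE(2)[OF _ C] by (simp add: admissible_def)
qed (rule additive_inequality(3)[OF m p zero_less_one adm])

lemma multiplicative_inequality:
  fixes f g :: "real ^ 'n::{finite,linorder} \<Rightarrow> real"
  assumes m: "m \<le> CARD('n)" and p: "ereal (real CARD('n)) < p" and adm: "admissible (orthant m) p f g G"
  shows "Lp_norm \<infinity> (orthant m) g \<le> multiplicative_bound m p f G"
proof -
  note alt = multiplicative_bound_alt[OF p refl admissible_norms_nonneg(2)[OF m p adm] refl admissible_norms_nonneg(1)[OF m p adm]]
  show ?thesis
    unfolding alt(1)
    using additive_inequality(2)[OF m p _ adm] alt(2)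
    by (intro optimize_scale alt(3-6)) auto
qed

text \<open>AM-GM is available for positive \<open>P\<close> and \<open>Q\<close>. Both are positive
  here: otherwise the multiplicative bound would be 0, and with it the norm of g.\<close>

lemma multiplicative_le_additive:
  fixes f g :: "real ^ 'n::{finite,linorder} \<Rightarrow> real"
  assumes m: "m \<le> CARD('n)" and p: "ereal (real CARD('n)) < p" and adm: "admissible (orthant m) p f g G"
    and g: "Lp_norm \<infinity> (orthant m) g > 0" and h: "h > 0"
  shows "multiplicative_bound m p f G \<le> additive_bound m p h f G"
proof -
  note alt = multiplicative_bound_alt[OF p refl admissible_norms_nonneg(2)[OF m p adm] refl admissible_norms_nonneg(1)[OF m p adm]]
  let ?P = "const_A CARD('n) p * 2 powr ((real m - real CARD('n)) * recip p) * Lp_norm p (orthant m) (\<lambda>x. cube_dual_norm (G x))"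
  let ?Q = "2 ^ m * Lp_norm \<infinity> (orthant m) f"
  have "?P \<noteq> 0 \<and> ?Q \<noteq> 0"
    using multiplicative_inequality[OF m p adm] g unfolding alt(1) by (metis mult_zero_left mult_zero_right powr_0 not_less powr_zero_eq_one less_le_not_le)
  then have "?P > 0" "?Q > 0" using alt(5,6) by linarith+
  from powr_AM_GM_scale(1)[OF alt(3,4) this h] show ?thesis
    unfolding alt(1) alt(2)[OF h] .
qed

section \<open>Weak derivatives by testing\<close>

lemma partials_partials: "partials js (partials is \<phi>) = partials (js @ is) \<phi>"
  by (simp add: partials_def)

lemma smooth_partials: "smooth \<phi> \<Longrightarrow> smooth (partials is \<phi>)"
  unfolding smooth_def partials_partials by blast

text \<open>\<open>smooth\<close> speaks of differentiability at parameter 0 only; moving the base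
  point gives it all along the line.\<close>

lemma smooth_has_derivative:
  assumes "smooth \<phi>"
  shows "((\<lambda>t. \<phi> (x + t *\<^sub>R axis i 1)) has_real_derivative partial i \<phi> (x + t *\<^sub>R axis i 1)) (at t)"
proof -
  let ?y = "x + t *\<^sub>R axis i 1"
  have "(\<lambda>s. partials [] \<phi> (?y + s *\<^sub>R axis i 1)) differentiable at 0"
    using assms unfolding smooth_def by blast
  then have "((\<lambda>s. \<phi> (?y + s *\<^sub>R axis i 1)) has_real_derivative partial i \<phi> ?y) (at 0)"
    unfolding partial_def DERIV_deriv_iff_real_differentiable by (simp add: partials_def)
  also have "(\<lambda>s. \<phi> (?y + s *\<^sub>R axis i 1)) = (\<lambda>s. \<phi> (x + (s + t) *\<^sub>R axis i 1))"
    by (simp add: algebra_simps)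
  finally show ?thesis
    using DERIV_shift[of "\<lambda>t. \<phi> (x + t *\<^sub>R axis i 1)" "partial i \<phi> ?y" 0 t] by simp
qed

lemma partial_eq_0:
  assumes "open S" "\<And>x. x \<in> S \<Longrightarrow> \<phi> x = 0" "x \<in> S"
  shows "partial i \<phi> x = 0"
proof -
  let ?T = "(\<lambda>t. x + t *\<^sub>R axis i 1) -` S"
  have "open ?T"
    using assms(1) by (intro open_vimage continuous_intros)
  have "((\<lambda>t. \<phi> (x + t *\<^sub>R axis i 1)) has_real_derivative 0) (at 0)"
    by (rule has_field_derivative_transform_within_open[of "\<lambda>_. 0" _ _ ?T])
      (use assms \<open>open ?T\<close> in auto)
  then show ?thesis unfolding partial_def by (rule DERIV_imp_deriv)
qed

lemma partials_eq_0:
  assumes "open S" "\<And>x. x \<in> S \<Longrightarrow> \<phi> x = 0" "x \<in> S"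
  shows "partials is \<phi> x = 0"
  using assms(3)
proof (induction "is" arbitrary: x)
  case (Cons i "is")
  then show ?case
    using partial_eq_0[OF assms(1), of "partials is \<phi>"] by (simp add: partials_def)
qed (use assms in \<open>simp add: partials_def\<close>)

lemma bounded_if_zero_off_cbox:
  fixes u :: "real ^ 'n \<Rightarrow> real"
  assumes "continuous_on UNIV u" "\<And>x. x \<notin> cbox a b \<Longrightarrow> u x = 0"
  shows "\<exists>K\<ge>0. \<forall>x. \<bar>u x\<bar> \<le> K"
proof -
  have "bounded (u ` cbox a b)"
    by (intro compact_imp_bounded compact_continuous_image continuous_on_subset[OF assms(1)]) auto
  then obtain K where K: "\<And>x. x \<in> cbox a b \<Longrightarrow> \<bar>u x\<bar> \<le> K"
    by (auto simp: bounded_iff)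
  have "\<bar>u x\<bar> \<le> max 0 K" for x
    using K[of x] assms(2)[of x] by (cases "x \<in> cbox a b") auto
  then show ?thesis by (intro exI[of _ "max 0 K"]) auto
qed

abbreviation sym_cube :: "real \<Rightarrow> (real ^ 'n) set" where
  "sym_cube R \<equiv> cbox (\<chi> i. - R) (\<chi> i. R)"

text \<open>One cube around the origin contains the support; every iterated derivative vanishes
  outside it too and, being continuous, is bounded.\<close>

lemma test_function_sym_cube:
  assumes "test_function C \<phi>"
  obtains R where "R > 0" "\<And>is x. x \<notin> sym_cube R \<Longrightarrow> partials is \<phi> x = 0"
    "\<And>is. \<exists>K\<ge>0. \<forall>x. \<bar>partials is \<phi> x\<bar> \<le> K"
proof -
  let ?S = "closure {x. \<phi> x \<noteq> 0}"
  have S: "compact ?S" "smooth \<phi>" using assms by (auto simp: test_function_def)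
  then obtain B where B: "\<And>x. x \<in> ?S \<Longrightarrow> norm x \<le> B" "B > 0"
    by (metis compact_imp_bounded bounded_pos)
  have sub: "x \<in> sym_cube B" if "x \<in> ?S" for x
    unfolding mem_box_cart
  proof
    fix j
    have "\<bar>x $ j\<bar> \<le> B" using B(1)[OF that] component_le_norm_cart[of x j] by linarith
    then show "(\<chi> i. - B) $ j \<le> x $ j \<and> x $ j \<le> (\<chi> i. B) $ j" by (simp add: abs_le_iff)
  qed
  have zero: "partials is \<phi> x = 0" if "x \<notin> sym_cube B" for "is" x
  proof (rule partials_eq_0[of "- ?S"])
    show "\<phi> x = 0" if "x \<in> - ?S" for x using that closure_subset[of "{x. \<phi> x \<noteq> 0}"] by auto
  qed (use sub that in auto)
  show thesis
    by (rule that[OF B(2) zero]) (use bounded_if_zero_off_cbox[OF smooth_partials_continuous[OF S(2)] zero] in auto)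
qed

lemma integrable_bounded_cbox:
  fixes w :: "real ^ 'n \<Rightarrow> real"
  assumes "w \<in> borel_measurable borel" "\<And>x. \<bar>w x\<bar> \<le> K" "\<And>x. x \<notin> cbox a b \<Longrightarrow> w x = 0"
  shows "integrable lborel w"
  using integrable_mult_bounded_support[of "\<lambda>_. 1" "cbox a b" w K] integrable_indicator_cbox[of a b] assms by simp

text \<open>Integration by parts for difference quotients: translation invariance moves the quotient
  from u to \<phi>, with the opposite step. Quotients of u and of \<phi> are bounded, so both sides
  pass to the limit by dominated convergence.\<close>

lemma integral_partial_by_quotients:
  fixes u v :: "real ^ 'n \<Rightarrow> real"
  assumes u[measurable]: "u \<in> borel_measurable borel" and K: "\<And>x. \<bar>u x\<bar> \<le> K"
    and v[measurable]: "v \<in> borel_measurable borel"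
    and L: "\<And>x t. \<bar>u (x + t *\<^sub>R axis i 1) - u x\<bar> \<le> L * \<bar>t\<bar>"
    and lim: "AE x in lborel. (\<lambda>n. (u (x + (1 / (real n + 1)) *\<^sub>R axis i 1) - u x) * (real n + 1)) \<longlonglongrightarrow> v x"
    and \<phi>: "test_function C \<phi>"
  shows "(LINT x|lborel. u x * partial i \<phi> x) = - (LINT x|lborel. v x * \<phi> x)"
proof -
  define e :: "real ^ 'n" where "e = axis i 1"
  define t where "t = (\<lambda>n. 1 / (real n + 1))"
  have t: "0 < t n" "t n \<le> 1" "real n + 1 = 1 / t n" for n by (auto simp: t_def)
  have t0: "t \<longlonglongrightarrow> 0" unfolding t_def by real_asymp
  have smooth: "smooth \<phi>" using \<phi> by (simp add: test_function_def)
  obtain R where R: "R > 0" "\<And>is x. x \<notin> sym_cube R \<Longrightarrow> partials is \<phi> x = 0"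
    and bd: "\<And>is. \<exists>K\<ge>0. \<forall>x. \<bar>partials is \<phi> x\<bar> \<le> K"
    using test_function_sym_cube[OF \<phi>] by metis
  have p0: "partials [] \<phi> = \<phi>" and p1: "partials [i] \<phi> = partial i \<phi>" by (simp_all add: partials_def)
  obtain M where M: "\<And>x. \<bar>\<phi> x\<bar> \<le> M" using bd[of "[]"] p0 by auto
  obtain M' where M': "\<And>x. \<bar>partial i \<phi> x\<bar> \<le> M'" "0 \<le> M'" using bd[of "[i]"] p1 by auto
  have \<phi>0: "\<phi> x = 0" if "x \<notin> sym_cube R" for x using R(2)[OF that, of "[]"] p0 by simp
  have \<phi>m[measurable]: "\<phi> \<in> borel_measurable borel" "partial i \<phi> \<in> borel_measurable borel"
    using smooth_partials_measurable[OF smooth, of "[]"] smooth_partials_measurable[OF smooth, of "[i]"] p0 p1 by auto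
  have K0: "0 \<le> K" using K[of 0] by linarith
  have L0: "0 \<le> L" using L[of 0 1] by simp
  have D: "((\<lambda>s. \<phi> (x + s *\<^sub>R e)) has_real_derivative partial i \<phi> (x + s *\<^sub>R e)) (at s)" for x s
    unfolding e_def by (rule smooth_has_derivative[OF smooth])
  have lip: "\<bar>\<phi> (x - t n *\<^sub>R e) - \<phi> x\<bar> \<le> M' * t n" for x n
  proof -
    obtain z where "\<phi> (x + 0 *\<^sub>R e) - \<phi> (x + (- t n) *\<^sub>R e) = (0 - (- t n)) * partial i \<phi> (x + z *\<^sub>R e)"
      using MVT2[of "- t n" 0 "\<lambda>s. \<phi> (x + s *\<^sub>R e)" "\<lambda>s. partial i \<phi> (x + s *\<^sub>R e)"] D t(1)[of n] by auto
    then have "\<phi> (x - t n *\<^sub>R e) - \<phi> x = - (t n * partial i \<phi> (x + z *\<^sub>R e))" by simp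
    then show ?thesis using M'(1)[of "x + z *\<^sub>R e"] t(1)[of n] by (simp add: abs_mult mult.commute mult_left_mono)
  qed
  \<comment> \<open>Steps have length at most 1, so the cube enlarged by 1 contains the supports of
    all translates.\<close>
  have out: "\<phi> (x - t n *\<^sub>R e) = 0 \<and> \<phi> x = 0 \<and> partial i \<phi> x = 0" if "x \<notin> sym_cube (R + 1)" for x n
  proof -
    have "x - t n *\<^sub>R e \<notin> sym_cube R"
    proof
      assume a: "x - t n *\<^sub>R e \<in> sym_cube R"
      have "- (R + 1) \<le> x $ j \<and> x $ j \<le> R + 1" for j
      proof -
        have "- R \<le> x $ j - t n * (e $ j)" "x $ j - t n * (e $ j) \<le> R"
          using a by (auto simp: mem_box_cart)
        moreover have "0 \<le> t n * (e $ j)" "t n * (e $ j) \<le> 1"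
          using t(1,2)[of n] by (auto simp: e_def axis_def)
        ultimately show ?thesis by linarith
      qed
      then show False using that by (auto simp: mem_box_cart)
    qed
    moreover have "x \<notin> sym_cube R"
    proof
      assume a: "x \<in> sym_cube R"
      have "- (R + 1) \<le> x $ j \<and> x $ j \<le> R + 1" for j
      proof -
        have "- R \<le> x $ j" "x $ j \<le> R" using a by (auto simp: mem_box_cart)
        then show ?thesis by linarith
      qed
      then show False using that by (auto simp: mem_box_cart)
    qed
    ultimately show ?thesis using \<phi>0 R(2)[of x "[i]"] p1 by simp
  qed
  define A where "A = (\<lambda>n. LINT x|lborel. (u (x + t n *\<^sub>R e) - u x) * (1 / t n) * \<phi> x)"
  have A1: "A \<longlonglongrightarrow> (LINT x|lborel. v x * \<phi> x)"
    unfolding A_def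
  proof (rule integral_dominated_convergence[where w="\<lambda>x. L * \<bar>\<phi> x\<bar>"])
    show "integrable lborel (\<lambda>x. L * \<bar>\<phi> x\<bar>)"
      using M \<phi>0 by (intro integrable_mult_right integrable_abs integrable_bounded_cbox[where K=M]) auto
    show "AE x in lborel. (\<lambda>n. (u (x + t n *\<^sub>R e) - u x) * (1 / t n) * \<phi> x) \<longlonglongrightarrow> v x * \<phi> x"
      using lim
    proof eventually_elim
      case (elim x)
      then have "(\<lambda>n. (u (x + t n *\<^sub>R e) - u x) * (1 / t n)) \<longlonglongrightarrow> v x" by (simp add: e_def t_def)
      then show ?case by (intro tendsto_mult tendsto_const)
    qed
    show "AE x in lborel. norm ((u (x + t n *\<^sub>R e) - u x) * (1 / t n) * \<phi> x) \<le> L * \<bar>\<phi> x\<bar>" for n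
    proof (rule AE_I2)
      fix x
      have "\<bar>u (x + t n *\<^sub>R e) - u x\<bar> * (1 / t n) \<le> L"
        using L[of x "t n"] t(1)[of n] by (simp add: e_def field_simps)
      then have "\<bar>u (x + t n *\<^sub>R e) - u x\<bar> * (1 / t n) * \<bar>\<phi> x\<bar> \<le> L * \<bar>\<phi> x\<bar>"
        by (rule mult_right_mono) simp
      then show "norm ((u (x + t n *\<^sub>R e) - u x) * (1 / t n) * \<phi> x) \<le> L * \<bar>\<phi> x\<bar>"
        using t(1)[of n] by (simp add: abs_mult)
    qed
  qed measurable
  have int: "integrable lborel (\<lambda>x. u (x + s *\<^sub>R e) * \<phi> x)" "integrable lborel (\<lambda>x. u x * \<phi> (x - t n *\<^sub>R e))" for s n
  proof -
    show "integrable lborel (\<lambda>x. u (x + s *\<^sub>R e) * \<phi> x)"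
      by (rule integrable_bounded_cbox[where K="K * M"])
        (use K M \<phi>0 K0 in \<open>auto simp: abs_mult intro!: mult_mono\<close>)
    show "integrable lborel (\<lambda>x. u x * \<phi> (x - t n *\<^sub>R e))"
      by (rule integrable_bounded_cbox[where K="K * M" and a="\<chi> i. - (R + 1)" and b="\<chi> i. R + 1"])
        (use K M out K0 in \<open>auto simp: abs_mult intro!: mult_mono\<close>)
  qed
  have Aeq: "A n = (LINT x|lborel. u x * ((\<phi> (x - t n *\<^sub>R e) - \<phi> x) * (1 / t n)))" for n
  proof -
    have "A n = (LINT x|lborel. (1 / t n) * (u (x + t n *\<^sub>R e) * \<phi> x - u (x + 0 *\<^sub>R e) * \<phi> x))"
      unfolding A_def by (intro Bochner_Integration.integral_cong) (auto simp: algebra_simps)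
    also have "\<dots> = (1 / t n) * ((LINT x|lborel. u (x + t n *\<^sub>R e) * \<phi> x) - (LINT x|lborel. u (x + 0 *\<^sub>R e) * \<phi> x))"
      by (subst integral_mult_right_zero, subst Bochner_Integration.integral_diff[OF int(1) int(1)]) simp
    also have "(LINT x|lborel. u (x + t n *\<^sub>R e) * \<phi> x) = (LINT x|lborel. u x * \<phi> (x - t n *\<^sub>R e))"
      using lebesgue_integral_lborel_translate[of "\<lambda>x. u x * \<phi> (x - t n *\<^sub>R e)" "t n *\<^sub>R e"] by simp
    also have "(1 / t n) * ((LINT x|lborel. u x * \<phi> (x - t n *\<^sub>R e)) - (LINT x|lborel. u (x + 0 *\<^sub>R e) * \<phi> x))
        = (LINT x|lborel. (1 / t n) * (u x * \<phi> (x - t n *\<^sub>R e) - u (x + 0 *\<^sub>R e) * \<phi> x))"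
      by (subst integral_mult_right_zero, subst Bochner_Integration.integral_diff[OF int(2) int(1)]) simp
    also have "\<dots> = (LINT x|lborel. u x * ((\<phi> (x - t n *\<^sub>R e) - \<phi> x) * (1 / t n)))"
      by (intro Bochner_Integration.integral_cong) (auto simp: algebra_simps)
    finally show ?thesis .
  qed
  have A2: "A \<longlonglongrightarrow> (LINT x|lborel. u x * - partial i \<phi> x)"
    unfolding Aeq[abs_def]
  proof (rule integral_dominated_convergence[where w="\<lambda>x. K * M' * indicator (sym_cube (R + 1)) x"])
    show "integrable lborel (\<lambda>x. K * M' * indicator (sym_cube (R + 1)) x :: real)"
      by (intro integrable_mult_right integrable_indicator_cbox)
    show "AE x in lborel. (\<lambda>n. u x * ((\<phi> (x - t n *\<^sub>R e) - \<phi> x) * (1 / t n))) \<longlonglongrightarrow> u x * - partial i \<phi> x"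
    proof (intro AE_I2 tendsto_mult tendsto_const)
      fix x
      have "((\<lambda>s. (\<phi> (x + s *\<^sub>R e) - \<phi> x) / s) \<longlongrightarrow> partial i \<phi> x) (at 0)"
        using D[of x 0] by (simp add: DERIV_def)
      moreover have "filterlim (\<lambda>n. - t n) (at 0) sequentially"
        using t(1) tendsto_minus[OF t0] by (auto simp: filterlim_at less_imp_neq[symmetric] intro!: always_eventually)
      ultimately have "(\<lambda>n. (\<phi> (x + (- t n) *\<^sub>R e) - \<phi> x) / (- t n)) \<longlonglongrightarrow> partial i \<phi> x"
        by (rule filterlim_compose)
      then have "(\<lambda>n. - ((\<phi> (x + (- t n) *\<^sub>R e) - \<phi> x) / (- t n))) \<longlonglongrightarrow> - partial i \<phi> x"
        by (rule tendsto_minus)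
      then show "(\<lambda>n. (\<phi> (x - t n *\<^sub>R e) - \<phi> x) * (1 / t n)) \<longlonglongrightarrow> - partial i \<phi> x"
        by simp
    qed
    show "AE x in lborel. norm (u x * ((\<phi> (x - t n *\<^sub>R e) - \<phi> x) * (1 / t n))) \<le> K * M' * indicator (sym_cube (R + 1)) x" for n
    proof (rule AE_I2)
      fix x
      show "norm (u x * ((\<phi> (x - t n *\<^sub>R e) - \<phi> x) * (1 / t n))) \<le> K * M' * indicator (sym_cube (R + 1)) x"
      proof (cases "x \<in> sym_cube (R + 1)")
        case True
        have "\<bar>(\<phi> (x - t n *\<^sub>R e) - \<phi> x) * (1 / t n)\<bar> \<le> M'"
          using lip[of x n] t(1)[of n] by (simp add: abs_mult field_simps)
        then have "\<bar>u x\<bar> * \<bar>(\<phi> (x - t n *\<^sub>R e) - \<phi> x) * (1 / t n)\<bar> \<le> K * M'"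
          using K K0 by (intro mult_mono) auto
        then show ?thesis using True by (simp add: abs_mult)
      qed (use out[of x n] in simp)
    qed
  qed measurable
  have "(LINT x|lborel. v x * \<phi> x) = (LINT x|lborel. u x * - partial i \<phi> x)"
    by (rule LIMSEQ_unique[OF A1 A2])
  then show ?thesis by simp
qed

section \<open>The product of signs as a fundamental solution of the mixed derivative\<close>

lemma integral_sgn_deriv:
  fixes \<psi> \<psi>' :: "real \<Rightarrow> real"
  assumes D: "\<And>t. (\<psi> has_real_derivative \<psi>' t) (at t)" and c: "continuous_on UNIV \<psi>'"
    and R: "R > 0" and 0: "\<psi> R = 0" "\<psi> (- R) = 0" "\<And>t. \<bar>t\<bar> > R \<Longrightarrow> \<psi>' t = 0"
  shows "(LINT t|lborel. sgn t * \<psi>' t) = - 2 * \<psi> 0"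
proof -
  have FTC: "has_bochner_integral lborel (\<lambda>t. indicator {a..b} t *\<^sub>R \<psi>' t) (\<psi> b - \<psi> a)" if "a \<le> b" for a b
    using D c that by (intro has_bochner_integral_FTC_Icc)
      (auto simp: has_real_derivative_iff_has_vector_derivative[symmetric] intro: has_field_derivative_at_within continuous_on_subset)
  \<comment> \<open>The fundamental theorem on each half-line; because of the opposite signs the two
    contributions at 0 add up to -2 \<psi>(0).\<close>
  note 1 = FTC[of 0 R] and 2 = FTC[of "- R" 0]
  have [measurable]: "\<psi>' \<in> borel_measurable borel" using c by (rule borel_measurable_continuous_onI)
  have "(LINT t|lborel. sgn t * \<psi>' t) = (LINT t|lborel. indicator {0..R} t *\<^sub>R \<psi>' t - indicator {- R..0} t *\<^sub>R \<psi>' t)"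
  proof (rule integral_cong_AE)
    have "AE t in lborel. t \<noteq> (0::real)" by (rule AE_lborel_singleton)
    then show "AE t in lborel. sgn t * \<psi>' t = indicator {0..R} t *\<^sub>R \<psi>' t - indicator {- R..0} t *\<^sub>R \<psi>' t"
      by eventually_elim (use 0(3) in \<open>auto simp: indicator_def sgn_if\<close>)
  qed measurable
  also have "\<dots> = (\<psi> R - \<psi> 0) - (\<psi> 0 - \<psi> (- R))"
    using has_bochner_integral_diff[OF 1 2] R by (simp add: has_bochner_integral_iff)
  finally show ?thesis using 0 by simp
qed

lemma measurable_Cart_lambda_PiM:
  "(\<lambda>s. \<chi> i. (s i :: real)) \<in> borel_measurable (\<Pi>\<^sub>M i\<in>(UNIV :: 'n::finite set). lborel)"
proof (subst borel_measurable_euclidean_space, intro ballI)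
  fix b :: "real ^ 'n" assume "b \<in> Basis"
  then obtain i where "b = axis i 1" by (auto simp: Basis_vec_def)
  then show "(\<lambda>s. (\<chi> i. s i) \<bullet> b) \<in> borel_measurable (\<Pi>\<^sub>M i\<in>(UNIV :: 'n set). lborel)"
    by (simp add: inner_axis)
qed

text \<open>Identifies vectors with families of coordinates, so that
  \<open>product_integral_insert\<close> can split off a single coordinate.\<close>

lemma lborel_cart: "(lborel :: (real ^ 'n) measure) = distr (\<Pi>\<^sub>M i\<in>UNIV. lborel) borel (\<lambda>s. \<chi> i. s i)"
proof (rule lborel_eqI)
  interpret product_sigma_finite "\<lambda>_ :: 'n. lborel :: real measure" ..
  note m = measurable_Cart_lambda_PiM
  fix l u :: "real ^ 'n" assume le: "\<And>b. b \<in> Basis \<Longrightarrow> l \<bullet> b \<le> u \<bullet> b"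
  have le': "l $ i \<le> u $ i" for i using le[of "axis i 1"] by (simp add: inner_axis)
  have "emeasure (distr (\<Pi>\<^sub>M i\<in>UNIV. lborel) borel (\<lambda>s. \<chi> i. s i)) (box l u)
    = emeasure (\<Pi>\<^sub>M i\<in>(UNIV :: 'n set). lborel) (\<Pi>\<^sub>E i\<in>UNIV. {l $ i<..<u $ i})"
    by (subst emeasure_distr[OF m]) (auto simp: space_PiM mem_box_cart PiE_iff intro!: arg_cong[where f="emeasure _"])
  also have "\<dots> = (\<Prod>i\<in>UNIV. emeasure lborel {l $ i<..<u $ i})"
    by (rule emeasure_PiM) auto
  also have "\<dots> = (\<Prod>i\<in>UNIV. ennreal (u $ i - l $ i))" using le' by simp
  also have "\<dots> = ennreal (\<Prod>i\<in>UNIV. u $ i - l $ i)" using le' by (subst prod_ennreal) auto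
  also have "(\<Prod>i\<in>UNIV. u $ i - l $ i) = (\<Prod>b\<in>Basis. (u - l) \<bullet> b)"
    unfolding prod_Basis_cart by (simp add: inner_axis)
  finally show "emeasure (distr (\<Pi>\<^sub>M i\<in>UNIV. lborel) borel (\<lambda>s. \<chi> i. s i)) (box l u) = ennreal (\<Prod>b\<in>Basis. (u - l) \<bullet> b)" .
qed simp

text \<open>Induction over the list: its head is the outermost derivative, and integrating against
  the sign of that variable gives -2 times the remaining expression. Coordinates outside the list
  stay frozen at those of \<open>y\<close>.\<close>

lemma integral_PiM_sgn_partials:
  fixes \<phi> :: "real ^ 'n \<Rightarrow> real"
  assumes smooth: "smooth \<phi>" and R: "R > 0" "\<And>is x. x \<notin> sym_cube R \<Longrightarrow> partials is \<phi> x = 0"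
    and bd: "\<And>is. \<exists>K\<ge>0. \<forall>x. \<bar>partials is \<phi> x\<bar> \<le> K" and "distinct is"
  shows "(LINT s|(\<Pi>\<^sub>M i\<in>set is. lborel). (\<Prod>i\<in>set is. sgn (s i)) * partials is \<phi> (y + (\<Sum>i\<in>set is. s i *\<^sub>R axis i 1)))
    = (- 2) ^ length is * \<phi> y"
  using \<open>distinct is\<close>
proof (induction "is")
  case Nil
  interpret product_sigma_finite "\<lambda>_ :: 'n. lborel :: real measure" ..
  show ?case by (simp add: PiM_empty lebesgue_integral_count_space_finite partials_def)
next
  case (Cons i "is")
  interpret product_sigma_finite "\<lambda>_ :: 'n. lborel :: real measure" ..
  let ?I = "set is" and ?\<psi> = "partials is \<phi>"
  have i: "i \<notin> ?I" "distinct is" using Cons.prems by auto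
  have sm: "smooth ?\<psi>" by (rule smooth_partials[OF smooth])
  have p: "partials (i # is) \<phi> = partial i ?\<psi>" by (simp add: partials_def)
  define f where "f = (\<lambda>s. (\<Prod>j\<in>insert i ?I. sgn (s j)) * partial i ?\<psi> (y + (\<Sum>j\<in>insert i ?I. s j *\<^sub>R axis j 1)))"
  obtain K where K: "0 \<le> K" "\<And>x. \<bar>partial i ?\<psi> x\<bar> \<le> K" using bd[of "i # is"] p by auto
  \<comment> \<open>If a displacement exceeds R + |y| in some coordinate, the argument has left the
    support cube.\<close>
  define R' where "R' = R + norm y"
  have R': "R' > 0" using R by (simp add: R'_def add_pos_nonneg)
  have comp: "(y + (\<Sum>j\<in>J. s j *\<^sub>R axis j 1)) $ k = y $ k + (if k \<in> J then s k else 0)" if "finite J" for J s k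
  proof -
    have "(\<Sum>j\<in>J. s j *\<^sub>R axis j (1::real)) $ k = (\<Sum>j\<in>J. if k = j then s j else 0)"
      unfolding sum_component by (intro sum.cong refl) (auto simp: axis_def)
    then show ?thesis using that by (simp add: sum.delta)
  qed
  have far: "y + (\<Sum>j\<in>J. s j *\<^sub>R axis j 1) \<notin> sym_cube R" if "finite J" "k \<in> J" "\<bar>s k\<bar> > R'" for J s k
  proof
    assume "y + (\<Sum>j\<in>J. s j *\<^sub>R axis j 1) \<in> sym_cube R"
    then have "(\<chi> i. - R) $ k \<le> (y + (\<Sum>j\<in>J. s j *\<^sub>R axis j 1)) $ k \<and> (y + (\<Sum>j\<in>J. s j *\<^sub>R axis j 1)) $ k \<le> (\<chi> i. R) $ k"
      unfolding mem_box_cart by blast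
    then have "- R \<le> y $ k + s k \<and> y $ k + s k \<le> R"
      unfolding comp[OF that(1)] using that(2) by simp
    then show False using that(3) component_le_norm_cart[of y k] unfolding R'_def by linarith
  qed
  have psi_m[measurable]: "partial i ?\<psi> \<in> borel_measurable borel"
    using smooth_partials_measurable[OF smooth, of "i # is"] p by simp
  have fm[measurable]: "f \<in> borel_measurable (\<Pi>\<^sub>M j\<in>insert i ?I. lborel)"
  proof -
    have c[measurable]: "(\<lambda>s. s j) \<in> borel_measurable (\<Pi>\<^sub>M j\<in>insert i ?I. lborel)" if "j \<in> insert i ?I" for j
      using measurable_component_singleton[OF that, of "\<lambda>_. lborel"] by simp
    have "(\<lambda>s. \<Prod>j\<in>insert i ?I. sgn (s j) :: real) \<in> borel_measurable (\<Pi>\<^sub>M j\<in>insert i ?I. lborel)"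
      by (intro borel_measurable_prod measurable_compose[OF c]) auto
    moreover have "(\<lambda>s. y + (\<Sum>j\<in>insert i ?I. s j *\<^sub>R axis j 1)) \<in> borel_measurable (\<Pi>\<^sub>M j\<in>insert i ?I. lborel)"
      by (intro borel_measurable_add borel_measurable_sum borel_measurable_scaleR c) auto
    ultimately show ?thesis unfolding f_def
      by (intro borel_measurable_times) (auto intro: measurable_compose[OF _ psi_m])
  qed
  have fint: "integrable (\<Pi>\<^sub>M j\<in>insert i ?I. lborel) f"
  proof (rule Bochner_Integration.integrable_bound[OF _ fm])
    let ?B = "\<Pi>\<^sub>E j\<in>insert i ?I. {- R'..R'}"
    have "emeasure (\<Pi>\<^sub>M j\<in>insert i ?I. lborel) ?B = (\<Prod>j\<in>insert i ?I. ennreal (R' - (- R')))"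
      using R' by (subst emeasure_PiM) auto
    also have "\<dots> = ennreal (\<Prod>j\<in>insert i ?I. R' - (- R'))"
      using R' by (subst prod_ennreal) auto
    also have "\<dots> < \<infinity>" unfolding infinity_ennreal_def by (rule ennreal_less_top)
    finally show "integrable (\<Pi>\<^sub>M j\<in>insert i ?I. lborel) (\<lambda>s. K * indicator ?B s :: real)"
      by (intro integrable_mult_right integrable_real_indicator sets_PiM_I_finite) auto
    show "AE s in (\<Pi>\<^sub>M j\<in>insert i ?I. lborel). norm (f s) \<le> norm (K * indicator ?B s :: real)"
    proof (rule AE_I2)
      fix s :: "'n \<Rightarrow> real" assume s: "s \<in> space (\<Pi>\<^sub>M j\<in>insert i ?I. lborel)"
      show "norm (f s) \<le> norm (K * indicator ?B s :: real)"
      proof (cases "s \<in> ?B")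
        case True
        have "\<bar>\<Prod>j\<in>insert i ?I. sgn (s j)\<bar> \<le> 1"
          unfolding abs_prod by (intro prod_le_1) (auto simp: sgn_if)
        then have "\<bar>\<Prod>j\<in>insert i ?I. sgn (s j)\<bar> * \<bar>partial i ?\<psi> (y + (\<Sum>j\<in>insert i ?I. s j *\<^sub>R axis j 1))\<bar> \<le> 1 * K"
          using K by (intro mult_mono) auto
        then show ?thesis using True K unfolding f_def by (simp add: abs_mult)
      next
        case False
        then obtain k where "k \<in> insert i ?I" "s k \<notin> {- R'..R'}" using s by (auto simp: space_PiM PiE_iff)
        then have "y + (\<Sum>j\<in>insert i ?I. s j *\<^sub>R axis j 1) \<notin> sym_cube R"
          by (intro far[of _ k]) (auto simp: abs_if)
        then have "f s = 0" unfolding f_def using R(2)[of _ "i # is"] p by simp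
        then show ?thesis by simp
      qed
    qed
  qed
  have inner: "(LINT t|lborel. f (s(i := t))) = (- 2) * ((\<Prod>j\<in>?I. sgn (s j)) * ?\<psi> (y + (\<Sum>j\<in>?I. s j *\<^sub>R axis j 1)))" for s
  proof -
    let ?z = "y + (\<Sum>j\<in>?I. s j *\<^sub>R axis j 1)"
    have eq: "f (s(i := t)) = (\<Prod>j\<in>?I. sgn (s j)) * (sgn t * partial i ?\<psi> (?z + t *\<^sub>R axis i 1))" for t
    proof -
      have "(\<Prod>j\<in>?I. sgn ((s(i := t)) j)) = (\<Prod>j\<in>?I. sgn (s j))"
        "(\<Sum>j\<in>?I. (s(i := t)) j *\<^sub>R axis j 1) = (\<Sum>j\<in>?I. s j *\<^sub>R axis j (1::real))"
        using i(1) by (auto intro!: prod.cong sum.cong)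
      then show ?thesis unfolding f_def using i(1) by (simp add: add_ac mult_ac)
    qed
    have far': "?z + t *\<^sub>R axis i 1 \<notin> sym_cube R" if "\<bar>t\<bar> > R'" for t
    proof -
      have "y + (\<Sum>j\<in>insert i ?I. (s(i := t)) j *\<^sub>R axis j 1) \<notin> sym_cube R"
        using that by (intro far[of _ i]) auto
      moreover have "(\<Sum>j\<in>?I. (s(i := t)) j *\<^sub>R axis j 1) = (\<Sum>j\<in>?I. s j *\<^sub>R axis j (1::real))"
        using i(1) by (auto intro!: sum.cong)
      ultimately show ?thesis using i(1) by (simp add: add_ac)
    qed
    \<comment> \<open>The radius is R' + 1 because the endpoints themselves must lie strictly beyond
      R'.\<close>
    have "(LINT t|lborel. sgn t * partial i ?\<psi> (?z + t *\<^sub>R axis i 1)) = - 2 * ?\<psi> (?z + 0 *\<^sub>R axis i 1)"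
    proof (rule integral_sgn_deriv[where R="R' + 1"])
      show "((\<lambda>t. ?\<psi> (?z + t *\<^sub>R axis i 1)) has_real_derivative partial i ?\<psi> (?z + t *\<^sub>R axis i 1)) (at t)" for t
        by (rule smooth_has_derivative[OF sm])
      have "continuous_on UNIV (partial i ?\<psi>)"
        using smooth_partials_continuous[OF smooth, of UNIV "i # is"] p by simp
      then show "continuous_on UNIV (\<lambda>t. partial i ?\<psi> (?z + t *\<^sub>R axis i 1))"
        by (rule continuous_on_compose2) (auto intro!: continuous_intros)
    next
      fix t assume "\<bar>t\<bar> > R' + 1"
      then show "partial i ?\<psi> (?z + t *\<^sub>R axis i 1) = 0"
        using R(2)[OF far'[of t], of "i # is"] p by simp
    qed (use R(2)[OF far'] R' in auto)
    then show ?thesis unfolding eq by simp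
  qed
  have "(LINT s|(\<Pi>\<^sub>M j\<in>insert i ?I. lborel). f s) = (LINT s|(\<Pi>\<^sub>M j\<in>?I. lborel). (LINT t|lborel. f (s(i := t))))"
    by (rule product_integral_insert[OF _ i(1) fint]) simp
  also have "\<dots> = (- 2) * ((- 2) ^ length is * \<phi> y)"
    unfolding inner using Cons.IH[OF i(2)] by simp
  finally show ?case by (simp add: f_def p)
qed

lemma integral_sgn_mixed_partial:
  fixes \<phi> :: "real ^ 'n::{finite,linorder} \<Rightarrow> real"
  assumes "test_function C \<phi>"
  shows "(LINT x|lborel. (\<Prod>i\<in>UNIV. sgn (x $ i)) * partials (sorted_list_of_set UNIV) \<phi> (x + y)) = (- 2) ^ CARD('n) * \<phi> y"
proof -
  have sm: "smooth \<phi>" using assms by (simp add: test_function_def)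
  obtain R where R: "R > 0" "\<And>is x. x \<notin> sym_cube R \<Longrightarrow> partials is \<phi> x = 0"
    and bd: "\<And>is. \<exists>K\<ge>0. \<forall>x. \<bar>partials is \<phi> x\<bar> \<le> K"
    using test_function_sym_cube[OF assms] by metis
  let ?is = "sorted_list_of_set (UNIV :: 'n::{finite,linorder} set)"
  have [measurable]: "partials ?is \<phi> \<in> borel_measurable borel" by (rule smooth_partials_measurable[OF sm])
  have sgn_m[measurable]: "(\<lambda>x :: real ^ 'n::{finite,linorder}. \<Prod>i\<in>UNIV. sgn (x $ i)) \<in> borel_measurable borel"
    by (intro borel_measurable_prod measurable_compose[OF _ borel_measurable_sgn]
        borel_measurable_continuous_onI continuous_intros)
  have "(LINT x|lborel. (\<Prod>i\<in>UNIV. sgn (x $ i)) * partials ?is \<phi> (x + y))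
    = (LINT s|(\<Pi>\<^sub>M i\<in>UNIV. lborel). (\<Prod>i\<in>UNIV. sgn (s i)) * partials ?is \<phi> ((\<chi> i. s i) + y))"
    by (subst lborel_cart, subst integral_distr[OF measurable_Cart_lambda_PiM]) auto
  also have "\<dots> = (LINT s|(\<Pi>\<^sub>M i\<in>set ?is. lborel). (\<Prod>i\<in>set ?is. sgn (s i)) * partials ?is \<phi> (y + (\<Sum>i\<in>set ?is. s i *\<^sub>R axis i 1)))"
  proof -
    have "(\<chi> i. s i) = (\<Sum>i\<in>UNIV. s i *\<^sub>R axis i (1::real))" for s :: "'n::{finite,linorder} \<Rightarrow> real"
      by (simp add: vec_eq_iff axis_def if_distrib cong: if_cong)
    then show ?thesis by (simp add: add.commute)
  qed
  also have "\<dots> = (- 2) ^ length ?is * \<phi> y"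
    by (rule integral_PiM_sgn_partials[OF sm R(1) _ bd]) (use R(2) in auto)
  finally show ?thesis by simp
qed

section \<open>The extremal function\<close>

lemma kern_pos: "0 < d \<Longrightarrow> 0 < r \<Longrightarrow> r < h \<Longrightarrow> 0 < kern d h r"
  by (auto simp: kern_def intro!: divide_pos_pos mult_pos_pos one_less_power)

text \<open>Up to the factor 2^(d-m), the kernel integrated over the points at distance r is the
  volume of the part of the box beyond r: a radial drop at r affects the average through all these
  points.\<close>

lemma kern_mult_power:
  assumes "0 < d" "0 < r"
  shows "real d * r ^ (d - 1) * kern d h r = h ^ d - r ^ d"
proof -
  obtain k where k: "d = Suc k" using assms(1) gr0_implies_Suc by blast
  have "real d * r ^ (d - 1) * kern d h r = (r ^ (d - 1) * r) * ((h / r) ^ d - 1)"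
    using assms by (simp add: kern_def)
  also have "r ^ (d - 1) * r = r ^ d" by (simp add: k)
  also have "r ^ d * ((h / r) ^ d - 1) = h ^ d - r ^ d"
    using assms by (simp add: power_divide right_diff_distrib)
  finally show ?thesis .
qed

text \<open>One factor h/r cancels against r: kern = (h (h/r)^(d-1) - r) / d, where the first term
  is nonincreasing and the second one is subtracted.\<close>

lemma kern_antimono:
  assumes "0 < d" "0 < r" "r \<le> s" "0 \<le> h"
  shows "kern d h s \<le> kern d h r"
proof -
  obtain k where k: "d = Suc k" using assms(1) gr0_implies_Suc by blast
  have eq: "kern d h t = (h * (h / t) ^ k - t) / real d" if "t > 0" for t
    using that by (simp add: kern_def k right_diff_distrib)
  have "h * (h / s) ^ k \<le> h * (h / r) ^ k"
    using assms by (intro mult_left_mono power_mono divide_left_mono) auto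
  then show ?thesis using assms by (simp add: eq divide_right_mono)
qed

text \<open>The parameter \<open>idx\<close> pins down the index type, hence the dimension, which
  \<open>m\<close>, \<open>p\<close> and \<open>h\<close> do not mention.\<close>

locale extremal =
  fixes m :: nat and p :: ereal and h :: real and idx :: "'n::{finite,linorder} itself"
  assumes m: "m \<le> CARD('n)" and p: "ereal (real CARD('n)) < p" and h: "0 < h"
begin

definition d :: nat where "d = CARD('n)"
definition q :: real where "q = conj_exp p"
definition V :: real where "V = 2 ^ (d - m)"

lemma d_pos: "0 < d" by (simp add: d_def)
lemma V_pos: "0 < V" by (simp add: V_def)

lemma q_props: "1 \<le> q" "q * (real d - 1) < real d" "1 < p" "1 / q = 1 - recip p"
  using conj_exp_props[of d p] p d_pos by (auto simp: q_def d_def)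

definition J :: "nat \<Rightarrow> real" where
  "J k = 2 ^ (d - k) * h ^ d * (h / real d) powr q * Beta (1 - (real d - 1) * q / real d) (q + 1)"

lemma J_pos: "0 < J k"
proof -
  have "0 < 1 - (real d - 1) * q / real d"
    using conj_exp_props(3)[of d p] p d_pos by (simp add: q_def d_def)
  then have "0 < Beta (1 - (real d - 1) * q / real d) (q + 1)"
    using q_props by (intro Beta_real_pos) auto
  then show ?thesis using h d_pos by (simp add: J_def)
qed

lemma nn_integral_kern_corner_box:
  assumes "k \<le> CARD('n)"
  shows "(\<integral>\<^sup>+z. indicator (corner_box k h) z * ennreal (kern d h (infnorm z) powr q) \<partial>(lborel :: (real ^ 'n::{finite,linorder}) measure)) = ennreal (J k)"
  unfolding J_def d_def by (rule nn_integral_kern_powr[OF assms h]) (use q_props in \<open>auto simp: d_def\<close>)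

text \<open>Size of the gradient in the equality case of Hoelder's inequality: its p-th power must
  be proportional to kern^q, and q/p = q - 1. For p = \<infinity> it is 1 on (0, h).\<close>

definition wgt :: "real \<Rightarrow> real" where
  "wgt r = (if 0 < r \<and> r < h then kern d h r powr (q - 1) else 0)"

lemma wgt_nonneg: "0 \<le> wgt r" by (simp add: wgt_def)

lemma wgt_measurable [measurable]: "wgt \<in> borel_measurable borel"
  unfolding wgt_def[abs_def] by measurable

lemma wgt_kern: "0 < r \<Longrightarrow> r < h \<Longrightarrow> real d * r ^ (d - 1) * kern d h r powr q = wgt r * (h ^ d - r ^ d)"
proof -
  assume r: "0 < r" "r < h"
  then have "kern d h r powr q = kern d h r powr (q - 1) * kern d h r"
    using kern_pos[of d r h] d_pos powr_add[of "kern d h r" "q - 1" 1] by simp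
  then have "real d * r ^ (d - 1) * kern d h r powr q = wgt r * (real d * r ^ (d - 1) * kern d h r)"
    using r by (simp add: wgt_def)
  then show ?thesis using kern_mult_power[of d r h] d_pos r by simp
qed

lemma nn_integral_radial:
  assumes "k \<le> CARD('n)" "u \<in> borel_measurable borel"
  shows "(\<integral>\<^sup>+y. indicator (corner_box k h) y * u (infnorm y) \<partial>(lborel :: (real ^ 'n::{finite,linorder}) measure))
    = (\<integral>\<^sup>+r. ennreal (2 ^ (d - k) * real d * r ^ (d - 1)) * indicator {0..h} r * u r \<partial>lborel)"
  unfolding d_def by (rule nn_integral_corner_box_radial) (use assms h in auto)

lemma J_eq_wgt: "ennreal (J m) = (\<integral>\<^sup>+r. ennreal (V * (h ^ d - r ^ d) * wgt r) \<partial>lborel)"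
proof -
  have "ennreal (J m) = (\<integral>\<^sup>+r. ennreal (V * real d * r ^ (d - 1)) * indicator {0..h} r * ennreal (kern d h r powr q) \<partial>lborel)"
    unfolding nn_integral_kern_corner_box[OF m, symmetric] V_def
    by (rule nn_integral_radial[OF m]) measurable
  also have "\<dots> = (\<integral>\<^sup>+r. ennreal (V * (h ^ d - r ^ d) * wgt r) \<partial>lborel)"
  proof (rule nn_integral_cong_AE)
    have "AE r in lborel. r \<noteq> 0 \<and> r \<noteq> h" by (intro AE_conjI AE_lborel_singleton)
    then show "AE r in lborel. ennreal (V * real d * r ^ (d - 1)) * indicator {0..h} r * ennreal (kern d h r powr q)
      = ennreal (V * (h ^ d - r ^ d) * wgt r)"
    proof eventually_elim
      case (elim r)
      show ?case
      proof (cases "0 < r \<and> r < h")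
        case True
        then have "ennreal (V * real d * r ^ (d - 1)) * ennreal (kern d h r powr q) = ennreal (V * (real d * r ^ (d - 1) * kern d h r powr q))"
          using V_pos by (simp add: ennreal_mult[symmetric] mult.assoc)
        also have "V * (real d * r ^ (d - 1) * kern d h r powr q) = V * (h ^ d - r ^ d) * wgt r"
          using True by (subst wgt_kern) (simp_all only: mult_ac)
        finally show ?thesis using True by simp
      next
        case False
        then show ?thesis using elim by (auto simp: wgt_def)
      qed
    qed
  qed
  finally show ?thesis .
qed

text \<open>Where r^d <= h^d / 2, the factor h^d - r^d in the finite integral \<open>J m\<close> is
  at least h^d / 2; where r^d is larger, kern is at most h. So \<open>J m\<close> controls the
  possible singularity at 0.\<close>

lemma wgt_integrable: "integrable lborel wgt"
proof (rule integrableI_nonneg)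
  have le: "ennreal (wgt r) \<le> ennreal (2 / (V * h ^ d)) * ennreal (V * (h ^ d - r ^ d) * wgt r) + ennreal (h powr (q - 1)) * indicator {0..h} r" for r
  proof (cases "0 < r \<and> r < h")
    case True
    then have pw: "r ^ d \<le> h ^ d" by (intro power_mono) auto
    show ?thesis
    proof (cases "r ^ d \<le> h ^ d / 2")
      case True
      have "wgt r = 2 / (V * h ^ d) * (V * (h ^ d / 2) * wgt r)" using h V_pos by simp
      also have "\<dots> \<le> 2 / (V * h ^ d) * (V * (h ^ d - r ^ d) * wgt r)"
        using True h V_pos wgt_nonneg by (intro mult_left_mono mult_right_mono) auto
      finally have "ennreal (wgt r) \<le> ennreal (2 / (V * h ^ d)) * ennreal (V * (h ^ d - r ^ d) * wgt r)"
        using h V_pos pw wgt_nonneg by (simp add: ennreal_mult[symmetric] ennreal_leI)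
      then show ?thesis by (metis add_increasing2 zero_le)
    next
      case F: False
      have "(h / r) ^ d \<le> 2" using F True h by (simp add: power_divide field_simps)
      then have "kern d h r \<le> r * (2 - 1) / real d"
        unfolding kern_def using True by (intro divide_right_mono mult_left_mono) auto
      also have "\<dots> \<le> r" using True d_pos by (simp add: field_simps)
      also have "\<dots> \<le> h" using True by simp
      finally have "kern d h r powr (q - 1) \<le> h powr (q - 1)"
        using kern_pos[of d r h] True d_pos q_props(1) by (intro powr_mono2) auto
      then have "ennreal (wgt r) \<le> ennreal (h powr (q - 1)) * indicator {0..h} r"
        using True by (simp add: wgt_def ennreal_leI)
      then show ?thesis by (metis add_increasing zero_le)
    qed
  qed (auto simp: wgt_def)
  have "(\<integral>\<^sup>+r. ennreal (wgt r) \<partial>lborel) \<le> (\<integral>\<^sup>+r. ennreal (2 / (V * h ^ d)) * ennreal (V * (h ^ d - r ^ d) * wgt r) + ennreal (h powr (q - 1)) * indicator {0..h} r \<partial>lborel)"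
    by (intro nn_integral_mono le)
  also have "\<dots> = ennreal (2 / (V * h ^ d)) * ennreal (J m) + ennreal (h powr (q - 1)) * emeasure lborel {0..h}"
    unfolding J_eq_wgt by (subst nn_integral_add) (auto simp: nn_integral_cmult)
  also have "\<dots> < \<infinity>" using h by (simp add: ennreal_mult_less_top)
  finally show "(\<integral>\<^sup>+r. ennreal (wgt r) \<partial>lborel) < \<infinity>" .
qed (auto simp: wgt_nonneg)

text \<open>The antiderivative of -\<open>wgt\<close> that vanishes from h on. As an integral over
  the line it is finite at 0 by integrability of \<open>wgt\<close>.\<close>

definition prof :: "real \<Rightarrow> real" where
  "prof r = (LINT s|lborel. (if r < s then wgt s else 0))"

lemma prof_integrable: "integrable lborel (\<lambda>s. if r < s then wgt s else 0)"
  by (rule Bochner_Integration.integrable_bound[OF wgt_integrable]) (auto simp: wgt_nonneg)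

lemma prof_measurable [measurable]: "prof \<in> borel_measurable borel"
  unfolding prof_def[abs_def] by measurable

lemma prof_nonneg: "0 \<le> prof r"
  unfolding prof_def by (intro integral_nonneg_AE AE_I2) (simp add: wgt_nonneg)

lemma prof_0: "prof 0 = (LINT s|lborel. wgt s)"
  unfolding prof_def by (intro Bochner_Integration.integral_cong) (auto simp: wgt_def)

lemma prof_antimono: "r \<le> s \<Longrightarrow> prof s \<le> prof r"
  unfolding prof_def by (intro integral_mono prof_integrable) (auto simp: wgt_nonneg)

lemma prof_eq_0: "h \<le> r \<Longrightarrow> prof r = 0"
  unfolding prof_def by (intro integral_eq_zero_AE AE_I2) (auto simp: wgt_def)

lemma prof_pos: "0 < prof 0"
proof -
  have "prof 0 \<noteq> 0"
  proof
    assume "prof 0 = 0"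
    then have "AE s in lborel. wgt s = 0"
      using integral_nonneg_eq_0_iff_AE[OF wgt_integrable] wgt_nonneg by (simp add: prof_0)
    then have "AE s in lborel. s \<notin> {0<..<h}"
      by eventually_elim (use kern_pos[of d _ h] d_pos in \<open>force simp: wgt_def\<close>)
    then have "emeasure lborel {0<..<h} = 0"
      by (subst (asm) AE_iff_measurable[of "{0<..<h}"]) auto
    then show False using h by simp
  qed
  then show ?thesis using prof_nonneg[of 0] by simp
qed

lemma prof_diff:
  assumes "r \<le> s"
  shows "prof r - prof s = (LINT t|lborel. indicator {r<..s} t * wgt t)"
proof -
  have "prof r - prof s = (LINT t|lborel. (if r < t then wgt t else 0) - (if s < t then wgt t else 0))"
    unfolding prof_def by (rule Bochner_Integration.integral_diff[OF prof_integrable prof_integrable, symmetric])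
  also have "\<dots> = (LINT t|lborel. indicator {r<..s} t * wgt t)"
    using assms by (intro Bochner_Integration.integral_cong) (auto simp: indicator_def)
  finally show ?thesis .
qed

text \<open>Since kern decreases, the slope beyond \<epsilon> is at most kern at \<epsilon> to the
  power q - 1.\<close>

lemma prof_Lipschitz:
  assumes "0 < \<epsilon>" "\<epsilon> < h" "\<epsilon> \<le> r" "\<epsilon> \<le> s"
  shows "\<bar>prof r - prof s\<bar> \<le> kern d h \<epsilon> powr (q - 1) * \<bar>r - s\<bar>"
proof -
  have *: "prof r - prof s \<le> kern d h \<epsilon> powr (q - 1) * (s - r)" if "\<epsilon> \<le> r" "r \<le> s" for r s
  proof -
    have le: "wgt t \<le> kern d h \<epsilon> powr (q - 1)" if "r < t" for t
      using that \<open>\<epsilon> \<le> r\<close> assms kern_antimono[of d \<epsilon> t h] kern_pos[of d t h] d_pos h q_props(1)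
      by (auto simp: wgt_def intro!: powr_mono2)
    have i: "integrable lborel (\<lambda>t. indicator {r<..s} t :: real)"
      using \<open>r \<le> s\<close> by (intro integrable_real_indicator) auto
    have "prof r - prof s \<le> (LINT t|lborel. indicator {r<..s} t * kern d h \<epsilon> powr (q - 1))"
      unfolding prof_diff[OF \<open>r \<le> s\<close>]
    proof (rule integral_mono)
      show "integrable lborel (\<lambda>t. indicator {r<..s} t * wgt t)"
        using integrable_mult_indicator[OF _ wgt_integrable, of "{r<..s}"] by simp
      show "integrable lborel (\<lambda>t. indicator {r<..s} t * kern d h \<epsilon> powr (q - 1))"
        by (intro integrable_mult_left i)
      show "indicator {r<..s} t * wgt t \<le> indicator {r<..s} t * kern d h \<epsilon> powr (q - 1)" for t
        using le[of t] by (auto simp: indicator_def)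
    qed
    also have "\<dots> = kern d h \<epsilon> powr (q - 1) * (s - r)"
      using \<open>r \<le> s\<close> by (simp add: mult.commute)
    finally show ?thesis .
  qed
  show ?thesis
  proof (cases "r \<le> s")
    case True
    then show ?thesis using *[of r s] prof_antimono[of r s] assms by simp
  next
    case False
    then show ?thesis using *[of s r] prof_antimono[of s r] assms by (simp add: abs_minus_commute[of r])
  qed
qed

text \<open>The point h is left out because \<open>wgt\<close> jumps there when p =
  \<infinity>.\<close>

lemma prof_has_derivative:
  assumes "0 < r" "r \<noteq> h"
  shows "(prof has_real_derivative - wgt r) (at r)"
proof (cases "r < h")
  case True
  \<comment> \<open>An interval around r that stays away from 0 and h, so that \<open>wgt\<close> is
    continuous on it.\<close>
  define a b where "a = r / 2" and "b = (r + h) / 2"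
  have ab: "0 < a" "a < r" "r < b" "b < h" using assms True by (auto simp: a_def b_def)
  have wc: "continuous_on {a..b} wgt"
  proof -
    have "continuous_on {a..b} (\<lambda>r. (r * ((h / r) ^ d - 1) / real d) powr (q - 1))"
    proof -
      have "0 < x * ((h / x) ^ d - 1) / real d" if "x \<in> {a..b}" for x
        using kern_pos[of d x h] d_pos that ab by (simp add: kern_def)
      note kp = this
      show ?thesis
        by (intro continuous_intros ballI) (use ab in force, use d_pos in simp, metis kp less_irrefl)
    qed
    also have "?this \<longleftrightarrow> continuous_on {a..b} wgt"
      using ab by (intro continuous_on_cong) (auto simp: wgt_def kern_def)
    finally show ?thesis .
  qed
  have eq: "prof s = prof a - integral {a..s} wgt" if "s \<in> {a..b}" for s
  proof -
    have si: "set_integrable lborel {a..s} wgt"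
      unfolding set_integrable_def by (rule integrable_mult_indicator[OF _ wgt_integrable]) auto
    have "integral {a..s} wgt = (LINT t:{a..s}|lborel. wgt t)"
      by (rule set_borel_integral_eq_integral(2)[OF si, symmetric])
    also have "\<dots> = (LINT t|lborel. indicator {a<..s} t * wgt t)"
      unfolding set_lebesgue_integral_def
    proof (rule integral_cong_AE)
      have "AE t in lborel. t \<noteq> a" by (rule AE_lborel_singleton)
      then show "AE t in lborel. indicator {a..s} t *\<^sub>R wgt t = indicator {a<..s} t * wgt t"
        by eventually_elim (auto simp: indicator_def)
    qed measurable
    finally show ?thesis using prof_diff[of a s] that by simp
  qed
  have "((\<lambda>s. integral {a..s} wgt) has_real_derivative wgt r) (at r within {a..b})"
    by (rule integral_has_real_derivative[OF wc]) (use ab in auto)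
  then have "((\<lambda>s. prof a - integral {a..s} wgt) has_real_derivative 0 - wgt r) (at r within {a..b})"
    by (intro derivative_intros)
  then have "((\<lambda>s. prof a - integral {a..s} wgt) has_real_derivative - wgt r) (at r)"
    using ab by (simp add: at_within_Icc_at)
  then show ?thesis
  proof (rule has_field_derivative_transform_within_open[of _ _ _ "{a<..<b}"])
    fix x assume "x \<in> {a<..<b}"
    then have "x \<in> {a..b}" by simp
    from eq[OF this] show "prof a - integral {a..x} wgt = prof x" by (rule sym)
  qed (use ab in auto)
next
  case False
  then have "h < r" using assms by simp
  have "((\<lambda>_. 0) has_real_derivative - wgt r) (at r)" using \<open>h < r\<close> by (simp add: wgt_def)
  then show ?thesis
    by (rule has_field_derivative_transform_within_open[of _ _ _ "{h<..}"]) (use \<open>h < r\<close> prof_eq_0 in auto)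
qed

text \<open>Integrability of \<open>wgt\<close> is enough: the slope at 0 may be infinite, but the
  mass of \<open>wgt\<close> near 0 tends to 0.\<close>

lemma prof_tendsto_0: "(\<lambda>n. prof (h / (real n + 2))) \<longlonglongrightarrow> prof 0"
  unfolding prof_def
proof (rule integral_dominated_convergence[OF _ _ wgt_integrable])
  show "AE s in lborel. (\<lambda>n. if h / (real n + 2) < s then wgt s else 0) \<longlonglongrightarrow> (if 0 < s then wgt s else 0)"
  proof (rule AE_I2)
    fix s
    show "(\<lambda>n. if h / (real n + 2) < s then wgt s else 0) \<longlonglongrightarrow> (if 0 < s then wgt s else 0)"
    proof (cases "0 < s")
      case True
      have "(\<lambda>n. h / (real n + 2)) \<longlonglongrightarrow> 0" by real_asymp
      then have "eventually (\<lambda>n. h / (real n + 2) < s) sequentially"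
        using True by (rule order_tendstoD)
      then show ?thesis
        using True by (intro tendsto_eventually) (rule eventually_mono, assumption, simp)
    next
      case False
      then have "wgt s = 0" by (simp add: wgt_def)
      then show ?thesis by (simp cong: if_cong)
    qed
  qed
qed (auto simp: wgt_nonneg)

end

section \<open>Criteria for local integrability and weak derivatives\<close>

lemma locally_integrable_borel:
  assumes "\<And>K. compact K \<Longrightarrow> K \<subseteq> C \<Longrightarrow> integrable lborel (\<lambda>x. indicator K x * u x)" 
  shows "locally_integrable C u"
  unfolding locally_integrable_def set_integrable_def
proof (intro allI impI)
  fix K assume K: "compact K \<and> K \<subseteq> C"
  then have "integrable lborel (\<lambda>x. indicator K x *\<^sub>R u x)" using assms by simp
  then show "integrable lebesgue (\<lambda>x. indicator K x *\<^sub>R u x)"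
    by (subst integrable_completion) auto
qed

lemma locally_integrable_integrable:
  fixes u :: "real ^ 'n \<Rightarrow> real"
  assumes "integrable lborel u"
  shows "locally_integrable C u"
proof (rule locally_integrable_borel)
  show "integrable lborel (\<lambda>x. indicator K x * u x)" if "compact K" for K
    using integrable_mult_indicator[OF _ assms, of K] that by (simp add: borel_compact)
qed

lemma locally_integrable_bounded:
  fixes u :: "real ^ 'n \<Rightarrow> real"
  assumes "u \<in> borel_measurable borel" "\<And>x. \<bar>u x\<bar> \<le> K"
  shows "locally_integrable C u"
proof (rule locally_integrable_borel)
  fix S :: "(real ^ 'n) set" assume S: "compact S"
  then obtain R where R: "\<And>x. x \<in> S \<Longrightarrow> norm x \<le> R" by (metis compact_imp_bounded bounded_iff)
  have out: "x \<notin> S" if "x \<notin> sym_cube R" for x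
  proof
    assume "x \<in> S"
    have "(\<chi> i. - R) $ j \<le> x $ j \<and> x $ j \<le> (\<chi> i. R) $ j" for j
      using R[OF \<open>x \<in> S\<close>] component_le_norm_cart[of x j] by (simp add: abs_le_iff)
    then show False using that by (simp add: mem_box_cart)
  qed
  have K0: "0 \<le> K" using assms(2)[of 0] by linarith
  have [measurable]: "S \<in> sets borel" using S by (rule borel_compact)
  show "integrable lborel (\<lambda>x. indicator S x * u x)"
  proof (rule integrable_bounded_cbox[where K=K])
    show "(\<lambda>x. indicator S x * u x) \<in> borel_measurable borel" using assms(1) by measurable
    show "\<bar>indicator S x * u x\<bar> \<le> K" for x using assms(2)[of x] K0 by (auto simp: indicator_def)
    show "indicator S x * u x = 0" if "x \<notin> sym_cube R" for x using out[OF that] by simp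
  qed
qed

text \<open>Test functions and their derivatives vanish off \<open>C\<close>, so the integrals over
  \<open>C\<close> in the definition are integrals over the whole space, and for Borel functions
  \<open>lborel\<close> may replace \<open>lebesgue\<close>.\<close>

lemma has_weak_partialsI:
  fixes u v :: "real ^ 'n \<Rightarrow> real"
  assumes C: "C \<in> sets borel" and u: "u \<in> borel_measurable borel" "locally_integrable C u"
    and v: "v \<in> borel_measurable borel" "locally_integrable C v"
    and eq: "\<And>\<phi>. test_function C \<phi> \<Longrightarrow>
      (LINT x|lborel. u x * partials is \<phi> x) = (- 1) ^ length is * (LINT x|lborel. v x * \<phi> x)"
  shows "has_weak_partials C is u v"
  unfolding has_weak_partials_def
proof (intro conjI allI impI u v)
  fix \<phi> assume \<phi>: "test_function C \<phi>"
  then have sm: "smooth \<phi>" and S: "closure {x. \<phi> x \<noteq> 0} \<subseteq> C" by (auto simp: test_function_def)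
  have conv: "(LINT x:C|lebesgue. w x * partials js \<phi> x) = (LINT x|lborel. w x * partials js \<phi> x)"
    if w: "w \<in> borel_measurable borel" for w js
  proof -
    have "partials js \<phi> x = 0" if "x \<notin> C" for x
    proof (rule partials_eq_0[of "- closure {x. \<phi> x \<noteq> 0}"])
      show "\<phi> x = 0" if "x \<in> - closure {x. \<phi> x \<noteq> 0}" for x
        using that closure_subset[of "{x. \<phi> x \<noteq> 0}"] by auto
    qed (use S that in auto)
    then have "(LINT x:C|lebesgue. w x * partials js \<phi> x) = (LINT x|lebesgue. w x * partials js \<phi> x)"
      unfolding set_lebesgue_integral_def by (intro Bochner_Integration.integral_cong) (auto simp: indicator_def)
    also have "\<dots> = (LINT x|lborel. w x * partials js \<phi> x)"
      using w smooth_partials_measurable[OF sm] by (intro integral_completion borel_measurable_times) auto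
    finally show ?thesis .
  qed
  show "(LINT x:C|lebesgue. u x * partials is \<phi> x) = (- 1) ^ length is * (LINT x:C|lebesgue. v x * \<phi> x)"
    using conv[OF u(1), of "is"] conv[OF v(1), of "[]"] eq[OF \<phi>] by (simp add: partials_def)
qed

lemma AE_lborel_borelI:
  assumes "AE x in lebesgue. P x" "{x. P x} \<in> sets borel"
  shows "AE x in lborel. P x"
  using assms by (subst (asm) AE_completion_iff) auto

section \<open>Null sets avoided by the gradient of the maximum norm\<close>

lemma AE_coords_distinct: "AE z :: real ^ 'n in lborel. \<forall>j k. j \<noteq> k \<longrightarrow> \<bar>z $ j\<bar> \<noteq> \<bar>z $ k\<bar>"
proof -
  have "AE z :: real ^ 'n in lborel. j \<noteq> k \<longrightarrow> \<bar>z $ j\<bar> \<noteq> \<bar>z $ k\<bar>" for j k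
  proof (cases "j = k")
    case False
    have ne: "AE z :: real ^ 'n in lborel. z $ j \<noteq> s * z $ k" for s
    proof -
      \<comment> \<open>Normal vector of the hyperplane z_j = s z_k; the values s = 1 and s = -1
        cover equality of moduli.\<close>
      let ?a = "axis j 1 - s *\<^sub>R axis k 1 :: real ^ 'n"
      have "?a $ j = 1" using False by (simp add: axis_def)
      then have "?a \<noteq> 0" by (metis zero_index zero_neq_one)
      then have "negligible {z. ?a \<bullet> z = 0}" by (intro negligible_hyperplane) auto
      moreover have "{z. ?a \<bullet> z = 0} = {z. z $ j = s * z $ k}"
        by (auto simp: inner_diff_left inner_axis' )
      ultimately have "{z :: real ^ 'n. z $ j = s * z $ k} \<in> null_sets lebesgue"
        by (simp add: negligible_iff_null_sets)
      then have "AE z in lebesgue. z \<notin> {z :: real ^ 'n. z $ j = s * z $ k}" by (rule AE_not_in)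
      then have "AE z :: real ^ 'n in lebesgue. z $ j \<noteq> s * z $ k" by simp
      moreover have "{z :: real ^ 'n. z $ j \<noteq> s * z $ k} \<in> sets borel"
        by (intro borel_open open_Collect_neq continuous_intros)
      ultimately show ?thesis by (rule AE_lborel_borelI)
    qed
    from ne[of 1] ne[of "-1"] show ?thesis
      by eventually_elim (auto simp: abs_eq_iff)
  qed simp
  then show ?thesis by (simp add: AE_all_countable)
qed

lemma AE_infnorm_neq: "AE z :: real ^ 'n in lborel. infnorm z \<noteq> r"
proof -
  have "AE z :: real ^ 'n in lborel. z $ k \<noteq> s" for k s
  proof -
    have "negligible {z :: real ^ 'n. axis k 1 \<bullet> z = s}"
      by (intro negligible_hyperplane) (simp add: axis_eq_0_iff)
    then have "{z :: real ^ 'n. z $ k = s} \<in> null_sets lebesgue"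
      by (simp add: negligible_iff_null_sets inner_axis')
    then have "AE z in lebesgue. z \<notin> {z :: real ^ 'n. z $ k = s}" by (rule AE_not_in)
    then have "AE z :: real ^ 'n in lebesgue. z $ k \<noteq> s" by simp
    moreover have "{z :: real ^ 'n. z $ k \<noteq> s} \<in> sets borel"
      by (intro borel_open open_Collect_neq continuous_intros)
    ultimately show ?thesis by (rule AE_lborel_borelI)
  qed
  then have "AE z :: real ^ 'n in lborel. \<forall>k. z $ k \<noteq> r \<and> z $ k \<noteq> - r"
    by (simp add: AE_all_countable)
  then show ?thesis
  proof eventually_elim
    case (elim z)
    then show ?case using infnorm_attained[of z] by (auto simp: abs_if split: if_splits)
  qed
qed

section \<open>The radial function and its weak gradient\<close>

context extremal
begin

definition g :: "real ^ 'n::{finite,linorder} \<Rightarrow> real" where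
  "g z = prof (infnorm z)"

text \<open>Chain rule: where one coordinate strictly dominates, the maximum norm has gradient
  sgn(z_i) e_i. The other points form a null set, and the value 0 there is a convention.\<close>

definition G :: "real ^ 'n::{finite,linorder} \<Rightarrow> real ^ 'n::{finite,linorder}" where
  "G z = (\<chi> i. if \<forall>j. j \<noteq> i \<longrightarrow> \<bar>z $ j\<bar> < \<bar>z $ i\<bar> then - wgt (infnorm z) * sgn (z $ i) else 0)"

lemma g_measurable [measurable]: "g \<in> borel_measurable borel"
  unfolding g_def[abs_def] by measurable

lemma G_measurable [measurable]: "(\<lambda>z. G z $ i) \<in> borel_measurable borel"
proof -
  have [measurable]: "(\<lambda>z :: real ^ 'n::{finite,linorder}. z $ j) \<in> borel_measurable borel" for j
    by (intro borel_measurable_continuous_onI continuous_intros)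
  show ?thesis unfolding G_def by simp
qed

lemma g_bounds: "0 \<le> g z" "g z \<le> prof 0" "\<bar>g z\<bar> \<le> prof 0"
  using prof_nonneg[of "infnorm z"] prof_antimono[OF infnorm_pos_le, of z] by (auto simp: g_def)

text \<open>At most one component of \<open>G\<close> is nonzero, so its dual norm does not exceed
  the radial slope.\<close>

lemma sum_abs_G_le: "(\<Sum>i\<in>UNIV. \<bar>G z $ i\<bar>) \<le> wgt (infnorm z)"
proof (cases "\<exists>i. \<forall>j. j \<noteq> i \<longrightarrow> \<bar>z $ j\<bar> < \<bar>z $ i\<bar>")
  case True
  then obtain i where i: "\<And>j. j \<noteq> i \<Longrightarrow> \<bar>z $ j\<bar> < \<bar>z $ i\<bar>" by blast
  have "G z $ j = 0" if "j \<noteq> i" for j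
    using i[OF that] that by (auto simp: G_def intro!: exI[of _ i])
  then have "(\<Sum>j\<in>UNIV. \<bar>G z $ j\<bar>) = \<bar>G z $ i\<bar>"
    by (subst sum.remove[of _ i]) auto
  also have "\<dots> \<le> wgt (infnorm z)"
    using wgt_nonneg[of "infnorm z"] by (auto simp: G_def abs_mult sgn_if)
  finally show ?thesis .
next
  case False
  then have "G z $ i = 0" for i by (auto simp: G_def)
  then show ?thesis using wgt_nonneg by simp
qed

lemma abs_G_le: "\<bar>G z $ i\<bar> \<le> wgt (infnorm z)"
  using member_le_sum[of i UNIV "\<lambda>i. \<bar>G z $ i\<bar>"] sum_abs_G_le[of z] by (auto intro: order_trans)

text \<open>The radial density of volume is bounded on [0, h], so integrability of
  \<open>wgt\<close> on the line suffices.\<close>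

lemma wgt_radial_integrable: "integrable lborel (\<lambda>z :: real ^ 'n::{finite,linorder}. wgt (infnorm z))"
proof (rule integrableI_nonneg)
  have "(\<integral>\<^sup>+z. ennreal (wgt (infnorm z)) \<partial>(lborel :: (real ^ 'n::{finite,linorder}) measure))
      = (\<integral>\<^sup>+z. indicator (corner_box 0 h) z * ennreal (wgt (infnorm z)) \<partial>(lborel :: (real ^ 'n::{finite,linorder}) measure))"
  proof (rule nn_integral_cong)
    show "ennreal (wgt (infnorm z)) = indicator (corner_box 0 h) z * ennreal (wgt (infnorm z))" for z :: "real ^ 'n::{finite,linorder}"
      by (cases "infnorm z \<le> h") (auto simp: mem_corner_box indicator_def wgt_def)
  qed
  also have "\<dots> = (\<integral>\<^sup>+r. ennreal (2 ^ (d - 0) * real d * r ^ (d - 1)) * indicator {0..h} r * ennreal (wgt r) \<partial>lborel)"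
    by (rule nn_integral_radial) auto
  also have "\<dots> \<le> (\<integral>\<^sup>+r. ennreal (2 ^ d * real d * h ^ (d - 1)) * ennreal (wgt r) \<partial>lborel)"
  proof (rule nn_integral_mono)
    fix r
    show "ennreal (2 ^ (d - 0) * real d * r ^ (d - 1)) * indicator {0..h} r * ennreal (wgt r) \<le> ennreal (2 ^ d * real d * h ^ (d - 1)) * ennreal (wgt r)"
      by (cases "r \<in> {0..h}") (auto intro!: mult_right_mono ennreal_leI mult_left_mono power_mono)
  qed
  also have "\<dots> = ennreal (2 ^ d * real d * h ^ (d - 1)) * (\<integral>\<^sup>+r. ennreal (wgt r) \<partial>lborel)"
    by (rule nn_integral_cmult) measurable
  also have "\<dots> < \<infinity>"
    using wgt_integrable wgt_nonneg by (simp add: ennreal_mult_less_top nn_integral_eq_integral)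
  finally show "(\<integral>\<^sup>+z. ennreal (wgt (infnorm z)) \<partial>(lborel :: (real ^ 'n::{finite,linorder}) measure)) < \<infinity>" .
qed (auto simp: wgt_nonneg)

lemma G_integrable: "integrable lborel (\<lambda>z. G z $ i)"
  by (rule Bochner_Integration.integrable_bound[OF wgt_radial_integrable]) (use abs_G_le wgt_nonneg in auto)

text \<open>The slope of \<open>prof\<close> may be unbounded at \<open>0\<close>, so the difference quotients of \<open>g\<close> are only
  dominated after cutting \<open>g\<close> off at a level set of the norm.\<close>

lemma truncated_quotient_tendsto:
  assumes \<epsilon>: "0 < \<epsilon>" "\<epsilon> < h" and z: "\<And>j k. j \<noteq> k \<Longrightarrow> \<bar>z $ j\<bar> \<noteq> \<bar>z $ k\<bar>" "infnorm z \<noteq> h" "infnorm z \<noteq> \<epsilon>"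
  shows "((\<lambda>t. (prof (max (infnorm (z + t *\<^sub>R axis i 1)) \<epsilon>) - prof (max (infnorm z) \<epsilon>)) / t) \<longlongrightarrow>
    (if infnorm z > \<epsilon> then G z $ i else 0)) (at 0)"
proof -
  let ?N = "\<lambda>t. infnorm (z + t *\<^sub>R axis i 1)"
  have cont: "isCont ?N 0" by (intro continuous_intros)
  have const: "((\<lambda>t. (prof (max (?N t) \<epsilon>) - prof (max (infnorm z) \<epsilon>)) / t) \<longlongrightarrow> 0) (at 0)"
    if "eventually (\<lambda>t. max (?N t) \<epsilon> = max (infnorm z) \<epsilon>) (at 0)"
    by (rule Lim_transform_eventually[OF tendsto_const]) (use that in eventually_elim, simp)
  show ?thesis
  proof (cases "infnorm z < \<epsilon>")
    case True
    have "eventually (\<lambda>t. ?N t < \<epsilon>) (at 0)"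
      using cont True by (intro order_tendstoD(2)[of ?N "infnorm z"]) (simp_all add: isCont_def)
    then have "eventually (\<lambda>t. max (?N t) \<epsilon> = max (infnorm z) \<epsilon>) (at 0)"
      using True by (auto elim!: eventually_mono)
    from const[OF this] True show ?thesis by simp
  next
    case False
    then have gt: "infnorm z > \<epsilon>" using z by simp
    obtain k where k: "infnorm z = \<bar>z $ k\<bar>" using infnorm_attained by blast
    have less: "\<bar>z $ j\<bar> < \<bar>z $ k\<bar>" if "j \<noteq> k" for j
      using component_le_infnorm_cart[of z j] z(1)[OF that] k by simp
    have zk: "\<bar>z $ k\<bar> > 0" using gt \<epsilon> k by simp
    have comp: "(z + t *\<^sub>R axis i 1) $ j = z $ j + (if j = i then t else 0)" for t j
      by (simp add: axis_def)
    show ?thesis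
    proof (cases "k = i")
      case True
      \<comment> \<open>Coordinate i still dominates after a small step, so the norm is |z_i + t|,
        which is linear in t with slope sgn(z_i).\<close>
      have ev: "eventually (\<lambda>t. ?N t = \<bar>z $ i\<bar> + sgn (z $ i) * t \<and> \<bar>z $ i\<bar> + sgn (z $ i) * t > \<epsilon>) (at 0)"
      proof -
        have e1: "eventually (\<lambda>t. \<forall>j\<in>UNIV - {i}. \<bar>z $ j\<bar> < \<bar>z $ i + t\<bar>) (at 0)"
        proof (intro eventually_ball_finite ballI)
          fix j assume "j \<in> UNIV - {i}"
          then have "\<bar>z $ j\<bar> < \<bar>z $ i\<bar>" using less True by simp
          moreover have "((\<lambda>t. \<bar>z $ i + t\<bar>) \<longlongrightarrow> \<bar>z $ i + 0\<bar>) (at 0)" by (intro tendsto_intros)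
          ultimately show "eventually (\<lambda>t. \<bar>z $ j\<bar> < \<bar>z $ i + t\<bar>) (at 0)"
            by (intro order_tendstoD(1)) auto
        qed simp
        have e2: "eventually (\<lambda>t. \<bar>t\<bar> < \<bar>z $ i\<bar>) (at (0::real))"
        proof -
          have "((\<lambda>t::real. \<bar>t\<bar>) \<longlongrightarrow> \<bar>0\<bar>) (at 0)" by (intro tendsto_intros)
          then show ?thesis using zk True by (intro order_tendstoD(2)) auto
        qed
        have e3: "eventually (\<lambda>t. \<epsilon> < \<bar>z $ i\<bar> + sgn (z $ i) * t) (at 0)"
        proof -
          have "((\<lambda>t. \<bar>z $ i\<bar> + sgn (z $ i) * t) \<longlongrightarrow> \<bar>z $ i\<bar> + sgn (z $ i) * 0) (at 0)" by (intro tendsto_intros)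
          then show ?thesis using gt k True by (intro order_tendstoD(1)) auto
        qed
        from e1 e2 e3 show ?thesis
        proof eventually_elim
          case (elim t)
          have a: "\<bar>z $ i + t\<bar> = \<bar>z $ i\<bar> + sgn (z $ i) * t"
            using elim(2) by (auto simp: sgn_if abs_if split: if_splits)
          have "?N t = \<bar>z $ i + t\<bar>"
          proof (rule antisym)
            show "?N t \<le> \<bar>z $ i + t\<bar>"
              unfolding infnorm_le_iff using elim(1) comp by (auto simp: less_imp_le)
            show "\<bar>z $ i + t\<bar> \<le> ?N t"
              using component_le_infnorm_cart[of "z + t *\<^sub>R axis i 1" i] comp by simp
          qed
          then show ?case using a elim(3) by simp
        qed
      qed
      have Gz: "G z $ i = - wgt \<bar>z $ i\<bar> * sgn (z $ i)"
        using less True k by (auto simp: G_def)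
      have "((\<lambda>t. prof (\<bar>z $ i\<bar> + sgn (z $ i) * t)) has_real_derivative - wgt (\<bar>z $ i\<bar> + sgn (z $ i) * 0) * sgn (z $ i)) (at 0)"
      proof (rule DERIV_chain2[of prof])
        show "(prof has_real_derivative - wgt (\<bar>z $ i\<bar> + sgn (z $ i) * 0)) (at (\<bar>z $ i\<bar> + sgn (z $ i) * 0))"
          using prof_has_derivative[of "\<bar>z $ i\<bar>"] zk z(2) k True by simp
        show "((\<lambda>t. \<bar>z $ i\<bar> + sgn (z $ i) * t) has_real_derivative sgn (z $ i)) (at 0)"
          by (auto intro!: derivative_eq_intros)
      qed
      then have lim: "((\<lambda>t. (prof (\<bar>z $ i\<bar> + sgn (z $ i) * t) - prof \<bar>z $ i\<bar>) / t) \<longlongrightarrow> G z $ i) (at 0)"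
        by (simp add: DERIV_def Gz)
      have "eventually (\<lambda>t. (prof (\<bar>z $ i\<bar> + sgn (z $ i) * t) - prof \<bar>z $ i\<bar>) / t
          = (prof (max (?N t) \<epsilon>) - prof (max (infnorm z) \<epsilon>)) / t) (at 0)"
        using ev
      proof eventually_elim
        case (elim t)
        then have "max (?N t) \<epsilon> = \<bar>z $ i\<bar> + sgn (z $ i) * t" by simp
        moreover have "max (infnorm z) \<epsilon> = \<bar>z $ i\<bar>" using gt k True by simp
        ultimately show ?case by (simp only:)
      qed
      from Lim_transform_eventually[OF lim this] gt show ?thesis by simp
    next
      case False
      \<comment> \<open>Another coordinate dominates, and a small step in direction i leaves the
        norm unchanged.\<close>
      have "eventually (\<lambda>t. \<bar>z $ i + t\<bar> < \<bar>z $ k\<bar>) (at 0)"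
      proof -
        have "((\<lambda>t. \<bar>z $ i + t\<bar>) \<longlongrightarrow> \<bar>z $ i + 0\<bar>) (at 0)" by (intro tendsto_intros)
        then show ?thesis using less[of i] False by (intro order_tendstoD(2)) auto
      qed
      then have "eventually (\<lambda>t. max (?N t) \<epsilon> = max (infnorm z) \<epsilon>) (at 0)"
      proof eventually_elim
        case (elim t)
        have "?N t = \<bar>z $ k\<bar>"
        proof (rule antisym)
          show "?N t \<le> \<bar>z $ k\<bar>"
            unfolding infnorm_le_iff using elim less comp by (auto simp: less_imp_le) (metis less_imp_le order_refl)
          show "\<bar>z $ k\<bar> \<le> ?N t"
            using component_le_infnorm_cart[of "z + t *\<^sub>R axis i 1" k] comp False by simp
        qed
        then show ?case using k by simp
      qed
      from const[OF this] have "((\<lambda>t. (prof (max (?N t) \<epsilon>) - prof (max (infnorm z) \<epsilon>)) / t) \<longlongrightarrow> 0) (at 0)" .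
      moreover have "G z $ i = 0" using less[of i] False by (auto simp: G_def intro!: exI[of _ k])
      ultimately show ?thesis using gt by simp
    qed
  qed
qed

text \<open>Beyond \<epsilon> the profile is Lipschitz, and the maximum norm changes by at most |t|
  along a coordinate direction; this is the domination that
  \<open>integral_partial_by_quotients\<close> asks for.\<close>

lemma truncated_weak_partial:
  assumes \<epsilon>: "0 < \<epsilon>" "\<epsilon> < h" and \<phi>: "test_function C \<phi>"
  shows "(LINT z|lborel. prof (max (infnorm z) \<epsilon>) * partial i \<phi> z)
    = - (LINT z|lborel. (if infnorm z > \<epsilon> then G z $ i else 0) * \<phi> z)"
proof (rule integral_partial_by_quotients[OF _ _ _ _ _ \<phi>])
  show "(\<lambda>z. prof (max (infnorm z) \<epsilon>)) \<in> borel_measurable borel" by measurable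
  show "(\<lambda>z. if infnorm z > \<epsilon> then G z $ i else 0) \<in> borel_measurable borel" by measurable
  show "\<bar>prof (max (infnorm z) \<epsilon>)\<bar> \<le> prof 0" for z :: "real ^ 'n::{finite,linorder}"
    using prof_nonneg prof_antimono[of 0 "max (infnorm z) \<epsilon>"] \<epsilon> by simp
  show "\<bar>prof (max (infnorm (z + t *\<^sub>R axis i 1)) \<epsilon>) - prof (max (infnorm z) \<epsilon>)\<bar> \<le> kern d h \<epsilon> powr (q - 1) * \<bar>t\<bar>"
    for z :: "real ^ 'n::{finite,linorder}" and t
  proof -
    have "\<bar>max (infnorm (z + t *\<^sub>R axis i 1)) \<epsilon> - max (infnorm z) \<epsilon>\<bar> \<le> \<bar>infnorm (z + t *\<^sub>R axis i 1) - infnorm z\<bar>"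
      by (auto simp: max_def abs_if)
    also have "\<dots> \<le> infnorm ((z + t *\<^sub>R axis i 1) - z)" by (rule absdiff_infnorm)
    also have "\<dots> = \<bar>t\<bar> * infnorm (axis i 1 :: real ^ 'n::{finite,linorder})"
      by (simp add: infnorm_mul)
    also have "\<dots> \<le> \<bar>t\<bar> * 1"
      by (intro mult_left_mono) (auto simp: infnorm_le_iff axis_def)
    also have "\<dots> = \<bar>t\<bar>" by simp
    finally have le: "\<bar>max (infnorm (z + t *\<^sub>R axis i 1)) \<epsilon> - max (infnorm z) \<epsilon>\<bar> \<le> \<bar>t\<bar>" .
    have "\<bar>prof (max (infnorm (z + t *\<^sub>R axis i 1)) \<epsilon>) - prof (max (infnorm z) \<epsilon>)\<bar>
      \<le> kern d h \<epsilon> powr (q - 1) * \<bar>max (infnorm (z + t *\<^sub>R axis i 1)) \<epsilon> - max (infnorm z) \<epsilon>\<bar>"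
      by (rule prof_Lipschitz[OF \<epsilon>]) auto
    also have "\<dots> \<le> kern d h \<epsilon> powr (q - 1) * \<bar>t\<bar>" by (intro mult_left_mono le) auto
    finally show ?thesis .
  qed
  have fl: "filterlim (\<lambda>n. 1 / (real n + 1)) (at 0) sequentially"
    by (intro filterlim_atI always_eventually) (real_asymp, auto)
  from AE_coords_distinct AE_infnorm_neq[of h] AE_infnorm_neq[of \<epsilon>]
  show "AE z in lborel. (\<lambda>n. (prof (max (infnorm (z + (1 / (real n + 1)) *\<^sub>R axis i 1)) \<epsilon>) - prof (max (infnorm z) \<epsilon>)) * (real n + 1))
     \<longlonglongrightarrow> (if infnorm z > \<epsilon> then G z $ i else 0)"
  proof eventually_elim
    case (elim z)
    have "((\<lambda>t. (prof (max (infnorm (z + t *\<^sub>R axis i 1)) \<epsilon>) - prof (max (infnorm z) \<epsilon>)) / t) \<longlongrightarrow>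
      (if infnorm z > \<epsilon> then G z $ i else 0)) (at 0)"
      by (rule truncated_quotient_tendsto[OF \<epsilon>]) (use elim in auto)
    from filterlim_compose[OF this fl] show ?case by simp
  qed
qed

text \<open>The truncation level tends to 0. One side is dominated by a multiple of |partial
  \<phi>|, the other by a multiple of |G|, which is integrable even where it is unbounded.\<close>

lemma weak_partial_g:
  assumes \<phi>: "test_function C \<phi>"
  shows "(LINT z|lborel. g z * partial i \<phi> z) = - (LINT z|lborel. G z $ i * \<phi> z)"
proof -
  define \<epsilon> where "\<epsilon> = (\<lambda>n. h / (real n + 2))"
  have \<epsilon>: "0 < \<epsilon> n" "\<epsilon> n < h" for n using h by (auto simp: \<epsilon>_def field_simps add_pos_nonneg)
  have \<epsilon>0: "\<epsilon> \<longlonglongrightarrow> 0" unfolding \<epsilon>_def by real_asymp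
  have smooth: "smooth \<phi>" using \<phi> by (simp add: test_function_def)
  obtain R where R: "R > 0" "\<And>is x. x \<notin> sym_cube R \<Longrightarrow> partials is \<phi> x = 0"
    and bd: "\<And>is. \<exists>K\<ge>0. \<forall>x. \<bar>partials is \<phi> x\<bar> \<le> K"
    using test_function_sym_cube[OF \<phi>] by metis
  have p0: "partials [] \<phi> = \<phi>" and p1: "partials [i] \<phi> = partial i \<phi>" by (simp_all add: partials_def)
  obtain M where M: "\<And>x. \<bar>\<phi> x\<bar> \<le> M" "0 \<le> M" using bd[of "[]"] p0 by auto
  obtain M' where M': "\<And>x. \<bar>partial i \<phi> x\<bar> \<le> M'" using bd[of "[i]"] p1 by auto
  have \<phi>m[measurable]: "\<phi> \<in> borel_measurable borel" "partial i \<phi> \<in> borel_measurable borel"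
    using smooth_partials_measurable[OF smooth, of "[]"] smooth_partials_measurable[OF smooth, of "[i]"] p0 p1 by auto
  have ev: "eventually (\<lambda>n. \<epsilon> n < infnorm z) sequentially" if "z \<noteq> 0" for z :: "real ^ 'n::{finite,linorder}"
    using order_tendstoD(2)[OF \<epsilon>0, of "infnorm z"] that by (simp add: infnorm_pos_lt)
  have "(\<lambda>n. LINT z|lborel. prof (max (infnorm z) (\<epsilon> n)) * partial i \<phi> z) \<longlonglongrightarrow> (LINT z|lborel. g z * partial i \<phi> z)"
  proof (rule integral_dominated_convergence[where w="\<lambda>z. prof 0 * \<bar>partial i \<phi> z\<bar>"])
    show "integrable lborel (\<lambda>z. prof 0 * \<bar>partial i \<phi> z\<bar>)"
      using M' R(2)[of _ "[i]"] p1 by (intro integrable_mult_right integrable_abs integrable_bounded_cbox[where K=M']) auto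
    have "AE z in lborel. z \<noteq> (0 :: real ^ 'n::{finite,linorder})" by (rule AE_lborel_singleton)
    then show "AE z in lborel. (\<lambda>n. prof (max (infnorm z) (\<epsilon> n)) * partial i \<phi> z) \<longlonglongrightarrow> g z * partial i \<phi> z"
    proof eventually_elim
      case (elim z)
      have "eventually (\<lambda>n. prof (max (infnorm z) (\<epsilon> n)) * partial i \<phi> z = g z * partial i \<phi> z) sequentially"
        using ev[OF elim] by eventually_elim (simp add: g_def max_def)
      then show ?case by (rule tendsto_eventually)
    qed
    show "AE z in lborel. norm (prof (max (infnorm z) (\<epsilon> n)) * partial i \<phi> z) \<le> prof 0 * \<bar>partial i \<phi> z\<bar>" for n
    proof (rule AE_I2)
      fix z :: "real ^ 'n::{finite,linorder}"
      have "\<bar>prof (max (infnorm z) (\<epsilon> n))\<bar> \<le> prof 0"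
        using prof_nonneg prof_antimono[of 0 "max (infnorm z) (\<epsilon> n)"] \<epsilon>(1)[of n] by simp
      then show "norm (prof (max (infnorm z) (\<epsilon> n)) * partial i \<phi> z) \<le> prof 0 * \<bar>partial i \<phi> z\<bar>"
        by (simp add: abs_mult mult_right_mono)
    qed
  qed measurable
  moreover have "(\<lambda>n. - (LINT z|lborel. (if infnorm z > \<epsilon> n then G z $ i else 0) * \<phi> z)) \<longlonglongrightarrow> - (LINT z|lborel. G z $ i * \<phi> z)"
  proof (intro tendsto_minus integral_dominated_convergence[where w="\<lambda>z. M * \<bar>G z $ i\<bar>"])
    show "integrable lborel (\<lambda>z. M * \<bar>G z $ i\<bar>)"
      by (intro integrable_mult_right integrable_abs G_integrable)
    have "AE z in lborel. z \<noteq> (0 :: real ^ 'n::{finite,linorder})" by (rule AE_lborel_singleton)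
    then show "AE z in lborel. (\<lambda>n. (if infnorm z > \<epsilon> n then G z $ i else 0) * \<phi> z) \<longlonglongrightarrow> G z $ i * \<phi> z"
    proof eventually_elim
      case (elim z)
      have "eventually (\<lambda>n. (if infnorm z > \<epsilon> n then G z $ i else 0) * \<phi> z = G z $ i * \<phi> z) sequentially"
        using ev[OF elim] by eventually_elim simp
      then show ?case by (rule tendsto_eventually)
    qed
    show "AE z in lborel. norm ((if infnorm z > \<epsilon> n then G z $ i else 0) * \<phi> z) \<le> M * \<bar>G z $ i\<bar>" for n
    proof (rule AE_I2)
      fix z
      have "\<bar>G z $ i\<bar> * \<bar>\<phi> z\<bar> \<le> \<bar>G z $ i\<bar> * M" using M by (intro mult_left_mono) auto
      then show "norm ((if infnorm z > \<epsilon> n then G z $ i else 0) * \<phi> z) \<le> M * \<bar>G z $ i\<bar>"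
        using M(2) by (auto simp: abs_mult mult.commute)
    qed
  qed measurable
  ultimately show ?thesis
    unfolding truncated_weak_partial[OF \<epsilon> \<phi>] by (rule LIMSEQ_unique)
qed

end

lemma measurable_lebesgue_on_borel: "u \<in> borel_measurable borel \<Longrightarrow> u \<in> borel_measurable (lebesgue_on C)"
  by (intro measurable_restrict_space1 measurable_completion) simp

section \<open>Norms of the extremal function and the equality case\<close>

context extremal
begin

abbreviation C :: "(real ^ 'n::{finite,linorder}) set" where "C \<equiv> orthant m"

lemma C_borel: "C \<in> sets borel" by measurable
lemma C_lebesgue: "C \<in> sets lebesgue" using C_borel by auto

lemma orthant_subset_corner_box: "z \<in> C \<Longrightarrow> infnorm z \<le> h \<Longrightarrow> z \<in> corner_box m h"
  by (auto simp: mem_corner_box orthant_def less_imp_le)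

text \<open>For finite p, p (q - 1) = q, so the p-th power of \<open>wgt\<close> is kern^q, whose
  integral over the box is \<open>J m\<close>. For p = \<infinity>, \<open>wgt\<close> is at most 1,
  which is \<open>J m\<close> to the power 0.\<close>

lemma Lp_radial_bound:
  fixes u :: "real ^ 'n::{finite,linorder} \<Rightarrow> real"
  assumes u: "u \<in> borel_measurable borel" and le: "\<And>z. \<bar>u z\<bar> \<le> wgt (infnorm z)"
  shows "in_Lp p C u" "Lp_norm p C u \<le> J m powr recip p"
proof -
  have um: "u \<in> borel_measurable (lebesgue_on C)" by (rule measurable_lebesgue_on_borel[OF u])
  have "in_Lp p C u \<and> Lp_norm p C u \<le> J m powr recip p"
  proof (cases "p = \<infinity>")
    case True
    then have "q = 1" unfolding q_def conj_exp_def by simp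
    then have "wgt r \<le> 1" for r by (simp add: wgt_def)
    then have "AE z in lebesgue. z \<in> C \<longrightarrow> \<bar>u z\<bar> \<le> 1"
      using le by (intro AE_I2 impI) (meson order_trans)
    from Linf_le[OF C_lebesgue um this] show ?thesis
      using True J_pos[of m] by (simp add: recip_def)
  next
    case False
    then obtain r where r: "p = ereal r" using p by (cases p) auto
    then have r1: "r > 1" using q_props(3) by (simp add: one_ereal_def)
    have "conj_exp p = r / (r - 1)" unfolding r conj_exp_def by simp
    then have "q = r / (r - 1)" unfolding q_def .
    then have qr: "(q - 1) * r = q" using r1 by (simp add: field_simps)
    have pt: "ennreal (\<bar>u z\<bar> powr r) * indicator C z \<le> indicator (corner_box m h) z * ennreal (kern d h (infnorm z) powr q)" for z
    proof (cases "z \<in> C \<and> 0 < infnorm z \<and> infnorm z < h")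
      case True
      have "\<bar>u z\<bar> powr r \<le> wgt (infnorm z) powr r"
        using le[of z] r1 by (intro powr_mono2) auto
      also have "\<dots> = kern d h (infnorm z) powr q"
        using True by (simp add: wgt_def powr_powr qr)
      finally show ?thesis
        using True orthant_subset_corner_box[of z] by (simp add: ennreal_leI)
    next
      case False
      then have "z \<notin> C \<or> u z = 0" using le[of z] by (auto simp: wgt_def split: if_splits)
      then show ?thesis by auto
    qed
    have nn: "(\<integral>\<^sup>+z. ennreal (\<bar>u z\<bar> powr r) \<partial>lebesgue_on C) \<le> ennreal (J m)"
    proof -
      have "(\<integral>\<^sup>+z. ennreal (\<bar>u z\<bar> powr r) \<partial>lebesgue_on C) = (\<integral>\<^sup>+z. ennreal (\<bar>u z\<bar> powr r) * indicator C z \<partial>lebesgue)"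
        using C_lebesgue by (subst nn_integral_restrict_space) auto
      also have "\<dots> = (\<integral>\<^sup>+z. ennreal (\<bar>u z\<bar> powr r) * indicator C z \<partial>lborel)"
        by (rule nn_integral_completion)
      also have "\<dots> \<le> ennreal (J m)"
        unfolding nn_integral_kern_corner_box[OF m, symmetric] by (intro nn_integral_mono pt)
      finally show ?thesis .
    qed
    have "integrable (lebesgue_on C) (\<lambda>z. \<bar>u z\<bar> powr r)"
    proof (rule integrableI_nonneg)
      show "(\<integral>\<^sup>+z. ennreal (\<bar>u z\<bar> powr r) \<partial>lebesgue_on C) < \<infinity>"
        using le_less_trans[OF nn ennreal_less_top] by simp
    qed (use um in auto)
    moreover have "(LINT z|lebesgue_on C. \<bar>u z\<bar> powr r) powr (1 / r) \<le> J m powr (1 / r)"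
    proof (rule powr_mono2)
      have "\<bar>LINT z|lebesgue_on C. \<bar>u z\<bar> powr r\<bar> \<le> J m"
        using nn J_pos[of m] by (intro abs_integral_le_nn_integral) auto
      then show "(LINT z|lebesgue_on C. \<bar>u z\<bar> powr r) \<le> J m" by simp
    qed (use r1 in \<open>auto intro: integral_nonneg_AE\<close>)
    ultimately show ?thesis using r um by (simp add: in_Lp_def Lp_norm_def recip_def)
  qed
  then show "in_Lp p C u" "Lp_norm p C u \<le> J m powr recip p" by auto
qed

definition u :: "real ^ 'n::{finite,linorder} \<Rightarrow> real" where
  "u y = indicator C y * g y"

lemma u_measurable [measurable]: "u \<in> borel_measurable borel"
  unfolding u_def[abs_def] by measurable

lemma u_nonneg: "0 \<le> u y" using g_bounds(1)[of y] by (simp add: u_def)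

lemma g_out: "z \<notin> sym_cube h \<Longrightarrow> g z = 0"
proof -
  assume z: "z \<notin> sym_cube h"
  have "\<not> infnorm z \<le> h"
  proof
    assume "infnorm z \<le> h"
    then have "- h \<le> z $ i \<and> z $ i \<le> h" for i
      by (auto simp: infnorm_le_iff abs_le_iff minus_le_iff)
    then show False using z by (simp add: mem_box_cart)
  qed
  then show ?thesis by (simp add: g_def prof_eq_0)
qed

lemma u_integrable: "integrable lborel u"
  by (rule integrable_bounded_cbox[where K="prof 0" and a="\<chi> i. - h" and b="\<chi> i. h"])
    (use g_bounds(3) prof_nonneg g_out in \<open>auto simp: u_def indicator_def\<close>)

text \<open>The product of signs over 2^d is a fundamental solution of the mixed derivative with sup
  norm 2^(-d). A product of Heaviside functions is another one, but its sup norm is 1 and the factor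
  2^d would be lost.\<close>

definition f :: "real ^ 'n::{finite,linorder} \<Rightarrow> real" where
  "f x = (LINT y|lborel. u y * (\<Prod>i\<in>UNIV. sgn (x $ i - y $ i))) / 2 ^ d"

lemma abs_prod_sgn_le: "\<bar>\<Prod>i\<in>I. sgn (a i :: real)\<bar> \<le> 1"
  unfolding abs_prod by (intro prod_le_1) (auto simp: sgn_if)

lemma prod_sgn_measurable [measurable]:
  "(\<lambda>(x, y). \<Prod>i\<in>UNIV. sgn (x $ i - y $ i)) \<in> borel_measurable (borel \<Otimes>\<^sub>M (borel :: (real ^ 'n::{finite,linorder}) measure))"
proof -
  have "(\<lambda>p :: (real ^ 'n::{finite,linorder}) \<times> (real ^ 'n::{finite,linorder}). fst p $ i - snd p $ i) \<in> borel_measurable (borel \<Otimes>\<^sub>M borel)" for i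
    unfolding borel_prod by (intro borel_measurable_continuous_onI continuous_intros)
  then show ?thesis
    unfolding case_prod_beta' by (intro borel_measurable_prod measurable_compose[OF _ borel_measurable_sgn])
qed

lemma f_measurable [measurable]: "f \<in> borel_measurable borel"
  unfolding f_def[abs_def] by measurable

lemma f_bound: "\<bar>f x\<bar> \<le> integral\<^sup>L lborel u / 2 ^ d"
proof -
  have le: "\<bar>u y * (\<Prod>i\<in>UNIV. sgn (x $ i - y $ i))\<bar> \<le> u y" for y
    using u_nonneg[of y] abs_prod_sgn_le[of "\<lambda>i. x $ i - y $ i" UNIV] by (simp add: abs_mult mult_left_le)
  have "(\<integral>\<^sup>+y. ennreal \<bar>u y * (\<Prod>i\<in>UNIV. sgn (x $ i - y $ i))\<bar> \<partial>lborel) \<le> (\<integral>\<^sup>+y. ennreal (u y) \<partial>lborel)"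
    by (intro nn_integral_mono ennreal_leI le)
  also have "\<dots> = ennreal (integral\<^sup>L lborel u)"
    using u_integrable u_nonneg by (intro nn_integral_eq_integral) auto
  finally have "\<bar>LINT y|lborel. u y * (\<Prod>i\<in>UNIV. sgn (x $ i - y $ i))\<bar> \<le> integral\<^sup>L lborel u"
    using u_nonneg by (intro abs_integral_le_nn_integral) (auto intro: integral_nonneg_AE)
  then show ?thesis by (simp add: f_def divide_right_mono)
qed

text \<open>Fubini's theorem reduces to a single source point y, where
  \<open>integral_sgn_mixed_partial\<close> gives (-2)^d \<phi>(y), and 2^d cancels. Test functions
  supported in \<open>C\<close> do not see that \<open>u\<close> cuts g off outside.\<close>

lemma mixed_f:
  assumes \<phi>: "test_function C \<phi>"
  shows "(LINT x|lborel. f x * partials (sorted_list_of_set UNIV) \<phi> x) = (- 1) ^ d * (LINT x|lborel. g x * \<phi> x)"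
proof -
  let ?is = "sorted_list_of_set (UNIV :: 'n::{finite,linorder} set)"
  let ?D = "\<lambda>x y. (\<Prod>i\<in>UNIV. sgn (x $ i - y $ i)) * partials ?is \<phi> x"
  have smooth: "smooth \<phi>" using \<phi> by (simp add: test_function_def)
  obtain R where R: "R > 0" "\<And>is x. x \<notin> sym_cube R \<Longrightarrow> partials is \<phi> x = 0"
    and bd: "\<And>is. \<exists>K\<ge>0. \<forall>x. \<bar>partials is \<phi> x\<bar> \<le> K"
    using test_function_sym_cube[OF \<phi>] by metis
  obtain K where K: "0 \<le> K" "\<And>x. \<bar>partials ?is \<phi> x\<bar> \<le> K" using bd[of ?is] by auto
  have pm[measurable]: "partials ?is \<phi> \<in> borel_measurable borel" by (rule smooth_partials_measurable[OF smooth])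
  have Dm: "(\<lambda>(x, y). ?D x y) \<in> borel_measurable (borel \<Otimes>\<^sub>M borel)"
    using borel_measurable_times[OF prod_sgn_measurable measurable_compose[OF measurable_fst pm]]
    by (simp add: case_prod_beta')
  have DK: "\<bar>?D x y\<bar> \<le> K" for x y
  proof -
    have "\<bar>\<Prod>i\<in>UNIV. sgn (x $ i - y $ i)\<bar> * \<bar>partials ?is \<phi> x\<bar> \<le> 1 * K"
      using K abs_prod_sgn_le by (intro mult_mono) auto
    then show ?thesis by (simp add: abs_mult)
  qed
  have inner: "(LINT x|lborel. indicator (sym_cube R) x * ?D x y) = (- 2) ^ d * \<phi> y" for y
  proof -
    have "(LINT x|lborel. indicator (sym_cube R) x * ?D x y) = (LINT x|lborel. ?D x y)"
      using R(2)[of _ ?is] by (intro Bochner_Integration.integral_cong) (auto simp: indicator_def)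
    also have "\<dots> = (LINT x|lborel. ?D (x + y) y)"
      by (rule lebesgue_integral_lborel_translate[symmetric]) (use measurable_compose[OF measurable_Pair2'[of y borel borel] Dm] Dm in measurable)
    also have "\<dots> = (- 2) ^ d * \<phi> y"
      using integral_sgn_mixed_partial[OF \<phi>, of y] by (simp add: d_def)
    finally show ?thesis .
  qed
  have "(LINT x|lborel. f x * partials ?is \<phi> x) = (LINT x|lborel. (1 / 2 ^ d) * (indicator (sym_cube R) x * (LINT y|lborel. u y * ?D x y)))"
  proof (rule Bochner_Integration.integral_cong[OF refl])
    fix x
    have "(LINT y|lborel. u y * ?D x y) = (LINT y|lborel. (u y * (\<Prod>i\<in>UNIV. sgn (x $ i - y $ i))) * partials ?is \<phi> x)"
      by (simp add: mult.assoc)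
    also have "\<dots> = (LINT y|lborel. u y * (\<Prod>i\<in>UNIV. sgn (x $ i - y $ i))) * partials ?is \<phi> x"
      by (rule integral_mult_left_zero)
    finally show "f x * partials ?is \<phi> x = (1 / 2 ^ d) * (indicator (sym_cube R) x * (LINT y|lborel. u y * ?D x y))"
      using R(2)[of x ?is] by (cases "x \<in> sym_cube R") (auto simp: f_def)
  qed
  also have "\<dots> = (1 / 2 ^ d) * (LINT x|lborel. indicator (sym_cube R) x * (LINT y|lborel. u y * ?D x y))"
    by (rule integral_mult_right_zero)
  also have "(LINT x|lborel. indicator (sym_cube R) x * (LINT y|lborel. u y * ?D x y)) = (LINT y|lborel. u y * (LINT x|lborel. indicator (sym_cube R) x * ?D x y))"
    by (rule Fubini_bounded_kernel(1)[OF u_integrable Dm DK borel_closed[OF closed_cbox] emeasure_lborel_cbox_finite, symmetric])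
  also have "\<dots> = (LINT y|lborel. (- 2) ^ d * (g y * \<phi> y))"
    unfolding inner
  proof (rule Bochner_Integration.integral_cong[OF refl])
    fix y
    have "\<phi> y = 0" if "y \<notin> C"
      using \<phi> that closure_subset[of "{x. \<phi> x \<noteq> 0}"] by (auto simp: test_function_def)
    then show "u y * ((- 2) ^ d * \<phi> y) = (- 2) ^ d * (g y * \<phi> y)"
      by (cases "y \<in> C") (auto simp: u_def)
  qed
  also have "\<dots> = (- 2) ^ d * (LINT y|lborel. g y * \<phi> y)" by (rule integral_mult_right_zero)
  finally have "(LINT x|lborel. f x * partials ?is \<phi> x) = ((1 / 2 ^ d) * (- 2) ^ d) * (LINT y|lborel. g y * \<phi> y)"
    by simp
  also have "(1 / 2 ^ d) * (- 2) ^ d = ((- 1) ^ d :: real)"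
    by (simp add: power_minus[of 2])
  finally show ?thesis .
qed

lemma g_integrable: "integrable lborel g"
  by (rule integrable_bounded_cbox[where K="prof 0"]) (use g_bounds(3) g_out in auto)

lemma admissible_extremal: "admissible C p f g G"
proof -
  have "0 \<le> integral\<^sup>L lborel u / 2 ^ d"
    using u_nonneg by (intro divide_nonneg_nonneg integral_nonneg_AE) auto
  then have "in_Lp \<infinity> C f"
    using f_bound by (intro Linf_le(1)[OF C_lebesgue measurable_lebesgue_on_borel[OF f_measurable], of "integral\<^sup>L lborel u / 2 ^ d"]) auto
  moreover have "has_mixed_deriv C f g"
    unfolding has_mixed_deriv_def
    using mixed_f by (intro has_weak_partialsI C_borel f_measurable g_measurable locally_integrable_bounded[OF f_measurable f_bound]
      locally_integrable_integrable g_integrable) (simp add: d_def)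
  moreover have "has_weak_gradient C g G"
    unfolding has_weak_gradient_def
    using weak_partial_g by (intro allI has_weak_partialsI C_borel g_measurable G_measurable
      locally_integrable_integrable g_integrable G_integrable) (simp add: partials_def)
  moreover have "in_Lp p C (\<lambda>z. G z $ i)" for i
    by (rule Lp_radial_bound(1)[OF G_measurable abs_G_le])
  ultimately show ?thesis
    using locally_integrable_integrable[OF g_integrable] by (auto simp: admissible_def in_W1_def)
qed

lemma Linf_norm_f_le: "2 ^ d * Lp_norm \<infinity> C f \<le> integral\<^sup>L lborel u"
proof -
  have "0 \<le> integral\<^sup>L lborel u / 2 ^ d"
    using u_nonneg by (intro divide_nonneg_nonneg integral_nonneg_AE) auto
  then have "Lp_norm \<infinity> C f \<le> integral\<^sup>L lborel u / 2 ^ d"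
    using f_bound by (intro Linf_le(2)[OF C_lebesgue measurable_lebesgue_on_borel[OF f_measurable]]) auto
  then show ?thesis by (simp add: field_simps)
qed

lemma Lp_norm_G_le: "Lp_norm p C (\<lambda>z. cube_dual_norm (G z)) \<le> J m powr recip p"
proof (rule Lp_radial_bound(2))
  show "(\<lambda>z. cube_dual_norm (G z)) \<in> borel_measurable borel"
    unfolding cube_dual_norm_eq_sum by measurable
  show "\<bar>cube_dual_norm (G z)\<bar> \<le> wgt (infnorm z)" for z
    unfolding cube_dual_norm_eq_sum using sum_abs_G_le[of z] by (simp add: sum_nonneg)
qed

text \<open>On the open cube (0, \<delta>)^d, which lies in \<open>C\<close> and has positive
  measure, g is at least \<open>prof \<delta>\<close>; \<delta> runs through h/(n+2), where
  \<open>prof\<close> tends to its value at 0.\<close>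

lemma Linf_norm_g_ge:
  assumes "in_Lp \<infinity> C g"
  shows "prof 0 \<le> Lp_norm \<infinity> C g"
proof (rule ccontr)
  assume "\<not> prof 0 \<le> Lp_norm \<infinity> C g"
  then have "eventually (\<lambda>n. Lp_norm \<infinity> C g < prof (h / (real n + 2))) sequentially"
    using prof_tendsto_0 by (intro order_tendstoD(1)) auto
  then obtain n where n: "Lp_norm \<infinity> C g < prof (h / (real n + 2))"
    by (auto simp: eventually_sequentially)
  define \<delta> where "\<delta> = h / (real n + 2)"
  have \<delta>: "\<delta> > 0" using h by (simp add: \<delta>_def add_nonneg_pos)
  let ?B = "box 0 (\<chi> i. \<delta>) :: (real ^ 'n::{finite,linorder}) set"
  have B: "z \<in> C \<and> infnorm z \<le> \<delta>" if "z \<in> ?B" for z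
    using that by (auto simp: mem_box_cart orthant_def infnorm_le_iff abs_le_iff less_imp_le intro: order_trans[of _ 0])
  have "AE z in lebesgue. z \<notin> ?B"
    using Linf_AE(1)[OF assms C_lebesgue]
  proof eventually_elim
    case (elim z)
    show ?case
    proof
      assume "z \<in> ?B"
      then have "\<bar>g z\<bar> \<le> Lp_norm \<infinity> C g" "infnorm z \<le> \<delta>" using elim B by auto
      then show False using prof_antimono[of "infnorm z" \<delta>] n by (simp add: g_def \<delta>_def)
    qed
  qed
  then have "?B \<in> null_sets lebesgue"
    by (subst (asm) AE_iff_null_sets[symmetric]) auto
  then have "negligible ?B" by (simp add: negligible_iff_null_sets)
  then have "?B = {}" by (simp add: negligible_interval)
  then show False using \<delta> by (simp add: interval_eq_empty_cart)
qed

text \<open>Tonelli's theorem with the profile written as an integral over s > r: the part of the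
  box within distance s has volume V s^d.\<close>

lemma integral_u_le: "ennreal (integral\<^sup>L lborel u) \<le> (\<integral>\<^sup>+s. ennreal (V * s ^ d * wgt s) \<partial>lborel)"
proof -
  have "ennreal (integral\<^sup>L lborel u) = (\<integral>\<^sup>+y. ennreal (u y) \<partial>lborel)"
    using u_integrable u_nonneg by (intro nn_integral_eq_integral[symmetric]) auto
  also have "\<dots> \<le> (\<integral>\<^sup>+y. indicator (corner_box m h) y * ennreal (prof (infnorm y)) \<partial>(lborel :: (real ^ 'n::{finite,linorder}) measure))"
  proof (rule nn_integral_mono)
    fix y
    show "ennreal (u y) \<le> indicator (corner_box m h) y * ennreal (prof (infnorm y))"
    proof (cases "y \<in> C \<and> infnorm y \<le> h")
      case True
      then show ?thesis using orthant_subset_corner_box[of y] by (simp add: u_def g_def)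
    next
      case False
      then have "u y = 0" by (auto simp: u_def g_def prof_eq_0 indicator_def)
      then show ?thesis by simp
    qed
  qed
  also have "\<dots> = (\<integral>\<^sup>+r. ennreal (V * real d * r ^ (d - 1)) * indicator {0..h} r * ennreal (prof r) \<partial>lborel)"
    unfolding V_def by (rule nn_integral_radial[OF m]) measurable
  also have "\<dots> = (\<integral>\<^sup>+r. (\<integral>\<^sup>+s. ennreal (V * real d * r ^ (d - 1)) * indicator {0..h} r * ennreal (if r < s then wgt s else 0) \<partial>lborel) \<partial>lborel)"
  proof (rule nn_integral_cong)
    fix r
    have "ennreal (prof r) = (\<integral>\<^sup>+s. ennreal (if r < s then wgt s else 0) \<partial>lborel)"
      unfolding prof_def by (rule nn_integral_eq_integral[OF prof_integrable, symmetric]) (auto simp: wgt_nonneg)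
    then show "ennreal (V * real d * r ^ (d - 1)) * indicator {0..h} r * ennreal (prof r)
      = (\<integral>\<^sup>+s. ennreal (V * real d * r ^ (d - 1)) * indicator {0..h} r * ennreal (if r < s then wgt s else 0) \<partial>lborel)"
      by (simp add: nn_integral_cmult)
  qed
  also have "\<dots> = (\<integral>\<^sup>+s. (\<integral>\<^sup>+r. ennreal (V * real d * r ^ (d - 1)) * indicator {0..h} r * ennreal (if r < s then wgt s else 0) \<partial>lborel) \<partial>lborel)"
    by (rule lborel_pair.Fubini') measurable
  also have "\<dots> = (\<integral>\<^sup>+s. ennreal (V * s ^ d * wgt s) \<partial>lborel)"
  proof (rule nn_integral_cong)
    fix s
    show "(\<integral>\<^sup>+r. ennreal (V * real d * r ^ (d - 1)) * indicator {0..h} r * ennreal (if r < s then wgt s else 0) \<partial>lborel) = ennreal (V * s ^ d * wgt s)"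
    proof (cases "0 < s \<and> s < h")
      case False
      then have "wgt s = 0" unfolding wgt_def by (rule if_not_P)
      then show ?thesis by (simp cong: if_cong)
    next
      case True
      have "(\<integral>\<^sup>+r. ennreal (V * real d * r ^ (d - 1)) * indicator {0..h} r * ennreal (if r < s then wgt s else 0) \<partial>lborel)
        = (\<integral>\<^sup>+r. ennreal (wgt s) * (ennreal (V * real d * r ^ (d - 1)) * indicator {0..s} r) \<partial>lborel)"
      proof (rule nn_integral_cong_AE)
        have "AE r in lborel. r \<noteq> s" by (rule AE_lborel_singleton)
        then show "AE r in lborel. ennreal (V * real d * r ^ (d - 1)) * indicator {0..h} r * ennreal (if r < s then wgt s else 0)
          = ennreal (wgt s) * (ennreal (V * real d * r ^ (d - 1)) * indicator {0..s} r)"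
          by eventually_elim (use True in \<open>auto simp: indicator_def mult.commute\<close>)
      qed
      also have "\<dots> = ennreal (wgt s) * (\<integral>\<^sup>+r. ennreal (V * real d * r ^ (d - 1)) * indicator {0..s} r \<partial>lborel)"
        by (rule nn_integral_cmult) measurable
      also have "(\<integral>\<^sup>+r. ennreal (V * real d * r ^ (d - 1)) * indicator {0..s} r \<partial>lborel) = ennreal (V * s ^ d - V * 0 ^ d)"
        by (rule nn_integral_FTC_Icc) (use True V_pos in \<open>auto intro!: derivative_eq_intros\<close>)
      also have "ennreal (wgt s) * ennreal (V * s ^ d - V * 0 ^ d) = ennreal (V * s ^ d * wgt s)"
        using True V_pos d_pos wgt_nonneg by (simp add: ennreal_mult[symmetric] power_0_left mult.commute)
      finally show ?thesis .
    qed
  qed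
  finally show ?thesis .
qed

text \<open>The integral of g and Hoelder's term are put under one integral over s, where s^d + (h^d
  - s^d) = h^d. Divided by V h^d, the result says that the average plus the gradient term is at most
  g(0).\<close>

lemma integral_u_J_le: "integral\<^sup>L lborel u + J m \<le> V * h ^ d * prof 0"
proof -
  have I0: "0 \<le> integral\<^sup>L lborel u" using u_nonneg by (intro integral_nonneg_AE) auto
  have "ennreal (integral\<^sup>L lborel u + J m) = ennreal (integral\<^sup>L lborel u) + ennreal (J m)"
    using I0 J_pos[of m] by (simp add: ennreal_plus)
  also have "\<dots> \<le> (\<integral>\<^sup>+s. ennreal (V * s ^ d * wgt s) \<partial>lborel) + (\<integral>\<^sup>+s. ennreal (V * (h ^ d - s ^ d) * wgt s) \<partial>lborel)"
    unfolding J_eq_wgt by (intro add_right_mono integral_u_le)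
  also have "\<dots> = (\<integral>\<^sup>+s. ennreal (V * s ^ d * wgt s) + ennreal (V * (h ^ d - s ^ d) * wgt s) \<partial>lborel)"
    by (rule nn_integral_add[symmetric]) measurable
  also have "\<dots> = (\<integral>\<^sup>+s. ennreal (V * h ^ d) * ennreal (wgt s) \<partial>lborel)"
  proof (rule nn_integral_cong)
    fix s
    show "ennreal (V * s ^ d * wgt s) + ennreal (V * (h ^ d - s ^ d) * wgt s) = ennreal (V * h ^ d) * ennreal (wgt s)"
    proof (cases "0 < s \<and> s < h")
      case True
      then have "s ^ d \<le> h ^ d" by (intro power_mono) auto
      then have "ennreal (V * s ^ d * wgt s) + ennreal (V * (h ^ d - s ^ d) * wgt s) = ennreal (V * s ^ d * wgt s + V * (h ^ d - s ^ d) * wgt s)"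
        using True V_pos wgt_nonneg by (intro ennreal_plus[symmetric]) auto
      also have "V * s ^ d * wgt s + V * (h ^ d - s ^ d) * wgt s = V * h ^ d * wgt s" by (simp add: algebra_simps)
      finally show ?thesis using V_pos h wgt_nonneg by (simp add: ennreal_mult)
    next
      case False
      then have "wgt s = 0" unfolding wgt_def by (rule if_not_P)
      then show ?thesis by simp
    qed
  qed
  also have "\<dots> = ennreal (V * h ^ d) * (\<integral>\<^sup>+s. ennreal (wgt s) \<partial>lborel)"
    by (rule nn_integral_cmult) measurable
  also have "\<dots> = ennreal (V * h ^ d * prof 0)"
    using V_pos h prof_nonneg[of 0] wgt_integrable wgt_nonneg by (simp add: nn_integral_eq_integral prof_0 ennreal_mult)
  finally show ?thesis
    using V_pos h prof_nonneg[of 0] by (subst (asm) ennreal_le_iff) auto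
qed

text \<open>The gradient norm contributes \<open>J m\<close> to the power 1/p and the kernel
  \<open>J m\<close> to the power 1/q; the exponents add up to 1, and \<open>integral_u_J_le\<close>
  applies.\<close>

lemma additive_bound_extremal: "additive_bound m p h f G \<le> prof 0"
proof -
  let ?N = "Lp_norm p C (\<lambda>z. cube_dual_norm (G z))" and ?F = "Lp_norm \<infinity> C f"
  have Jq: "J m powr (1 / q) = (2 ^ (d - m) * h ^ d) powr (1 / q) * (h * const_A d p)"
    unfolding J_def q_def by (rule Beta_powr_eq_const_A) (use p d_pos h in \<open>auto simp: d_def\<close>)
  have "additive_bound m p h f G = (2 ^ d * ?F + ?N * (2 ^ (d - m) * h ^ d) powr (1 / q) * (h * const_A d p)) / (2 ^ (d - m) * h ^ d)"
    unfolding additive_bound_def d_def[symmetric]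
    by (subst additive_bound_alt[OF _ h q_props(4)]) (use m in \<open>simp_all add: d_def mult_ac\<close>)
  also have "\<dots> = (2 ^ d * ?F + ?N * J m powr (1 / q)) / (V * h ^ d)"
    unfolding Jq V_def by (simp add: mult.assoc)
  also have "\<dots> \<le> (integral\<^sup>L lborel u + J m powr recip p * J m powr (1 / q)) / (V * h ^ d)"
    using V_pos h by (intro divide_right_mono add_mono mult_right_mono Linf_norm_f_le Lp_norm_G_le) auto
  also have "J m powr recip p * J m powr (1 / q) = J m"
    unfolding q_props(4) using J_pos[of m] by (simp add: powr_add[symmetric])
  also have "(integral\<^sup>L lborel u + J m) / (V * h ^ d) \<le> prof 0"
    using integral_u_J_le V_pos h by (simp add: divide_le_eq mult.commute)
  finally show ?thesis .
qed

text \<open>A squeeze: g(0) is at most the norm of g, the norm at most the additive bound, and this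
  at most g(0). The multiplicative bound lies between the norm and the additive bound at this h, so
  it equals both.\<close>

lemma sharp:
  "admissible C p f g G \<and> Lp_norm \<infinity> C g = additive_bound m p h f G \<and>
   Lp_norm \<infinity> C g = multiplicative_bound m p f G \<and> Lp_norm \<infinity> C g \<noteq> 0"
proof -
  note adm = admissible_extremal
  note add = additive_inequality(1,2)[OF m p h adm]
  have ge: "prof 0 \<le> Lp_norm \<infinity> C g" by (rule Linf_norm_g_ge[OF add(1)])
  then have pos: "0 < Lp_norm \<infinity> C g" using prof_pos by linarith
  have eq: "Lp_norm \<infinity> C g = additive_bound m p h f G"
    using add(2) ge additive_bound_extremal by linarith
  have "Lp_norm \<infinity> C g = multiplicative_bound m p f G"
    using multiplicative_inequality[OF m p adm] multiplicative_le_additive[OF m p adm pos h] eq by linarith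
  then show ?thesis using adm eq pos by simp
qed

end

theorem theorem4:
  fixes m :: nat and p :: ereal
  assumes "m \<le> CARD('n::{finite,linorder})" and "ereal (real CARD('n)) < p"
  shows
    "(\<forall>h>0. \<forall>(f :: real ^ 'n::{finite,linorder} \<Rightarrow> real) g G. admissible (orthant m) p f g G \<longrightarrow>
        in_Lp \<infinity> (orthant m) g \<and>
        Lp_norm \<infinity> (orthant m) g \<le> additive_bound m p h f G) \<and>
     (\<forall>(f :: real ^ 'n::{finite,linorder} \<Rightarrow> real) g G. admissible (orthant m) p f g G \<longrightarrow>
        in_Lp \<infinity> (orthant m) g \<and>
        Lp_norm \<infinity> (orthant m) g \<le> multiplicative_bound m p f G) \<and>
     (m = 0 \<or> m = 1 \<longrightarrow>
        (\<forall>h>0. \<exists>(f :: real ^ 'n::{finite,linorder} \<Rightarrow> real) g G. admissible (orthant m) p f g G \<and>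
           Lp_norm \<infinity> (orthant m) g = additive_bound m p h f G \<and>
           Lp_norm \<infinity> (orthant m) g \<noteq> 0) \<and>
        (\<exists>(f :: real ^ 'n::{finite,linorder} \<Rightarrow> real) g G. admissible (orthant m) p f g G \<and>
           Lp_norm \<infinity> (orthant m) g = multiplicative_bound m p f G \<and>
           Lp_norm \<infinity> (orthant m) g \<noteq> 0))"
proof -
  have ext: "extremal TYPE('n::{finite,linorder}) m p h" if "h > 0" for h
    using assms that by unfold_locales
  note sharp = extremal.sharp[OF ext]
  show ?thesis
  proof (intro conjI allI impI)
    show "\<exists>(f :: real ^ 'n::{finite,linorder} \<Rightarrow> real) g G. admissible (orthant m) p f g G \<and>
           Lp_norm \<infinity> (orthant m) g = additive_bound m p h f G \<and> Lp_norm \<infinity> (orthant m) g \<noteq> 0" if "h > 0" for h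
      using sharp[OF that] by blast
    \<comment> \<open>The multiplicative bound contains no h, so an extremal function of any scale
      serves.\<close>
    show "\<exists>(f :: real ^ 'n::{finite,linorder} \<Rightarrow> real) g G. admissible (orthant m) p f g G \<and>
           Lp_norm \<infinity> (orthant m) g = multiplicative_bound m p f G \<and> Lp_norm \<infinity> (orthant m) g \<noteq> 0"
      using sharp[OF zero_less_one] by blast
  qed (rule additive_inequality(1,2)[OF assms] additive_inequality(1)[OF assms zero_less_one]
      multiplicative_inequality[OF assms]; assumption)+
qed

end
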